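(* Let $a$ be a positive cubefree integer, and let $c_p$ and $\widetilde c_p$ denote the local Tamagawa numbers at a prime $p$ of $E_{C_3^0}(a)$ and $\widetilde E_{C_3^0}(a)$, respectively. Then $E_{C_3^0}(a)$ (equivalently $\widetilde E_{C_3^0}(a)$) has bad reduction at $p$ if and only if $p\mid 3a$, and: (i) if $p\neq 3$ and $p\mid a$, then $c_p=3$, and $\widetilde c_p=3$ if $p\equiv 1\pmod 6$, while $\widetilde c_p=1$ if $p\equiv 2,5\pmod 6$; (ii) at $p=3$: if $a\equiv \pm1\pmod 9$ then $(c_3,\widetilde c_3)=(1,3)$; if $a\equiv\pm 2\pmod 9$ then $(c_3,\widetilde c_3)=(2,2)$; if $a\equiv \pm 4\pmod 9$ then $(c_3,\widetilde c_3)=(1,1)$; if $a\equiv 0\pmod 3$ then $(c_3,\widetilde c_3)=(3,1)$.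
   Context: For an integer $a\neq 0$, $E_{C_3^0}(a)$ is the elliptic curve $y^2+ay=x^3$ over $\mathbb{Q}$, which has the rational point $(0,0)$ of order $3$, and $\widetilde E_{C_3^0}(a)$ is the elliptic curve $y^2+ay=x^3-7a^2$, which is a model of the $3$-isogenous curve $E_{C_3^0}(a)/\langle (0,0)\rangle$. The local Tamagawa number at $p$ of an elliptic curve $E/\mathbb{Q}$ is $c_p=[E(\mathbb{Q}_p):E_0(\mathbb{Q}_p)]$, computed with respect to a $p$-minimal model, where $E_0$ denotes the points of nonsingular reduction. *)

theory Defs
  imports Complex_Main "HOL-Computational_Algebra.Primes"
begin

definition rat_val :: "nat \<Rightarrow> rat \<Rightarrow> int" where
  "rat_val p q = (case quotient_of q of (n, d) \<Rightarrow>
      int (multiplicity (int p) n) - int (multiplicity (int p) d))"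

definition p_integral :: "nat \<Rightarrow> rat \<Rightarrow> bool" where
  "p_integral p q \<longleftrightarrow> q = 0 \<or> rat_val p q \<ge> 0"

section \<open>Q_p as p-adic Cauchy sequences of rationals (modulo null sequences)\<close>

type_synonym pseq = "nat \<Rightarrow> rat"

definition pcauchy :: "nat \<Rightarrow> pseq \<Rightarrow> bool" where
  "pcauchy p x \<longleftrightarrow> (\<forall>k. \<exists>N. \<forall>m\<ge>N. \<forall>n\<ge>N. x m = x n \<or> rat_val p (x m - x n) \<ge> k)"

text \<open>v_p(lim x) \<ge> k\<close>
definition pge :: "nat \<Rightarrow> pseq \<Rightarrow> int \<Rightarrow> bool" where
  "pge p x k \<longleftrightarrow> (\<exists>N. \<forall>m\<ge>N. x m = 0 \<or> rat_val p (x m) \<ge> k)"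

definition pnull :: "nat \<Rightarrow> pseq \<Rightarrow> bool" where
  "pnull p x \<longleftrightarrow> (\<forall>k. pge p x k)"

definition peq :: "nat \<Rightarrow> pseq \<Rightarrow> pseq \<Rightarrow> bool" where
  "peq p x y \<longleftrightarrow> pnull p (\<lambda>n. x n - y n)"

section \<open>Weierstrass curves y^2 + a1 xy + a3 y = x^3 + a2 x^2 + a4 x + a6\<close>

type_synonym wcoeffs = "rat \<times> rat \<times> rat \<times> rat \<times> rat"

definition disc :: "wcoeffs \<Rightarrow> rat" where
  "disc A = (case A of (a1, a2, a3, a4, a6) \<Rightarrow>
     let b2 = a1^2 + 4*a2; b4 = 2*a4 + a1*a3; b6 = a3^2 + 4*a6;
         b8 = a1^2*a6 + 4*a2*a6 - a1*a3*a4 + a2*a3^2 - a4^2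
     in -(b2^2*b8) - 8*b4^3 - 27*b6^2 + 9*b2*b4*b6)"

text \<open>Change of variables x = u^2 x' + r, y = u^3 y' + s u^2 x' + t (Silverman, Table 3.1).\<close>
definition chg :: "wcoeffs \<Rightarrow> rat \<Rightarrow> rat \<Rightarrow> rat \<Rightarrow> rat \<Rightarrow> wcoeffs" where
  "chg A u r s t = (case A of (a1, a2, a3, a4, a6) \<Rightarrow>
     ((a1 + 2*s) / u,
      (a2 - s*a1 + 3*r - s^2) / u^2,
      (a3 + r*a1 + 2*t) / u^3,
      (a4 - s*a3 + 2*r*a2 - (t + r*s)*a1 + 3*r^2 - 2*s*t) / u^4,
      (a6 + r*a4 + r^2*a2 + r^3 - t*a3 - t^2 - r*t*a1) / u^6))"

definition is_model :: "wcoeffs \<Rightarrow> wcoeffs \<Rightarrow> bool" where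
  "is_model A B \<longleftrightarrow> (\<exists>u r s t. u \<noteq> 0 \<and> B = chg A u r s t)"

definition integral_model :: "nat \<Rightarrow> wcoeffs \<Rightarrow> bool" where
  "integral_model p B = (case B of (a1, a2, a3, a4, a6) \<Rightarrow>
     p_integral p a1 \<and> p_integral p a2 \<and> p_integral p a3 \<and> p_integral p a4 \<and> p_integral p a6)"

definition p_minimal :: "nat \<Rightarrow> wcoeffs \<Rightarrow> wcoeffs \<Rightarrow> bool" where
  "p_minimal p A B \<longleftrightarrow> is_model A B \<and> integral_model p B \<and>
     (\<forall>C. is_model A C \<and> integral_model p C \<longrightarrow> rat_val p (disc B) \<le> rat_val p (disc C))"

definition min_model :: "nat \<Rightarrow> wcoeffs \<Rightarrow> wcoeffs" where
  "min_model p A = (SOME B. p_minimal p A B)"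

definition bad_reduction :: "nat \<Rightarrow> wcoeffs \<Rightarrow> bool" where
  "bad_reduction p A \<longleftrightarrow> rat_val p (disc (min_model p A)) > 0"

type_synonym ppoint = "(pseq \<times> pseq) option"  \<comment> \<open>None = point at infinity\<close>

definition Epts :: "nat \<Rightarrow> wcoeffs \<Rightarrow> ppoint set" where
  "Epts p A = (case A of (a1, a2, a3, a4, a6) \<Rightarrow>
     insert None {Some (x, y) | x y. pcauchy p x \<and> pcauchy p y \<and>
        peq p (\<lambda>n. y n ^ 2 + a1 * x n * y n + a3 * y n)
              (\<lambda>n. x n ^ 3 + a2 * x n ^ 2 + a4 * x n + a6)})"

definition wneg :: "wcoeffs \<Rightarrow> ppoint \<Rightarrow> ppoint" where
  "wneg A P = (case A of (a1, a2, a3, a4, a6) \<Rightarrow>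
     (case P of None \<Rightarrow> None | Some (x, y) \<Rightarrow> Some (x, \<lambda>n. - y n - a1 * x n - a3)))"

definition wadd :: "nat \<Rightarrow> wcoeffs \<Rightarrow> ppoint \<Rightarrow> ppoint \<Rightarrow> ppoint" where
  "wadd p A P Q = (case A of (a1, a2, a3, a4, a6) \<Rightarrow>
     (case P of None \<Rightarrow> Q | Some (x1, y1) \<Rightarrow>
      (case Q of None \<Rightarrow> P | Some (x2, y2) \<Rightarrow>
        if peq p x1 x2 \<and> pnull p (\<lambda>n. y1 n + y2 n + a1 * x2 n + a3) then None
        else
          let lam = (if peq p x1 x2
                     then (\<lambda>n. (3 * x1 n ^ 2 + 2 * a2 * x1 n + a4 - a1 * y1 n)
                                / (2 * y1 n + a1 * x1 n + a3))
                     else (\<lambda>n. (y2 n - y1 n) / (x2 n - x1 n)));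
              nu = (if peq p x1 x2
                     then (\<lambda>n. (-(x1 n ^ 3) + a4 * x1 n + 2 * a6 - a3 * y1 n)
                                / (2 * y1 n + a1 * x1 n + a3))
                     else (\<lambda>n. (y1 n * x2 n - y2 n * x1 n) / (x2 n - x1 n)));
              x3 = (\<lambda>n. lam n ^ 2 + a1 * lam n - a2 - x1 n - x2 n)
          in Some (x3, \<lambda>n. - (lam n + a1) * x3 n - nu n - a3))))"

text \<open>E_0(Q_p): points with nonsingular reduction (for a p-integral model).
  A point with v_p(x) < 0 reduces to the point at infinity, which is nonsingular;
  an integral point reduces to a singular point iff both partials vanish mod p.\<close>
definition E0pts :: "nat \<Rightarrow> wcoeffs \<Rightarrow> ppoint set" where
  "E0pts p A = (case A of (a1, a2, a3, a4, a6) \<Rightarrow>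
     {P \<in> Epts p A. case P of None \<Rightarrow> True | Some (x, y) \<Rightarrow>
        \<not> pge p x 0 \<or>
        \<not> (pge p (\<lambda>n. a1 * y n - 3 * x n ^ 2 - 2 * a2 * x n - a4) 1 \<and>
           pge p (\<lambda>n. 2 * y n + a1 * x n + a3) 1)})"

definition E0_index :: "nat \<Rightarrow> wcoeffs \<Rightarrow> nat" where
  "E0_index p A = card (Epts p A //
     {(P, Q). P \<in> Epts p A \<and> Q \<in> Epts p A \<and> wadd p A P (wneg A Q) \<in> E0pts p A})"

definition tamagawa :: "nat \<Rightarrow> wcoeffs \<Rightarrow> nat" where
  "tamagawa p A = E0_index p (min_model p A)"

definition E_C3 :: "int \<Rightarrow> wcoeffs" where
  "E_C3 a = (0, 0, of_int a, 0, 0)"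

definition Et_C3 :: "int \<Rightarrow> wcoeffs" where
  "Et_C3 a = (0, 0, of_int a, 0, - 7 * (of_int a)^2)"

definition cubefree :: "int \<Rightarrow> bool" where
  "cubefree a \<longleftrightarrow> (\<forall>q::nat. prime q \<longrightarrow> \<not> (int q ^ 3 dvd a))"

end

theory Submission
  imports Defs "HOL-Number_Theory.Number_Theory"
begin

text \<open>
  No field of p-adic numbers is constructed: points are handled through rational approximations
  \<open>(x n, y n)\<close> for large \<open>n\<close>, at which the curve equation and the chord relations hold up to an error of
  high valuation. At a bad prime the curve is moved by a rational change of variables to a minimal model \<open>T\<close> with
  \<open>a\<^sub>1 = 0\<close> whose reduction is singular at the origin, as in Tate's algorithm. Whether \<open>P - Q\<close> has
  nonsingular reduction is then read off from valuations of the slope of the chord through \<open>P\<close> and \<open>-Q\<close>: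
  a chord through a nonsingular and a singular point meets the curve again in a singular point, and for two
  singular points the relation
  \<open>l (y\<^sub>1 + y\<^sub>2 + A\<^sub>3) = z\<^sub>1\<^sup>2 + z\<^sub>1 z\<^sub>2 + z\<^sub>2\<^sup>2 + A\<^sub>2 (z\<^sub>1 + z\<^sub>2) + A\<^sub>4\<close> decides whether the slope \<open>l\<close> is divisible by \<open>p\<close>.
  So the index of \<open>E\<^sub>0\<close> is the number of values of an explicit component map, without using associativity of
  the group law. Nontrivial components are hit by points coming from 3-adic cube roots or p-adic cube roots
  of unity.
\<close>

section \<open>The p-adic valuation on the rationals\<close>

text \<open>Completing the square turns the curves into y^2 = x^3 + a^2/4 and y^2 = x^3 - 27 a^2/4,
  with discriminants -3^3 a^4 and -3^9 a^4. As \<open>a\<close> is cubefree, v(a) <= 2, so both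
  valuations stay below 12 except for the second curve at 3 when 3 divides \<open>a\<close>. There
  the valuation is 17 or 13: in the first case the model can be rescaled by 3, in the second only c6
  shows that it cannot. All bad reduction here is cuspidal, so there is a single singular point
  modulo p to move to the origin. At p different from 3 the types are IV and IV*, and the second
  curve splits exactly when -3 is a square mod p. At 3 with \<open>a\<close> prime to 3, the first
  curve has type III if a^2 = 4 mod 9 and type II otherwise; the second has type III* if a^2 = 4 mod
  9 and IV* otherwise, split for a^2 = 1 and nonsplit for a^2 = 7. If 3 divides \<open>a\<close>,
  the first curve has type IV or IV* and the second II* or II. Index 1 is obtained by showing that
  no p-adic point reduces to the cusp, which is why nonsplit IV and IV* need no component group of
  their own.\<close>

text \<open>\<open>rat_val p 0\<close> evaluates to 0 because \<open>multiplicity\<close> returns 0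
  at 0. The clause for zero restores infinite valuation, without which the predicate would not be
  closed under addition.\<close>

definition vge :: "nat \<Rightarrow> int \<Rightarrow> rat \<Rightarrow> bool" where
  "vge p k q \<longleftrightarrow> q = 0 \<or> k \<le> rat_val p q"

locale padic =
  fixes p :: nat
  assumes p: "prime p"
begin

abbreviation V :: "int \<Rightarrow> rat \<Rightarrow> bool" where "V \<equiv> vge p"

lemma prime_int: "prime (int p)"
  using p by simp

lemma rat_val_quotient:
  assumes "n \<noteq> 0" "d \<noteq> 0"
  shows "rat_val p (of_int n / of_int d) = int (multiplicity (int p) n) - int (multiplicity (int p) d)"
proof -
  obtain n' d' where q: "quotient_of (of_int n / of_int d) = (n', d')" by force
  have d': "d' > 0" using quotient_of_denom_pos[OF q] .
  have "(of_int n / of_int d :: rat) = of_int n' / of_int d'"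
    using quotient_of_div[OF q] .
  then have "(of_int (n * d') :: rat) = of_int (n' * d)"
    using assms d' by (simp add: field_simps)
  then have e: "n * d' = n' * d" using of_int_eq_iff by blast
  have n': "n' \<noteq> 0" using e assms d' by auto
  have "multiplicity (int p) n + multiplicity (int p) d' = multiplicity (int p) n' + multiplicity (int p) d"
    using arg_cong[OF e, of "multiplicity (int p)"] assms d' n' prime_int
    by (simp add: prime_elem_multiplicity_mult_distrib)
  then show ?thesis unfolding rat_val_def q by simp
qed

lemma rat_quotientE:
  fixes q :: rat
  assumes "q \<noteq> 0"
  obtains n d :: int where "q = of_int n / of_int d" "n \<noteq> 0" "d \<noteq> 0"
proof -
  obtain n d where q: "quotient_of q = (n, d)" by force
  show ?thesis
    using that[of n d] quotient_of_div[OF q] quotient_of_denom_pos[OF q] assms by auto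
qed

lemma rat_val_mult:
  assumes "x \<noteq> 0" "y \<noteq> 0"
  shows "rat_val p (x * y) = rat_val p x + rat_val p y"
proof -
  obtain a b where x: "x = of_int a / of_int b" "a \<noteq> 0" "b \<noteq> 0" using rat_quotientE assms by blast
  obtain c d where y: "y = of_int c / of_int d" "c \<noteq> 0" "d \<noteq> 0" using rat_quotientE assms by blast
  have "x * y = of_int (a * c) / of_int (b * d)" using x y by simp
  then show ?thesis
    using rat_val_quotient[of a b] rat_val_quotient[of c d] rat_val_quotient[of "a * c" "b * d"] x y prime_int
    by (simp add: prime_elem_multiplicity_mult_distrib)
qed

lemma rat_val_1 [simp]: "rat_val p 1 = 0"
  using rat_val_quotient[of 1 1] by simp

lemma rat_val_of_int: "n \<noteq> 0 \<Longrightarrow> rat_val p (of_int n) = int (multiplicity (int p) n)"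
  using rat_val_quotient[of n 1] by simp

lemma rat_val_minus [simp]: "rat_val p (- x) = rat_val p x"
proof (cases "x = 0")
  case False
  have "rat_val p ((-1) * (-1)) = rat_val p (-1) + rat_val p (-1)" by (rule rat_val_mult) auto
  then have "rat_val p (-1) = 0" by simp
  then show ?thesis using rat_val_mult[of "-1" x] False by simp
qed simp

lemma rat_val_inverse:
  assumes "x \<noteq> 0"
  shows "rat_val p (inverse x) = - rat_val p x"
  using rat_val_mult[of x "inverse x"] assms by simp

lemma rat_val_divide:
  assumes "x \<noteq> 0" "y \<noteq> 0"
  shows "rat_val p (x / y) = rat_val p x - rat_val p y"
  using rat_val_mult[of x "inverse y"] rat_val_inverse[of y] assms by (simp add: divide_inverse)

lemma rat_val_power: "x \<noteq> 0 \<Longrightarrow> rat_val p (x ^ n) = int n * rat_val p x"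
  by (induction n) (auto simp: rat_val_mult algebra_simps)

lemma vge_0 [simp]: "V k 0"
  by (simp add: vge_def)

lemma vge_mono: "V k x \<Longrightarrow> j \<le> k \<Longrightarrow> V j x"
  by (auto simp: vge_def)

lemma vge_minus [simp]: "V k (- x) \<longleftrightarrow> V k x"
  by (simp add: vge_def)

lemma vge_mult: "V i x \<Longrightarrow> V j y \<Longrightarrow> V (i + j) (x * y)"
  by (cases "x = 0 \<or> y = 0") (auto simp: vge_def rat_val_mult)

lemma vge_of_int [simp]: "V 0 (of_int n)"
  by (cases "n = 0") (auto simp: vge_def rat_val_of_int)

lemma vge_numeral [simp]: "V 0 (numeral n)"
  using vge_of_int[of "numeral n"] by simp

lemma vge_1 [simp]: "V 0 1"
  using vge_of_int[of 1] by simp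

lemma vge_of_int_iff: "V (int k) (of_int n) \<longleftrightarrow> int p ^ k dvd n"
proof (cases "n = 0")
  case False
  then show ?thesis
    using power_dvd_iff_le_multiplicity[of n "int p" k] prime_gt_1_nat[OF p]
    by (auto simp: vge_def rat_val_of_int not_prime_unit)
qed simp

lemma vge_of_int_1: "V 1 (of_int n) \<longleftrightarrow> int p dvd n"
  using vge_of_int_iff[of 1 n] by simp

lemma vge_0_denominator:
  assumes "V 0 x"
  obtains n d :: int where "x = of_int n / of_int d" "\<not> int p dvd d"
proof (cases "x = 0")
  case True
  show ?thesis using that[of 0 1] True prime_int not_prime_unit by auto
next
  case False
  obtain n d where q: "quotient_of x = (n, d)" by force
  have x: "x = of_int n / of_int d" and d: "d > 0"
    using quotient_of_div[OF q] quotient_of_denom_pos[OF q] by auto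
  have c: "coprime n d" using quotient_of_coprime[OF q] .
  have n: "n \<noteq> 0" using False x by auto
  have "multiplicity (int p) d \<le> multiplicity (int p) n"
    using assms False rat_val_quotient[of n d] n d x by (auto simp: vge_def)
  then have "\<not> int p dvd d"
    using c n d prime_int
    by (metis coprime_common_divisor dvd_refl linorder_not_less multiplicity_gt_zero_iff
        not_prime_unit order.strict_trans2 power_one_right less_numeral_extra(3)
        multiplicity_eq_zero_iff le_zero_eq)
  then show ?thesis using that x by blast
qed

text \<open>Dividing by the summand of smaller valuation reduces the claim to \<open>1 + w\<close>
  with \<open>w\<close> integral, where a denominator prime to \<open>p\<close> can be used.\<close>

lemma vge_add:
  assumes "V k x" "V k y"
  shows "V k (x + y)"
proof -
  have one: "V 0 (1 + w)" if w0: "V 0 w" for w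
  proof -
    obtain n d :: int where w: "w = of_int n / of_int d" "\<not> int p dvd d" by (rule vge_0_denominator[OF w0])
    have d: "d \<noteq> 0" using w by auto
    have "1 + w = of_int (n + d) / of_int d" using w d by (simp add: field_simps)
    moreover have "multiplicity (int p) d = 0" using w(2) by (simp add: not_dvd_imp_multiplicity_0)
    ultimately show ?thesis
      using rat_val_quotient[of "n + d" d] d by (cases "n + d = 0") (auto simp: vge_def)
  qed
  have main: "V k (x + y)" if "V k x" "x \<noteq> 0" "y \<noteq> 0" "rat_val p x \<le> rat_val p y" for x y
  proof -
    have "V 0 (y / x)" using that by (simp add: vge_def rat_val_divide)
    then have "V (k + 0) (x * (1 + y / x))" using that by (intro vge_mult one)
    moreover have "x * (1 + y / x) = x + y" using that by (simp add: distrib_left)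
    ultimately show ?thesis by simp
  qed
  show ?thesis
    using assms main[of x y] main[of y x] linear[of "rat_val p x" "rat_val p y"]
    by (cases "x = 0"; cases "y = 0") (auto simp: add.commute)
qed

lemma vge_diff: "V k x \<Longrightarrow> V k y \<Longrightarrow> V k (x - y)"
  using vge_add[of k x "- y"] by simp

lemma vge_diff_commute: "V k (x - y) \<longleftrightarrow> V k (y - x)"
  using vge_minus[of k "x - y"] by (simp del: vge_minus)

lemma vge_add_iff: "V k x \<Longrightarrow> V k (x + y) \<longleftrightarrow> V k y"
  using vge_add[of k x y] vge_diff[of k "x + y" x] by auto

lemma vge_add_iff': "V k y \<Longrightarrow> V k (x + y) \<longleftrightarrow> V k x"
  using vge_add_iff[of k y x] by (simp add: add.commute)

lemma vge_diff_iff': "V k y \<Longrightarrow> V k (x - y) \<longleftrightarrow> V k x"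
  using vge_add_iff'[of k "- y" x] by simp

lemma vge_cong: "V k (x - y) \<Longrightarrow> V k x \<longleftrightarrow> V k y"
  using vge_add_iff[of k "x - y" y] by simp

text \<open>An upper bound v(x) <= i is written \<open>\<not> V (i + 1) x\<close> throughout, which
  also says that \<open>x\<close> is nonzero; such bounds add under multiplication.\<close>

lemma not_vge_mult: "\<not> V (i + 1) x \<Longrightarrow> \<not> V (j + 1) y \<Longrightarrow> \<not> V (i + j + 1) (x * y)"
  by (cases "x = 0 \<or> y = 0") (auto simp: vge_def rat_val_mult)

lemma vge_cancel: "V (i + j) (x * y) \<Longrightarrow> \<not> V (i + 1) x \<Longrightarrow> V j y"
  by (cases "x = 0 \<or> y = 0") (auto simp: vge_def rat_val_mult)

lemma vge_divide: "V i x \<Longrightarrow> \<not> V (j + 1) y \<Longrightarrow> V (i - j) (x / y)"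
  by (cases "x = 0 \<or> y = 0") (auto simp: vge_def rat_val_divide)

lemma vge_power: "V i x \<Longrightarrow> V (int n * i) (x ^ n)"
  by (cases "n = 0"; cases "x = 0") (auto simp: vge_def rat_val_power mult_left_mono)

lemma vge_power_cancel: "V (int n * i) (x ^ n) \<Longrightarrow> n > 0 \<Longrightarrow> V i x"
  by (cases "x = 0") (auto simp: vge_def rat_val_power)

lemma vge_mult_le: "V i x \<Longrightarrow> V j y \<Longrightarrow> k \<le> i + j \<Longrightarrow> V k (x * y)"
  using vge_mult vge_mono by blast

lemma vge_mult_0: "V 0 x \<Longrightarrow> V k y \<Longrightarrow> V k (x * y)"
  using vge_mult[of 0 x k y] by simp

lemma vge_mult_0': "V 0 y \<Longrightarrow> V k x \<Longrightarrow> V k (x * y)"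
  using vge_mult[of k x 0 y] by simp

lemma vge_power_0: "V 0 x \<Longrightarrow> V 0 (x ^ n)"
  using vge_power[of 0 x n] by simp

text \<open>The valuation of a square is even, so an odd lower bound improves by one.\<close>

lemma vge_square_cancel: "V (2 * k - 1) (x * x) \<Longrightarrow> V k x"
  using not_vge_mult[of "k - 1" x "k - 1" x] by (auto simp: algebra_simps)

text \<open>The valuation of a cube is a multiple of 3, so a bound of 4 on z^3 excludes v(z) =
  1.\<close>

lemma vge_2_if_cube:
  assumes "V 1 z" "V 4 (z * (z * z) + w)" "V 4 w"
  shows "V 2 z"
proof (rule ccontr)
  assume z: "\<not> V 2 z"
  then have "\<not> V 4 (z * (z * z))" using not_vge_mult[of 1 z 1 z] not_vge_mult[of 1 z 2 "z * z"] by simp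
  then show False using assms vge_add_iff' by blast
qed

text \<open>Bezout inverts the denominator modulo p^k; residue arguments can then be made with
  integers.\<close>

lemma vge_approx_int:
  assumes "V 0 x"
  obtains m :: int where "V (int k) (x - of_int m)"
proof -
  obtain n d :: int where x: "x = of_int n / of_int d" "\<not> int p dvd d"
    by (rule vge_0_denominator[OF assms])
  have d: "d \<noteq> 0" using x by auto
  have "coprime d (int p ^ k)"
    using x(2) prime_int prime_imp_coprime coprime_commute coprime_power_right_iff by blast
  then obtain e f where e: "e * d + f * int p ^ k = 1"
    using bezout_int[of d "int p ^ k"] by (auto simp: coprime_iff_gcd_eq_1)
  have "x - of_int (n * e) = of_int (n * (1 - e * d)) / of_int d"
    using x d by (simp add: field_simps)
  also have "1 - e * d = f * int p ^ k" using e by simp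
  finally have "x - of_int (n * e) = of_int (n * (f * int p ^ k)) / of_int d" .
  moreover have "V (int k) (of_int (n * (f * int p ^ k)))"
    by (simp only: vge_of_int_iff) simp
  moreover have "\<not> V (0 + 1) (of_int d)" using x(2) vge_of_int_1 by simp
  ultimately have "V (int k) (x - of_int (n * e))"
    using vge_divide[of "int k" _ 0 "of_int d"] by simp
  then show ?thesis using that by blast
qed

lemma not_vge_3: "p = 2 \<Longrightarrow> \<not> V 1 3"
  using vge_of_int_1[of 3] by simp

lemma not_vge_2: "p \<noteq> 2 \<Longrightarrow> \<not> V 1 2"
  using vge_of_int_1[of 2] p
  by (metis int_dvd_int_iff of_nat_numeral of_int_numeral primes_dvd_imp_eq two_is_prime_nat)

end

section \<open>Cauchy and null sequences\<close>

lemma pge_eventually: "pge p x k \<longleftrightarrow> (\<forall>\<^sub>F n in sequentially. vge p k (x n))"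
  by (simp add: pge_def vge_def eventually_sequentially)

lemma pcauchy_vge: "pcauchy p x \<longleftrightarrow> (\<forall>k. \<exists>N. \<forall>m\<ge>N. \<forall>n\<ge>N. vge p k (x m - x n))"
  by (simp add: pcauchy_def vge_def)

definition pbounded :: "nat \<Rightarrow> pseq \<Rightarrow> bool" where
  "pbounded p x \<longleftrightarrow> (\<exists>k. pge p x k)"

context padic
begin

lemma pnullD: "pnull p x \<Longrightarrow> \<forall>\<^sub>F n in sequentially. V k (x n)"
  by (simp add: pnull_def pge_eventually)

lemma pnullI: "(\<And>k. \<forall>\<^sub>F n in sequentially. V k (x n)) \<Longrightarrow> pnull p x"
  by (simp add: pnull_def pge_eventually)

lemma pnull_0 [simp]: "pnull p (\<lambda>_. 0)"
  by (rule pnullI) simp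

lemma pnull_eventually:
  assumes "pnull p x" "\<forall>\<^sub>F n in sequentially. x n = y n"
  shows "pnull p y"
proof (rule pnullI)
  fix k
  from pnullD[OF assms(1)] assms(2) show "\<forall>\<^sub>F n in sequentially. V k (y n)"
    by eventually_elim simp
qed

lemma pnull_add:
  assumes "pnull p x" "pnull p y"
  shows "pnull p (\<lambda>n. x n + y n)"
proof (rule pnullI)
  fix k
  from pnullD[OF assms(1)] pnullD[OF assms(2)] show "\<forall>\<^sub>F n in sequentially. V k (x n + y n)"
    by eventually_elim (rule vge_add)
qed

lemma pnull_diff:
  assumes "pnull p x" "pnull p y"
  shows "pnull p (\<lambda>n. x n - y n)"
proof (rule pnullI)
  fix k
  from pnullD[OF assms(1)] pnullD[OF assms(2)] show "\<forall>\<^sub>F n in sequentially. V k (x n - y n)"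
    by eventually_elim (rule vge_diff)
qed

lemma pnull_minus: "pnull p x \<Longrightarrow> pnull p (\<lambda>n. - x n)"
  using pnull_diff[of "\<lambda>_. 0" x] by simp

lemma pnull_mult_bounded:
  assumes "pbounded p x" "pnull p y"
  shows "pnull p (\<lambda>n. x n * y n)"
proof (rule pnullI)
  fix k
  obtain i where "\<forall>\<^sub>F n in sequentially. V i (x n)"
    using assms(1) by (auto simp: pbounded_def pge_eventually)
  moreover have "\<forall>\<^sub>F n in sequentially. V (k - i) (y n)" by (rule pnullD[OF assms(2)])
  ultimately show "\<forall>\<^sub>F n in sequentially. V k (x n * y n)"
    by eventually_elim (rule vge_mult_le, auto)
qed

lemma pcauchy_const [simp]: "pcauchy p (\<lambda>_. c)"
  by (simp add: pcauchy_vge)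

lemma pcauchyD: "pcauchy p x \<Longrightarrow> \<exists>N. \<forall>m\<ge>N. \<forall>n\<ge>N. V k (x m - x n)"
  by (simp add: pcauchy_vge)

lemma pcauchy_bounded:
  assumes "pcauchy p x"
  shows "pbounded p x"
proof -
  obtain N where N: "\<And>m n. m \<ge> N \<Longrightarrow> n \<ge> N \<Longrightarrow> V 0 (x m - x n)" using pcauchyD[OF assms] by blast
  have "V (min 0 (rat_val p (x N))) (x n)" if "n \<ge> N" for n
  proof -
    have "V (min 0 (rat_val p (x N))) (x n - x N)" using vge_mono[OF N[of n N]] that by simp
    moreover have "V (min 0 (rat_val p (x N))) (x N)" by (simp add: vge_def)
    ultimately show ?thesis using vge_add by fastforce
  qed
  then show ?thesis by (auto simp: pbounded_def pge_eventually eventually_sequentially)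
qed

lemma pcauchy_add:
  assumes "pcauchy p x" "pcauchy p y"
  shows "pcauchy p (\<lambda>n. x n + y n)"
  unfolding pcauchy_vge
proof
  fix k
  obtain N where N: "\<And>m n. m \<ge> N \<Longrightarrow> n \<ge> N \<Longrightarrow> V k (x m - x n)" using pcauchyD[OF assms(1)] by blast
  obtain M where M: "\<And>m n. m \<ge> M \<Longrightarrow> n \<ge> M \<Longrightarrow> V k (y m - y n)" using pcauchyD[OF assms(2)] by blast
  have "V k ((x m + y m) - (x n + y n))" if "m \<ge> max N M" "n \<ge> max N M" for m n
    using vge_add[OF N[of m n] M[of m n]] that by (simp add: algebra_simps)
  then show "\<exists>N. \<forall>m\<ge>N. \<forall>n\<ge>N. V k ((x m + y m) - (x n + y n))" by blast
qed

lemma pcauchy_mult: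
  assumes "pcauchy p x" "pcauchy p y"
  shows "pcauchy p (\<lambda>n. x n * y n)"
  unfolding pcauchy_vge
proof
  fix k
  obtain i I where i: "\<And>n. n \<ge> I \<Longrightarrow> V i (x n)"
    using pcauchy_bounded[OF assms(1)] by (auto simp: pbounded_def pge_eventually eventually_sequentially)
  obtain j J where j: "\<And>n. n \<ge> J \<Longrightarrow> V j (y n)"
    using pcauchy_bounded[OF assms(2)] by (auto simp: pbounded_def pge_eventually eventually_sequentially)
  obtain N where N: "\<And>m n. m \<ge> N \<Longrightarrow> n \<ge> N \<Longrightarrow> V (k - j) (x m - x n)" using pcauchyD[OF assms(1)] by blast
  obtain M where M: "\<And>m n. m \<ge> M \<Longrightarrow> n \<ge> M \<Longrightarrow> V (k - i) (y m - y n)" using pcauchyD[OF assms(2)] by blast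
  have "V k (x m * y m - x n * y n)" if "m \<ge> Max {N, M, I, J}" "n \<ge> Max {N, M, I, J}" for m n
  proof -
    have "V k (x m * (y m - y n))" "V k ((x m - x n) * y n)"
      using that vge_mult[OF i[of m] M[of m n]] vge_mult[OF N[of m n] j[of n]] by auto
    from vge_add[OF this] show ?thesis by (simp add: algebra_simps)
  qed
  then show "\<exists>N. \<forall>m\<ge>N. \<forall>n\<ge>N. V k (x m * y m - x n * y n)" by blast
qed

lemma pcauchy_minus: "pcauchy p x \<Longrightarrow> pcauchy p (\<lambda>n. - x n)"
  using pcauchy_mult[OF pcauchy_const[of "-1"], of x] by simp

lemma pcauchy_diff: "pcauchy p x \<Longrightarrow> pcauchy p y \<Longrightarrow> pcauchy p (\<lambda>n. x n - y n)"
  using pcauchy_add[OF _ pcauchy_minus, of x y] by simp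

lemma pcauchy_power: "pcauchy p x \<Longrightarrow> pcauchy p (\<lambda>n. x n ^ k)"
  by (induction k) (auto intro: pcauchy_mult)

text \<open>For a Cauchy sequence each valuation threshold is eventually always met or eventually
  always missed. This makes the negation of \<open>pge\<close> an eventual statement too, so that
  properties of limits can be read off at a single late index.\<close>

lemma pcauchy_vge_cases:
  assumes "pcauchy p x"
  shows "(\<forall>\<^sub>F n in sequentially. V k (x n)) \<or> (\<forall>\<^sub>F n in sequentially. \<not> V k (x n))"
proof -
  obtain N where N: "\<And>m n. m \<ge> N \<Longrightarrow> n \<ge> N \<Longrightarrow> V k (x m - x n)" using pcauchyD[OF assms] by blast
  have "V k (x n) \<longleftrightarrow> V k (x N)" if "n \<ge> N" for n
    using vge_cong[OF N[of n N]] that by simp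
  then show ?thesis by (cases "V k (x N)") (auto simp: eventually_sequentially)
qed

lemma not_pge_eventually: "pcauchy p x \<Longrightarrow> \<not> pge p x k \<Longrightarrow> \<forall>\<^sub>F n in sequentially. \<not> V k (x n)"
  using pcauchy_vge_cases by (auto simp: pge_eventually)

lemma not_pnull_eventually:
  assumes "pcauchy p x" "\<not> pnull p x"
  obtains k where "\<forall>\<^sub>F n in sequentially. \<not> V (k + 1) (x n)"
proof -
  obtain k where "\<not> pge p x k" using assms(2) by (auto simp: pnull_def)
  from not_pge_eventually[OF assms(1) this] show ?thesis using that[of "k - 1"] by simp
qed

lemma pcauchy_inverse:
  assumes "pcauchy p x" "\<not> pnull p x"
  shows "pcauchy p (\<lambda>n. inverse (x n))"
  unfolding pcauchy_vge
proof
  fix k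
  obtain j where "\<forall>\<^sub>F n in sequentially. \<not> V (j + 1) (x n)" by (rule not_pnull_eventually[OF assms])
  then obtain J where j: "\<And>n. n \<ge> J \<Longrightarrow> \<not> V (j + 1) (x n)" by (auto simp: eventually_sequentially)
  obtain N where N: "\<And>m n. m \<ge> N \<Longrightarrow> n \<ge> N \<Longrightarrow> V (k + 2 * j) (x m - x n)" using pcauchyD[OF assms(1)] by blast
  have "V k (inverse (x m) - inverse (x n))" if "m \<ge> max N J" "n \<ge> max N J" for m n
  proof -
    have "\<not> V (j + j + 1) (x m * x n)" using that by (intro not_vge_mult j) auto
    moreover have "V (k + 2 * j) (x n - x m)" using N[of n m] that by simp
    ultimately have "V k ((x n - x m) / (x m * x n))"
      using vge_divide[of "k + 2 * j" "x n - x m" "j + j" "x m * x n"] by simp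
    moreover have "x m \<noteq> 0" "x n \<noteq> 0" using j[of m] j[of n] that by auto
    ultimately show ?thesis by (simp add: field_simps)
  qed
  then show "\<exists>N. \<forall>m\<ge>N. \<forall>n\<ge>N. V k (inverse (x m) - inverse (x n))" by blast
qed

lemma pcauchy_divide: "pcauchy p x \<Longrightarrow> pcauchy p y \<Longrightarrow> \<not> pnull p y \<Longrightarrow> pcauchy p (\<lambda>n. x n / y n)"
  using pcauchy_mult[OF _ pcauchy_inverse, of x y] by (simp add: divide_inverse)

lemma not_pnull_nonzero:
  assumes "pcauchy p x" "\<not> pnull p x"
  shows "\<forall>\<^sub>F n in sequentially. x n \<noteq> 0"
proof -
  obtain k where "\<forall>\<^sub>F n in sequentially. \<not> V (k + 1) (x n)" by (rule not_pnull_eventually[OF assms])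
  then show ?thesis by eventually_elim auto
qed

lemma pnull_mult: "pcauchy p x \<Longrightarrow> pnull p y \<Longrightarrow> pnull p (\<lambda>n. x n * y n)"
  by (intro pnull_mult_bounded pcauchy_bounded)

lemma pnull_divide: "pcauchy p y \<Longrightarrow> \<not> pnull p y \<Longrightarrow> pnull p x \<Longrightarrow> pnull p (\<lambda>n. x n / y n)"
  using pnull_mult[OF pcauchy_inverse, of y x] by (simp add: divide_inverse mult.commute)

lemma pnull_cancel:
  assumes "pcauchy p x" "\<not> pnull p x" "pnull p (\<lambda>n. x n * y n)"
  shows "pnull p y"
proof (rule pnull_eventually[OF pnull_divide[OF assms]])
  show "\<forall>\<^sub>F n in sequentially. x n * y n / x n = y n"
    using not_pnull_nonzero[OF assms(1,2)] by eventually_elim simp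
qed

lemmas pcauchy_intros = pcauchy_const pcauchy_add pcauchy_diff pcauchy_minus pcauchy_mult pcauchy_power

end

section \<open>Chords of Weierstrass curves\<close>

text \<open>A residual rather than an equation: the terms of a sequence converging to a p-adic point
  need not lie on the curve, and only their residuals tend to zero.\<close>

definition weq :: "wcoeffs \<Rightarrow> rat \<Rightarrow> rat \<Rightarrow> rat" where
  "weq A x y = (case A of (a1, a2, a3, a4, a6) \<Rightarrow>
     y^2 + a1 * x * y + a3 * y - (x^3 + a2 * x^2 + a4 * x + a6))"

lemma weq_tuple:
  "weq (a1, a2, a3, a4, a6) x y = y^2 + a1 * x * y + a3 * y - (x^3 + a2 * x^2 + a4 * x + a6)"
  by (simp add: weq_def)

lemma Epts_None [simp]: "None \<in> Epts p A"
  by (cases A) (simp add: Epts_def)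

lemma Epts_Some:
  "Some (x, y) \<in> Epts p A \<longleftrightarrow> pcauchy p x \<and> pcauchy p y \<and> pnull p (\<lambda>n. weq A (x n) (y n))"
  by (cases A) (simp add: Epts_def weq_def peq_def)

text \<open>On the line \<^term>\<open>y = l * x + nu\<close> the Weierstrass cubic in \<^term>\<open>x\<close> equals
  \<^term>\<open>(x - x1) * (x - x2) * (x - x3)\<close> up to a linear polynomial; its two coefficients are controlled
  by the residuals at \<^term>\<open>x1\<close> and of the slope relation.\<close>

lemma weq_third_point:
  fixes a1 a2 a3 a4 a6 x1 y1 x2 y2 l nu :: rat
  defines "x3 \<equiv> l^2 + a1 * l - a2 - x1 - x2"
  shows "weq (a1, a2, a3, a4, a6) x3 (- (l + a1) * x3 - nu - a3) =
     weq (a1, a2, a3, a4, a6) x1 y1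
     - (2 * y1 - (y1 - l * x1 - nu) + a1 * x1 + a3) * (y1 - l * x1 - nu)
     + (x3 - x1) * (l * (y1 + y2 + a1 * x2 + a3) - (x1^2 + x1 * x2 + x2^2 + a2 * (x1 + x2) + a4 - a1 * y1))
     - (x3 - x1) * (l + a1) * (y1 - l * x1 - nu) - (x3 - x1) * l * (y2 - l * x2 - nu)"
  unfolding weq_tuple x3_def by Groebner_Basis.algebra

context padic
begin

lemma wneg_Epts: "P \<in> Epts p A \<Longrightarrow> wneg A P \<in> Epts p A"
proof (cases P)
  case (Some xy)
  assume P: "P \<in> Epts p A"
  obtain x y where [simp]: "xy = (x, y)" by force
  obtain a1 a2 a3 a4 a6 where A: "A = (a1, a2, a3, a4, a6)" by (metis prod.collapse)
  have "weq A (x n) (- y n - a1 * x n - a3) = weq A (x n) (y n)" for n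
    unfolding A weq_tuple by Groebner_Basis.algebra
  then show ?thesis
    using P Some by (simp add: A Epts_Some wneg_def pcauchy_intros)
qed (auto simp: wneg_def split: prod.splits)

text \<open>The chord and tangent branches of \<open>wadd\<close> satisfy the same relations up to
  null sequences, the last one being the slope relation obtained by dividing the difference of the
  two curve equations by x2 - x1. The later arguments therefore treat both branches alike.\<close>

lemma wadd_line:
  assumes A: "A = (a1, a2, a3, a4, a6)"
    and P: "Some (x1, y1) \<in> Epts p A" and Q: "Some (x2, y2) \<in> Epts p A"
    and nop: "\<not> (peq p x1 x2 \<and> pnull p (\<lambda>n. y1 n + y2 n + a1 * x2 n + a3))"
  obtains l nu x3 where
    "pcauchy p l" "pcauchy p nu"
    "x3 = (\<lambda>n. l n ^ 2 + a1 * l n - a2 - x1 n - x2 n)"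
    "wadd p A (Some (x1, y1)) (Some (x2, y2)) = Some (x3, \<lambda>n. - (l n + a1) * x3 n - nu n - a3)"
    "pnull p (\<lambda>n. y1 n - l n * x1 n - nu n)"
    "pnull p (\<lambda>n. y2 n - l n * x2 n - nu n)"
    "pnull p (\<lambda>n. l n * (y1 n + y2 n + a1 * x2 n + a3)
       - (x1 n ^ 2 + x1 n * x2 n + x2 n ^ 2 + a2 * (x1 n + x2 n) + a4 - a1 * y1 n))"
proof (cases "peq p x1 x2")
  case False
  have c: "pcauchy p x1" "pcauchy p y1" "pcauchy p x2" "pcauchy p y2"
    and F: "pnull p (\<lambda>n. weq A (x1 n) (y1 n))" "pnull p (\<lambda>n. weq A (x2 n) (y2 n))"
    using P Q by (auto simp: Epts_Some)
  define d where "d n = x2 n - x1 n" for n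
  have d: "pcauchy p d" unfolding d_def by (intro pcauchy_intros c)
  have d0: "\<not> pnull p d"
  proof
    assume "pnull p d"
    from pnull_minus[OF this] show False using False by (simp add: peq_def d_def)
  qed
  note nz = not_pnull_nonzero[OF d d0]
  define l where "l n = (y2 n - y1 n) / d n" for n
  define nu where "nu n = (y1 n * x2 n - y2 n * x1 n) / d n" for n
  define x3 where "x3 n = l n ^ 2 + a1 * l n - a2 - x1 n - x2 n" for n
  show ?thesis
  proof (rule that[of l nu x3])
    show "pcauchy p l" "pcauchy p nu"
      unfolding l_def nu_def by (intro pcauchy_divide pcauchy_intros c d d0)+
    show "wadd p A (Some (x1, y1)) (Some (x2, y2)) = Some (x3, \<lambda>n. - (l n + a1) * x3 n - nu n - a3)"
      using False by (simp add: wadd_def A Let_def x3_def l_def nu_def d_def fun_eq_iff)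
    have "\<forall>\<^sub>F n in sequentially. 0 = y1 n - l n * x1 n - nu n"
      using nz
    proof eventually_elim
      case (elim n)
      have "l n * d n = y2 n - y1 n" "nu n * d n = y1 n * x2 n - y2 n * x1 n"
        using elim by (simp_all add: l_def nu_def)
      then have "d n * (y1 n - l n * x1 n - nu n) = 0" unfolding d_def by Groebner_Basis.algebra
      then show ?case using elim by simp
    qed
    then show "pnull p (\<lambda>n. y1 n - l n * x1 n - nu n)" by (rule pnull_eventually[OF pnull_0])
    have "\<forall>\<^sub>F n in sequentially. 0 = y2 n - l n * x2 n - nu n"
      using nz
    proof eventually_elim
      case (elim n)
      have "l n * d n = y2 n - y1 n" "nu n * d n = y1 n * x2 n - y2 n * x1 n"
        using elim by (simp_all add: l_def nu_def)
      then have "d n * (y2 n - l n * x2 n - nu n) = 0" unfolding d_def by Groebner_Basis.algebra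
      then show ?case using elim by simp
    qed
    then show "pnull p (\<lambda>n. y2 n - l n * x2 n - nu n)" by (rule pnull_eventually[OF pnull_0])
    have "pnull p (\<lambda>n. (weq A (x2 n) (y2 n) - weq A (x1 n) (y1 n)) / d n)"
      by (intro pnull_divide pnull_diff d d0 F)
    moreover have "\<forall>\<^sub>F n in sequentially. (weq A (x2 n) (y2 n) - weq A (x1 n) (y1 n)) / d n =
      l n * (y1 n + y2 n + a1 * x2 n + a3)
       - (x1 n ^ 2 + x1 n * x2 n + x2 n ^ 2 + a2 * (x1 n + x2 n) + a4 - a1 * y1 n)"
      using nz
    proof eventually_elim
      case (elim n)
      have "weq A (x2 n) (y2 n) - weq A (x1 n) (y1 n) = (y2 n - y1 n) * (y1 n + y2 n + a1 * x2 n + a3)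
       - d n * (x1 n ^ 2 + x1 n * x2 n + x2 n ^ 2 + a2 * (x1 n + x2 n) + a4 - a1 * y1 n)"
        unfolding A weq_tuple d_def by Groebner_Basis.algebra
      moreover have "l n * d n = y2 n - y1 n" using elim by (simp add: l_def)
      ultimately have "weq A (x2 n) (y2 n) - weq A (x1 n) (y1 n) = d n * (l n * (y1 n + y2 n + a1 * x2 n + a3)
       - (x1 n ^ 2 + x1 n * x2 n + x2 n ^ 2 + a2 * (x1 n + x2 n) + a4 - a1 * y1 n))"
        by Groebner_Basis.algebra
      then show ?case using elim by simp
    qed
    ultimately show "pnull p (\<lambda>n. l n * (y1 n + y2 n + a1 * x2 n + a3)
       - (x1 n ^ 2 + x1 n * x2 n + x2 n ^ 2 + a2 * (x1 n + x2 n) + a4 - a1 * y1 n))"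
      by (rule pnull_eventually)
  qed (simp_all add: x3_def fun_eq_iff)
next
  case True
  have c: "pcauchy p x1" "pcauchy p y1" "pcauchy p x2" "pcauchy p y2"
    and F: "pnull p (\<lambda>n. weq A (x1 n) (y1 n))" "pnull p (\<lambda>n. weq A (x2 n) (y2 n))"
    using P Q by (auto simp: Epts_Some)
  have dx: "pnull p (\<lambda>n. x2 n - x1 n)" using pnull_minus True by (fastforce simp: peq_def)
  define s where "s n = y1 n + y2 n + a1 * x2 n + a3" for n
  have s: "pcauchy p s" unfolding s_def by (intro pcauchy_intros c)
  have s0: "\<not> pnull p s" using nop True by (simp add: s_def[abs_def])
  \<comment> \<open>Modulo x2 - x1 the difference of the curve equations factors as s * (y2 - y1),
    and \<open>s\<close> is not null because the points are not opposite. So equal abscissae force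
    equal ordinates in the limit.\<close>
  have dy: "pnull p (\<lambda>n. y2 n - y1 n)"
  proof (rule pnull_cancel[OF s s0])
    have "pnull p (\<lambda>n. weq A (x2 n) (y2 n) - weq A (x1 n) (y1 n) +
       (x1 n ^ 2 + x1 n * x2 n + x2 n ^ 2 + a2 * (x1 n + x2 n) + a4 - a1 * y1 n) * (x2 n - x1 n))"
      by (intro pnull_add pnull_diff F pnull_mult dx pcauchy_intros c)
    moreover have "weq A (x2 n) (y2 n) - weq A (x1 n) (y1 n) +
       (x1 n ^ 2 + x1 n * x2 n + x2 n ^ 2 + a2 * (x1 n + x2 n) + a4 - a1 * y1 n) * (x2 n - x1 n)
       = s n * (y2 n - y1 n)" for n
      unfolding A weq_tuple s_def by Groebner_Basis.algebra
    ultimately show "pnull p (\<lambda>n. s n * (y2 n - y1 n))" by simp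
  qed
  define d where "d n = 2 * y1 n + a1 * x1 n + a3" for n
  have d: "pcauchy p d" unfolding d_def by (intro pcauchy_intros c)
  \<comment> \<open>The tangent denominator \<open>d\<close> is the limit value of \<open>s\<close>
    with the second point replaced by the first.\<close>
  have d0: "\<not> pnull p d"
  proof
    assume "pnull p d"
    then have "pnull p (\<lambda>n. d n + ((y2 n - y1 n) + a1 * (x2 n - x1 n)))"
      by (intro pnull_add dx dy pnull_mult pcauchy_const)
    moreover have "d n + ((y2 n - y1 n) + a1 * (x2 n - x1 n)) = s n" for n
      by (simp add: d_def s_def algebra_simps)
    ultimately show False using s0 by simp
  qed
  note nz = not_pnull_nonzero[OF d d0]
  define l where "l n = (3 * x1 n ^ 2 + 2 * a2 * x1 n + a4 - a1 * y1 n) / d n" for n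
  define nu where "nu n = (-(x1 n ^ 3) + a4 * x1 n + 2 * a6 - a3 * y1 n) / d n" for n
  define x3 where "x3 n = l n ^ 2 + a1 * l n - a2 - x1 n - x2 n" for n
  have l: "pcauchy p l" and nu: "pcauchy p nu"
    unfolding l_def nu_def by (intro pcauchy_divide pcauchy_intros c d d0)+
  show ?thesis
  proof (rule that[of l nu x3])
    show "pcauchy p l" "pcauchy p nu" by fact+
    show "wadd p A (Some (x1, y1)) (Some (x2, y2)) = Some (x3, \<lambda>n. - (l n + a1) * x3 n - nu n - a3)"
      using True nop by (simp add: wadd_def A Let_def x3_def l_def nu_def d_def fun_eq_iff)
    \<comment> \<open>The tangent formulas for \<open>l\<close> and \<open>nu\<close> put the first
      point on the line only modulo the curve equation: \<open>d\<close> times the defect is twice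
      the residual.\<close>
    have "pnull p (\<lambda>n. 2 * weq A (x1 n) (y1 n) / d n)"
      by (intro pnull_divide pnull_mult pcauchy_const d d0 F)
    moreover have "\<forall>\<^sub>F n in sequentially. 2 * weq A (x1 n) (y1 n) / d n = y1 n - l n * x1 n - nu n"
      using nz
    proof eventually_elim
      case (elim n)
      have "2 * weq A (x1 n) (y1 n) = y1 n * d n
          - (3 * x1 n ^ 2 + 2 * a2 * x1 n + a4 - a1 * y1 n) * x1 n
          - (-(x1 n ^ 3) + a4 * x1 n + 2 * a6 - a3 * y1 n)"
        unfolding A weq_tuple d_def by Groebner_Basis.algebra
      moreover have "l n * d n = 3 * x1 n ^ 2 + 2 * a2 * x1 n + a4 - a1 * y1 n"
        "nu n * d n = -(x1 n ^ 3) + a4 * x1 n + 2 * a6 - a3 * y1 n"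
        using elim by (simp_all add: l_def nu_def)
      ultimately have "2 * weq A (x1 n) (y1 n) = d n * (y1 n - l n * x1 n - nu n)" by Groebner_Basis.algebra
      then show ?case using elim by simp
    qed
    ultimately show n1: "pnull p (\<lambda>n. y1 n - l n * x1 n - nu n)" by (rule pnull_eventually)
    have "pnull p (\<lambda>n. (y1 n - l n * x1 n - nu n) + ((y2 n - y1 n) - l n * (x2 n - x1 n)))"
      by (intro pnull_add pnull_diff n1 dy dx pnull_mult l)
    moreover have "(y1 n - l n * x1 n - nu n) + ((y2 n - y1 n) - l n * (x2 n - x1 n))
        = y2 n - l n * x2 n - nu n" for n by Groebner_Basis.algebra
    ultimately show "pnull p (\<lambda>n. y2 n - l n * x2 n - nu n)" by simp
    have "pnull p (\<lambda>n. l n * ((y2 n - y1 n) + a1 * (x2 n - x1 n))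
        - (2 * x1 n + x2 n + a2) * (x2 n - x1 n))"
      by (intro pnull_diff pnull_add pnull_mult dy dx l pcauchy_intros c)
    moreover have "\<forall>\<^sub>F n in sequentially. l n * ((y2 n - y1 n) + a1 * (x2 n - x1 n))
        - (2 * x1 n + x2 n + a2) * (x2 n - x1 n) =
      l n * (y1 n + y2 n + a1 * x2 n + a3)
       - (x1 n ^ 2 + x1 n * x2 n + x2 n ^ 2 + a2 * (x1 n + x2 n) + a4 - a1 * y1 n)"
      using nz
    proof eventually_elim
      case (elim n)
      have e: "l n * d n = 3 * x1 n ^ 2 + 2 * a2 * x1 n + a4 - a1 * y1 n" using elim by (simp add: l_def)
      show ?case using e unfolding d_def by Groebner_Basis.algebra
    qed
    ultimately show "pnull p (\<lambda>n. l n * (y1 n + y2 n + a1 * x2 n + a3)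
       - (x1 n ^ 2 + x1 n * x2 n + x2 n ^ 2 + a2 * (x1 n + x2 n) + a4 - a1 * y1 n))"
      by (rule pnull_eventually)
  qed (simp_all add: x3_def fun_eq_iff)
qed

lemma wadd_Epts:
  assumes P: "P \<in> Epts p A" and Q: "Q \<in> Epts p A"
  shows "wadd p A P Q \<in> Epts p A"
proof -
  obtain a1 a2 a3 a4 a6 where A: "A = (a1, a2, a3, a4, a6)" by (metis prod.collapse)
  consider "P = None" | "P \<noteq> None" "Q = None" | x1 y1 x2 y2 where "P = Some (x1, y1)" "Q = Some (x2, y2)"
    by (metis option.exhaust prod.collapse)
  then show ?thesis
  proof cases
    case 1
    then show ?thesis using Q by (simp add: A wadd_def)
  next
    case 2
    then show ?thesis using P by (auto simp add: A wadd_def)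
  next
    case 3
    show ?thesis
    proof (cases "peq p x1 x2 \<and> pnull p (\<lambda>n. y1 n + y2 n + a1 * x2 n + a3)")
      case True
      then show ?thesis using 3 by (simp add: A wadd_def)
    next
      case False
      have c: "pcauchy p x1" "pcauchy p y1" "pcauchy p x2" "pcauchy p y2"
        and F: "pnull p (\<lambda>n. weq A (x1 n) (y1 n))" "pnull p (\<lambda>n. weq A (x2 n) (y2 n))"
        using P Q 3 by (auto simp: Epts_Some)
      obtain l nu x3 where l: "pcauchy p l" "pcauchy p nu"
        and x3: "x3 = (\<lambda>n. l n ^ 2 + a1 * l n - a2 - x1 n - x2 n)"
        and add: "wadd p A (Some (x1, y1)) (Some (x2, y2)) = Some (x3, \<lambda>n. - (l n + a1) * x3 n - nu n - a3)"
        and n: "pnull p (\<lambda>n. y1 n - l n * x1 n - nu n)"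
          "pnull p (\<lambda>n. y2 n - l n * x2 n - nu n)"
          "pnull p (\<lambda>n. l n * (y1 n + y2 n + a1 * x2 n + a3)
            - (x1 n ^ 2 + x1 n * x2 n + x2 n ^ 2 + a2 * (x1 n + x2 n) + a4 - a1 * y1 n))"
        using wadd_line[OF A _ _ False] P Q 3 by blast
      have third: "weq A (x3 n) (- (l n + a1) * x3 n - nu n - a3) = weq (a1, a2, a3, a4, a6) (x1 n) (y1 n)
         - (2 * y1 n - (y1 n - l n * x1 n - nu n) + a1 * x1 n + a3) * (y1 n - l n * x1 n - nu n)
         + (x3 n - x1 n) * (l n * (y1 n + y2 n + a1 * x2 n + a3)
            - (x1 n ^ 2 + x1 n * x2 n + x2 n ^ 2 + a2 * (x1 n + x2 n) + a4 - a1 * y1 n))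
         - (x3 n - x1 n) * (l n + a1) * (y1 n - l n * x1 n - nu n)
         - (x3 n - x1 n) * l n * (y2 n - l n * x2 n - nu n)" for n
        unfolding A x3 by (rule weq_third_point)
      have cx: "pcauchy p x3" unfolding x3 by (intro pcauchy_intros l c)
      have "pnull p (\<lambda>n. weq A (x3 n) (- (l n + a1) * x3 n - nu n - a3))"
        unfolding third
        by (intro pnull_add pnull_diff pnull_mult[where y = "\<lambda>n. y1 n - l n * x1 n - nu n"]
            pnull_mult[where y = "\<lambda>n. y2 n - l n * x2 n - nu n"]
            pnull_mult[where x = "\<lambda>n. x3 n - x1 n"] n F[unfolded A] pcauchy_intros cx l c)
      then show ?thesis using 3 add cx l by (simp add: Epts_Some pcauchy_intros)
    qed
  qed
qed

end

section \<open>Models with singular reduction at the origin\<close>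

text \<open>Clearing denominators leaves polynomial relations in the products u^i b_i, the form in
  which the Groebner basis method can prove identities between two models.\<close>

lemma chg_iff:
  assumes "u \<noteq> 0"
  shows "(b1, b2, b3, b4, b6) = chg (a1, a2, a3, a4, a6) u r s t \<longleftrightarrow>
    u * b1 = a1 + 2 * s \<and> u^2 * b2 = a2 - s * a1 + 3 * r - s^2 \<and> u^3 * b3 = a3 + r * a1 + 2 * t \<and>
    u^4 * b4 = a4 - s * a3 + 2 * r * a2 - (t + r * s) * a1 + 3 * r^2 - 2 * s * t \<and>
    u^6 * b6 = a6 + r * a4 + r^2 * a2 + r^3 - t * a3 - t^2 - r * t * a1"
  using assms by (auto simp: chg_def nonzero_eq_divide_eq mult.commute)

text \<open>\<^const>\<open>min_model\<close> is an unspecified choice, so the index is computed on every model \<open>B\<close> obtained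
  from \<open>T\<close> by an integral change of variables; \<open>Z\<close> and \<open>Y\<close> turn coordinates of \<open>B\<close> into those of \<open>T\<close>.\<close>

locale tate_form = padic +
  fixes A2 A3 A4 A6 u r s t :: rat
  assumes A: "vge p 1 A2" "vge p 1 A3" "vge p 1 A4" "vge p 1 A6"
    and u: "vge p 0 u" "\<not> vge p 1 u" and rst: "vge p 0 r" "vge p 0 s" "vge p 0 t"
begin

abbreviation T :: wcoeffs where "T \<equiv> (0, A2, A3, A4, A6)"
abbreviation B :: wcoeffs where "B \<equiv> chg T u r s t"
abbreviation Z :: "rat \<Rightarrow> rat" where "Z x \<equiv> u^2 * x + r"
abbreviation Y :: "rat \<Rightarrow> rat \<Rightarrow> rat" where "Y x y \<equiv> u^3 * y + s * u^2 * x + t"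

lemma u0: "u \<noteq> 0"
  using u by auto

definition b1 where "b1 = fst B"
definition b2 where "b2 = fst (snd B)"
definition b3 where "b3 = fst (snd (snd B))"
definition b4 where "b4 = fst (snd (snd (snd B)))"
definition b6 where "b6 = snd (snd (snd (snd B)))"

lemma B_eq: "B = (b1, b2, b3, b4, b6)"
  by (simp add: b1_def b2_def b3_def b4_def b6_def)

lemma B_coeffs:
  "u * b1 = 2 * s" "u^2 * b2 = A2 + 3 * r - s^2" "u^3 * b3 = A3 + 2 * t"
  "u^4 * b4 = A4 - s * A3 + 2 * r * A2 + 3 * r^2 - 2 * s * t"
  "u^6 * b6 = A6 + r * A4 + r^2 * A2 + r^3 - t * A3 - t^2"
  using B_eq[symmetric, unfolded chg_iff[OF u0]] by simp_all

lemma weq_T: "weq T (Z x) (Y x y) = u^6 * weq B x y"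
proof -
  have "u^6 * weq B x y = (u^3 * y)^2 + (u * b1) * (u^2 * x) * (u^3 * y) + (u^3 * b3) * (u^3 * y)
      - ((u^2 * x)^3 + (u^2 * b2) * (u^2 * x)^2 + (u^4 * b4) * (u^2 * x) + u^6 * b6)"
    unfolding B_eq weq_tuple by Groebner_Basis.algebra
  also have "\<dots> = weq T (Z x) (Y x y)"
    unfolding B_coeffs weq_tuple by Groebner_Basis.algebra
  finally show ?thesis by simp
qed

text \<open>A line of slope \<open>l\<close> on \<open>B\<close> becomes a line of slope
  \<open>u * l + s\<close> on \<open>T\<close>, and \<open>T\<close> has no a1 term.\<close>

lemma Z_third: "Z (l^2 + b1 * l - b2 - x1 - x2) = (u * l + s)^2 - A2 - Z x1 - Z x2"
proof -
  have "Z (l^2 + b1 * l - b2 - x1 - x2) = (u * l)^2 + (u * b1) * (u * l) - u^2 * b2 - u^2 * x1 - u^2 * x2 + r"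
    by Groebner_Basis.algebra
  then show ?thesis unfolding B_coeffs by Groebner_Basis.algebra
qed

lemma Y_neg: "Y x (- y - b1 * x - b3) = - Y x y - A3"
proof -
  have "Y x (- y - b1 * x - b3) = - (u^3 * y) - (u * b1) * (u^2 * x) - u^3 * b3 + s * u^2 * x + t"
    by Groebner_Basis.algebra
  then show ?thesis unfolding B_coeffs by Groebner_Basis.algebra
qed

text \<open>The last term is the price of a slope change by \<open>s\<close> when the two points lie
  on the line only approximately; \<open>nu\<close> cancels there, but is kept to match the
  residuals of \<open>wadd_line\<close>.\<close>

lemma slope_T: "(u * l + s) * (Y x1 y1 + Y x2 y2 + A3) - ((Z x1)^2 + Z x1 * Z x2 + (Z x2)^2 + A2 * (Z x1 + Z x2) + A4)
  = u^4 * (l * (y1 + y2 + b1 * x2 + b3) - (x1^2 + x1 * x2 + x2^2 + b2 * (x1 + x2) + b4 - b1 * y1))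
   - s * u^3 * ((y1 - l * x1 - nu) - (y2 - l * x2 - nu))"
proof -
  have "u^4 * (l * (y1 + y2 + b1 * x2 + b3) - (x1^2 + x1 * x2 + x2^2 + b2 * (x1 + x2) + b4 - b1 * y1))
    = (u * l) * (u^3 * y1 + u^3 * y2 + (u * b1) * (u^2 * x2) + u^3 * b3)
      - ((u^2 * x1)^2 + (u^2 * x1) * (u^2 * x2) + (u^2 * x2)^2 + (u^2 * b2) * (u^2 * x1 + u^2 * x2)
         + u^4 * b4 - (u * b1) * (u^3 * y1))"
    by Groebner_Basis.algebra
  then show ?thesis unfolding B_coeffs by Groebner_Basis.algebra
qed

lemma partial_y: "u^3 * (2 * y + b1 * x + b3) = 2 * Y x y + A3"
proof -
  have "u^3 * (2 * y + b1 * x + b3) = 2 * (u^3 * y) + (u * b1) * (u^2 * x) + u^3 * b3" by Groebner_Basis.algebra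
  then show ?thesis unfolding B_coeffs by Groebner_Basis.algebra
qed

lemma partial_x: "u^4 * (b1 * y - 3 * x^2 - 2 * b2 * x - b4)
    = (- 3 * (Z x)^2 - 2 * A2 * Z x - A4) + s * (2 * Y x y + A3)"
proof -
  have "u^4 * (b1 * y - 3 * x^2 - 2 * b2 * x - b4)
    = (u * b1) * (u^3 * y) - 3 * (u^2 * x)^2 - 2 * (u^2 * b2) * (u^2 * x) - u^4 * b4" by Groebner_Basis.algebra
  then show ?thesis unfolding B_coeffs by Groebner_Basis.algebra
qed

lemma not_vge_power_u: "\<not> V 1 (u ^ n)"
proof (induction n)
  case 0
  then show ?case using rat_val_1 by (simp add: vge_def)
next
  case (Suc n)
  then show ?case using not_vge_mult[of 0 u 0 "u ^ n"] u by simp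
qed

lemma vge_unit_mult [simp]: "V k (u ^ n * x) \<longleftrightarrow> V k x"
  using vge_cancel[of 0 k "u ^ n" x] not_vge_power_u[of n] vge_mult_0[of "u ^ n" k x] vge_power_0[of u n] u
  by auto

lemma vge_Z: "k \<le> 0 \<Longrightarrow> V k (Z x) \<longleftrightarrow> V k x"
  using vge_add_iff'[of k r "u^2 * x"] vge_mono[OF rst(1), of k] by simp

text \<open>The reduction of \<open>T\<close> is the cuspidal cubic y^2 = x^3, on which the abscissa
  0 belongs to the cusp alone.\<close>

lemma vge_Y_if_vge_Z:
  assumes z: "V 1 z" and F: "V 1 (weq T z y)"
  shows "V 1 y"
proof (rule ccontr)
  assume y: "\<not> V 1 y"
  then have "\<not> V 1 (y + A3)" using vge_add_iff'[OF A(2)] by simp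
  then have "\<not> V 1 (y * (y + A3))" using not_vge_mult[of 0 y 0 "y + A3"] y by simp
  moreover have "y * (y + A3) = weq T z y + (z * z * z + A2 * (z * z) + A4 * z + A6)"
    unfolding weq_tuple by Groebner_Basis.algebra
  moreover have "V 1 (weq T z y + (z * z * z + A2 * (z * z) + A4 * z + A6))"
    by (intro vge_add F A vge_mult_le[OF vge_mult_le[OF z z order.refl] z]
        vge_mult_le[OF A(1) vge_mult_le[OF z z order.refl]] vge_mult_le[OF A(3) z]) auto
  ultimately show False by simp
qed

text \<open>Up to powers of the unit \<open>u\<close>, the partial derivatives on \<open>B\<close>
  are combinations of those on \<open>T\<close>, so the claim reduces to the cusp of
  \<open>T\<close>.\<close>

lemma singular_iff:
  assumes F: "V 1 (weq B x y)"
  shows "V 0 x \<and> V 1 (b1 * y - 3 * x^2 - 2 * b2 * x - b4) \<and> V 1 (2 * y + b1 * x + b3) \<longleftrightarrow> V 1 (Z x)"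
proof -
  let ?z = "Z x" and ?y = "Y x y"
  have F': "V 1 (weq T ?z ?y)" unfolding weq_T using F by simp
  have py: "V 1 (2 * y + b1 * x + b3) \<longleftrightarrow> V 1 (2 * ?y + A3)"
    unfolding partial_y[symmetric] by simp
  have px: "V 1 (b1 * y - 3 * x^2 - 2 * b2 * x - b4) \<longleftrightarrow> V 1 (- 3 * ?z^2 - 2 * A2 * ?z - A4)"
    if "V 1 (2 * ?y + A3)"
    using vge_add_iff'[of 1 "s * (2 * ?y + A3)" "- 3 * ?z^2 - 2 * A2 * ?z - A4"]
      vge_mult_0[OF rst(2) that] vge_unit_mult[of 1 4 "b1 * y - 3 * x^2 - 2 * b2 * x - b4"]
    unfolding partial_x by simp
  show ?thesis
  proof
    assume L: "V 0 x \<and> V 1 (b1 * y - 3 * x^2 - 2 * b2 * x - b4) \<and> V 1 (2 * y + b1 * x + b3)"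
    then have z: "V 0 ?z" using vge_Z[of 0 x] by simp
    have ty: "V 1 (2 * ?y)" using L py vge_add_iff'[OF A(2), of "2 * ?y"] by simp
    have tx: "V 1 (- 3 * ?z^2 - 2 * A2 * ?z - A4)" using L py px by simp
    \<comment> \<open>For p = 2 the y-derivative vanishes identically modulo p, and the x-derivative
      3 z^2 determines z. For odd p the y-derivative gives y and the equation then gives z; the
      x-derivative would fail at 3.\<close>
    show "V 1 ?z"
    proof (cases "p = 2")
      case True
      have "- 3 * ?z^2 - 2 * A2 * ?z - A4 = - (3 * ?z^2 + (2 * (A2 * ?z) + A4))" by Groebner_Basis.algebra
      then have "V 1 (3 * ?z^2 + (2 * (A2 * ?z) + A4))" using tx by (metis vge_minus)
      moreover have "V 1 (2 * (A2 * ?z) + A4)"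
        by (intro vge_add A vge_mult_0[OF vge_numeral] vge_mult_0'[OF z])
      ultimately have "V 1 (3 * ?z^2)" using vge_add_iff' by blast
      then have "V 1 (?z^2)" using vge_cancel[of 0 1 3 "?z^2"] not_vge_3[OF True] by simp
      then show ?thesis using not_vge_mult[of 0 ?z 0 ?z] by (auto simp: power2_eq_square)
    next
      case False
      have y: "V 1 ?y" using vge_cancel[of 0 1 2 ?y] not_vge_2[OF False] ty by simp
      have "?z * (?z * ?z) = (?y * ?y + A3 * ?y) - (weq T ?z ?y + (A2 * (?z * ?z) + A4 * ?z + A6))"
        unfolding weq_tuple by Groebner_Basis.algebra
      moreover have "V 1 ((?y * ?y + A3 * ?y) - (weq T ?z ?y + (A2 * (?z * ?z) + A4 * ?z + A6)))"
        by (intro vge_diff vge_add F' A vge_mult_le[OF y y] vge_mult_le[OF A(2) y]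
            vge_mult_0'[OF vge_mult_0[OF z z] A(1)] vge_mult_0'[OF z A(3)]) auto
      ultimately have "V 1 (?z * (?z * ?z))" by simp
      then show ?thesis using not_vge_mult[of 0 ?z 0 ?z] not_vge_mult[of 0 ?z 0 "?z * ?z"] by auto
    qed
  next
    assume z: "V 1 ?z"
    have y: "V 1 ?y" by (rule vge_Y_if_vge_Z[OF z F'])
    have "V 0 x" using vge_Z[of 0 x] vge_mono[OF z] by simp
    moreover have ty: "V 1 (2 * ?y + A3)" by (intro vge_add A vge_mult_0[OF vge_numeral y])
    moreover have "V 1 (- 3 * ?z^2 - 2 * A2 * ?z - A4)"
    proof -
      have "- 3 * ?z^2 - 2 * A2 * ?z - A4 = - (3 * (?z * ?z)) - 2 * (A2 * ?z) - A4" by Groebner_Basis.algebra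
      moreover have "V 1 (- (3 * (?z * ?z)) - 2 * (A2 * ?z) - A4)"
        by (intro vge_diff vge_minus[THEN iffD2] A vge_mult_0[OF vge_numeral]
            vge_mult_le[OF z z] vge_mult_le[OF A(1) z]) auto
      ultimately show ?thesis by (simp only:)
    qed
    ultimately show "V 0 x \<and> V 1 (b1 * y - 3 * x^2 - 2 * b2 * x - b4) \<and> V 1 (2 * y + b1 * x + b3)"
      using px py by simp
  qed
qed

lemma E0pts_None [simp]: "None \<in> E0pts p B"
  unfolding E0pts_def B_eq by simp

lemma E0pts_Some:
  assumes P: "Some (x, y) \<in> Epts p B"
  shows "Some (x, y) \<in> E0pts p B \<longleftrightarrow> \<not> pge p (\<lambda>n. Z (x n)) 1"
proof -
  have F: "\<forall>\<^sub>F n in sequentially. V 1 (weq B (x n) (y n))"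
    using P by (intro pnullD) (simp add: Epts_Some)
  have "pge p x 0 \<and> pge p (\<lambda>n. b1 * y n - 3 * x n ^ 2 - 2 * b2 * x n - b4) 1
         \<and> pge p (\<lambda>n. 2 * y n + b1 * x n + b3) 1 \<longleftrightarrow>
      (\<forall>\<^sub>F n in sequentially. V 0 (x n) \<and> V 1 (b1 * y n - 3 * x n ^ 2 - 2 * b2 * x n - b4)
         \<and> V 1 (2 * y n + b1 * x n + b3))"
    by (simp add: pge_eventually eventually_conj_iff)
  also have "\<dots> \<longleftrightarrow> pge p (\<lambda>n. Z (x n)) 1"
    unfolding pge_eventually
    by (rule eventually_cong[OF F]) (rule singular_iff)
  finally show ?thesis using P unfolding E0pts_def B_eq by auto
qed

text \<open>The chord through a nonsingular and a singular point has \<^term>\<open>l^2 - z1\<close> of positive valuation,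
  so its third point is singular.\<close>

lemma mixed_third:
  assumes z1: "\<not> V 1 z1" and F: "V 1 (weq T z1 y1)" and z2: "V 1 z2" and y2: "V 1 y2"
    and line: "V 1 ((y1 - y2) - l * (z1 - z2))"
  shows "V 1 (l^2 - A2 - z1 - z2)"
proof -
  define e where "e = rat_val p z1"
  have z1': "V e z1" "\<not> V (e + 1) z1" "e \<le> 0" using z1 by (auto simp: e_def vge_def)
  define w where "w = y2 + ((y1 - y2) - l * (z1 - z2))"
  have w: "V 1 w" unfolding w_def by (intro vge_add y2 line)
  have lw: "l * (z1 - z2) = y1 - w" unfolding w_def by Groebner_Basis.algebra
  have d: "\<not> V (e + 1) (z1 - z2)" using vge_diff_iff'[of "e + 1" z2 z1] vge_mono[OF z2] z1' by simp
  have d0: "z1 - z2 \<noteq> 0" using d by auto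
  have zz: "V (2 * e) (z1 * z1)" by (rule vge_mult_le[OF z1'(1) z1'(1)]) simp
  \<comment> \<open>A pole would have 2 v(y1) = 3 e; the cruder integral bound 2 e suffices since e
    <= 0.\<close>
  have y1: "V (2 * e) y1"
  proof (rule ccontr)
    assume n: "\<not> V (2 * e) y1"
    then have "\<not> V (2 * e) (y1 + A3)" using vge_add_iff'[of "2 * e" A3 y1] vge_mono[OF A(2), of "2 * e"] z1' by simp
    then have "\<not> V (4 * e - 1) (y1 * (y1 + A3))"
      using not_vge_mult[of "2 * e - 1" y1 "2 * e - 1" "y1 + A3"] n by simp
    moreover have "y1 * (y1 + A3) = weq T z1 y1 + (z1 * (z1 * z1) + A2 * (z1 * z1) + A4 * z1 + A6)"
      unfolding weq_tuple by Groebner_Basis.algebra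
    moreover have "V (4 * e - 1) (weq T z1 y1 + (z1 * (z1 * z1) + A2 * (z1 * z1) + A4 * z1 + A6))"
      using z1'(3)
      by (intro vge_add vge_mono[OF F] vge_mono[OF A(4)] vge_mult_le[OF z1'(1) zz]
          vge_mult_le[OF A(1) zz] vge_mult_le[OF A(3) z1'(1)]) auto
    ultimately show False by simp
  qed
  let ?num = "weq T z1 y1 + A2 * (z1 * z1) + A4 * z1 + A6 - A3 * y1 - 2 * (y1 * w) + w * w
    + 2 * ((z1 * z1) * z2) - z1 * (z2 * z2)"
  \<comment> \<open>Multiplying by (z1 - z2)^2 replaces the slope by y1 - w; then y1^2 - z1^3
    cancels through the curve equation, and every remaining term has valuation at least 2 e +
    1.\<close>
  have num: "(z1 - z2) * ((z1 - z2) * (l^2 - z1)) = ?num"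
  proof -
    have "(z1 - z2) * ((z1 - z2) * (l^2 - z1)) = (y1 - w)^2 - z1 * (z1 - z2)^2"
      unfolding lw[symmetric] by Groebner_Basis.algebra
    also have "\<dots> = ?num" unfolding weq_tuple by Groebner_Basis.algebra
    finally show ?thesis .
  qed
  have "V (2 * e + 1) ?num"
    using z1'(3)
    by (intro vge_add vge_diff vge_mono[OF F] vge_mono[OF A(4)] vge_mult_le[OF A(1) zz]
        vge_mult_le[OF A(3) z1'(1)] vge_mult_le[OF A(2) y1] vge_mult_0[OF vge_numeral]
        vge_mult_le[OF y1 w] vge_mult_le[OF w w] vge_mult_le[OF zz z2]
        vge_mult_le[OF z1'(1) vge_mult_le[OF z2 z2 order.refl]]) auto
  then have "V (e + (e + 1)) ((z1 - z2) * ((z1 - z2) * (l^2 - z1)))" unfolding num by (simp add: algebra_simps)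
  then have "V (e + 1) ((z1 - z2) * (l^2 - z1))" using vge_cancel d by blast
  then have "V 1 (l^2 - z1)" using vge_cancel d by blast
  then have "V 1 ((l^2 - z1) - A2 - z2)" by (rule vge_diff[OF vge_diff[OF _ A(1)] z2])
  moreover have "(l^2 - z1) - A2 - z2 = l^2 - A2 - z1 - z2" by Groebner_Basis.algebra
  ultimately show ?thesis by (simp only:)
qed

end

text \<open>A relation that is the kernel of a map has the nonempty fibres as classes, so its being
  an equivalence comes from \<open>f\<close> and not from the group law.\<close>

lemma E0_index_eq_card_image:
  assumes "\<And>P Q. P \<in> Epts p A \<Longrightarrow> Q \<in> Epts p A \<Longrightarrow> wadd p A P (wneg A Q) \<in> E0pts p A \<longleftrightarrow> f P = f Q"
  shows "E0_index p A = card (f ` Epts p A)"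
proof -
  let ?S = "Epts p A"
  let ?R = "{(P, Q). P \<in> ?S \<and> Q \<in> ?S \<and> wadd p A P (wneg A Q) \<in> E0pts p A}"
  let ?g = "\<lambda>c. {Q \<in> ?S. f Q = c}"
  have "?R `` {P} = ?g (f P)" if "P \<in> ?S" for P
    using that assms by auto
  then have "?S // ?R = (\<lambda>P. ?g (f P)) ` ?S"
    unfolding quotient_def by blast
  then have "?S // ?R = ?g ` f ` ?S" by (simp only: image_image)
  moreover have "inj_on ?g (f ` ?S)" by (rule inj_onI) blast
  ultimately show ?thesis unfolding E0_index_def by (simp add: card_image)
qed

section \<open>The component map and the index that it computes\<close>

context tate_form
begin

text \<open>Component 0 is \<open>E\<^sub>0\<close>. For types IV and IV* a singular point has \<open>y\<close> or \<open>y + A\<^sub>3\<close> of valuation at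
  least \<open>k\<close>, which tells components 1 and 2 apart; with \<open>k = 0\<close> all singular points lie in component 1.\<close>

definition component_at :: "int \<Rightarrow> rat \<Rightarrow> rat \<Rightarrow> nat" where
  "component_at k z y = (if \<not> V 1 z then 0 else if V k y then 1 else 2)"

definition component :: "int \<Rightarrow> ppoint \<Rightarrow> nat" where
  "component k P = (case P of None \<Rightarrow> 0 | Some (x, y) \<Rightarrow>
     if \<not> pge p (\<lambda>n. Z (x n)) 1 then 0 else if pge p (\<lambda>n. Y (x n) (y n)) k then 1 else 2)"

lemma pcauchy_Z: "pcauchy p x \<Longrightarrow> pcauchy p (\<lambda>n. Z (x n))"
  by (intro pcauchy_intros)

lemma pcauchy_Y: "pcauchy p x \<Longrightarrow> pcauchy p y \<Longrightarrow> pcauchy p (\<lambda>n. Y (x n) (y n))"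
  by (intro pcauchy_intros)

lemma eventually_component_at:
  assumes "pcauchy p x" "pcauchy p y"
  shows "\<forall>\<^sub>F n in sequentially. component_at k (Z (x n)) (Y (x n) (y n)) = component k (Some (x, y))"
proof -
  have "\<forall>\<^sub>F n in sequentially. V 1 (Z (x n)) \<longleftrightarrow> pge p (\<lambda>n. Z (x n)) 1"
    using not_pge_eventually[OF pcauchy_Z[OF assms(1)], of 1]
    by (cases "pge p (\<lambda>n. Z (x n)) 1") (auto simp: pge_eventually)
  moreover have "\<forall>\<^sub>F n in sequentially. V k (Y (x n) (y n)) \<longleftrightarrow> pge p (\<lambda>n. Y (x n) (y n)) k"
    using not_pge_eventually[OF pcauchy_Y[OF assms], of k]
    by (cases "pge p (\<lambda>n. Y (x n) (y n)) k") (auto simp: pge_eventually)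
  ultimately show ?thesis
    by eventually_elim (simp add: component_at_def component_def)
qed

text \<open>There are two third ordinates: \<open>y3'\<close> belongs to the sum, in coordinates of
  \<open>B\<close>, while \<open>y3\<close> belongs to the third intersection with the line, before
  reflection and in coordinates of \<open>T\<close>. Only the latter is collinear with the two given
  points, so that \<open>mixed_third\<close> can be applied to it.\<close>

lemma third_point_eventually:
  assumes P: "Some (x1, y1) \<in> Epts p B" and Q: "Some (x2, y2) \<in> Epts p B"
    and nop: "\<not> (peq p x1 x2 \<and> pnull p (\<lambda>n. y1 n + y2 n + b1 * x2 n + b3))"
  obtains l x3 y3 y3' where
    "wadd p B (Some (x1, y1)) (Some (x2, y2)) = Some (x3, y3')"
    "\<And>k. \<forall>\<^sub>F n in sequentially. Z (x3 n) = l n ^ 2 - A2 - Z (x1 n) - Z (x2 n)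
       \<and> V k (Y (x1 n) (y1 n) - Y (x2 n) (y2 n) - l n * (Z (x1 n) - Z (x2 n)))
       \<and> V k (Y (x1 n) (y1 n) - y3 n - l n * (Z (x1 n) - Z (x3 n)))
       \<and> V k (Y (x2 n) (y2 n) - y3 n - l n * (Z (x2 n) - Z (x3 n)))
       \<and> V k (weq T (Z (x3 n)) (y3 n))
       \<and> V k (l n * (Y (x1 n) (y1 n) + Y (x2 n) (y2 n) + A3)
          - (Z (x1 n) ^ 2 + Z (x1 n) * Z (x2 n) + Z (x2 n) ^ 2 + A2 * (Z (x1 n) + Z (x2 n)) + A4))"
proof -
  obtain l nu x3 where l: "pcauchy p l" "pcauchy p nu"
    and x3: "x3 = (\<lambda>n. l n ^ 2 + b1 * l n - b2 - x1 n - x2 n)"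
    and add: "wadd p B (Some (x1, y1)) (Some (x2, y2)) = Some (x3, \<lambda>n. - (l n + b1) * x3 n - nu n - b3)"
    and n: "pnull p (\<lambda>n. y1 n - l n * x1 n - nu n)"
      "pnull p (\<lambda>n. y2 n - l n * x2 n - nu n)"
      "pnull p (\<lambda>n. l n * (y1 n + y2 n + b1 * x2 n + b3)
        - (x1 n ^ 2 + x1 n * x2 n + x2 n ^ 2 + b2 * (x1 n + x2 n) + b4 - b1 * y1 n))"
    using wadd_line[OF B_eq P Q nop] by blast
  let ?y = "\<lambda>n. - (l n + b1) * x3 n - nu n - b3"
  let ?y3 = "\<lambda>n. Y (x3 n) (l n * x3 n + nu n)"
  have S: "Some (x3, ?y) \<in> Epts p B" using wadd_Epts[OF P Q] add by simp
  then have "Some (x3, ?y) \<in> Epts p B" "Some (x3, \<lambda>n. l n * x3 n + nu n) \<in> Epts p B"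
    using wneg_Epts[OF S] by (simp_all add: wneg_def B_eq algebra_simps)
  then have n3: "pnull p (\<lambda>n. weq B (x3 n) (l n * x3 n + nu n))" by (simp add: Epts_Some)
  show ?thesis
  proof (rule that[of x3 ?y "\<lambda>n. u * l n + s" ?y3])
    fix k
    show "\<forall>\<^sub>F n in sequentially. Z (x3 n) = (u * l n + s) ^ 2 - A2 - Z (x1 n) - Z (x2 n)
       \<and> V k (Y (x1 n) (y1 n) - Y (x2 n) (y2 n) - (u * l n + s) * (Z (x1 n) - Z (x2 n)))
       \<and> V k (Y (x1 n) (y1 n) - ?y3 n - (u * l n + s) * (Z (x1 n) - Z (x3 n)))
       \<and> V k (Y (x2 n) (y2 n) - ?y3 n - (u * l n + s) * (Z (x2 n) - Z (x3 n)))
       \<and> V k (weq T (Z (x3 n)) (?y3 n))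
       \<and> V k ((u * l n + s) * (Y (x1 n) (y1 n) + Y (x2 n) (y2 n) + A3)
          - (Z (x1 n) ^ 2 + Z (x1 n) * Z (x2 n) + Z (x2 n) ^ 2 + A2 * (Z (x1 n) + Z (x2 n)) + A4))"
      using pnullD[OF n(1), of k] pnullD[OF n(2), of k] pnullD[OF n(3), of k] pnullD[OF n3, of k]
    proof eventually_elim
      case (elim n)
      have e1: "Y (x1 n) (y1 n) - Y (x2 n) (y2 n) - (u * l n + s) * (Z (x1 n) - Z (x2 n))
         = u^3 * ((y1 n - l n * x1 n - nu n) - (y2 n - l n * x2 n - nu n))" by Groebner_Basis.algebra
      have e2: "Y (x1 n) (y1 n) - ?y3 n - (u * l n + s) * (Z (x1 n) - Z (x3 n))
         = u^3 * (y1 n - l n * x1 n - nu n)" by Groebner_Basis.algebra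
      have e3: "Y (x2 n) (y2 n) - ?y3 n - (u * l n + s) * (Z (x2 n) - Z (x3 n))
         = u^3 * (y2 n - l n * x2 n - nu n)" by Groebner_Basis.algebra
      have e4: "Z (x3 n) = (u * l n + s) ^ 2 - A2 - Z (x1 n) - Z (x2 n)" unfolding x3 by (rule Z_third)
      have e5: "V k ((u * l n + s) * (Y (x1 n) (y1 n) + Y (x2 n) (y2 n) + A3)
          - (Z (x1 n) ^ 2 + Z (x1 n) * Z (x2 n) + Z (x2 n) ^ 2 + A2 * (Z (x1 n) + Z (x2 n)) + A4))"
        unfolding slope_T[where nu = "nu n"]
        by (intro vge_diff vge_unit_mult[THEN iffD2] vge_mult_0[OF vge_mult_0[OF rst(2) vge_power_0[OF u(1)]]] elim)
      show ?case
        unfolding e1 e2 e3 weq_T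
        by (intro conjI e4 e5 vge_unit_mult[THEN iffD2] vge_diff elim)
    qed
  qed (use add in simp)
qed

text \<open>Points are sequences, not limits, so P - Q = O only says that the coordinates agree up
  to null sequences.\<close>

lemma component_cong:
  assumes P: "Some (x1, y1) \<in> Epts p B" and Q: "Some (x2, y2) \<in> Epts p B"
    and x: "peq p x1 x2" and y: "pnull p (\<lambda>n. y1 n - y2 n)"
  shows "component k (Some (x1, y1)) = component k (Some (x2, y2))"
proof -
  have "pnull p (\<lambda>n. u^2 * (x1 n - x2 n))"
    by (intro pnull_mult pcauchy_const) (use x in \<open>simp add: peq_def\<close>)
  then have "pnull p (\<lambda>n. Z (x1 n) - Z (x2 n))" by (simp add: algebra_simps)
  from pnullD[OF this, of 1] have z: "pge p (\<lambda>n. Z (x1 n)) 1 \<longleftrightarrow> pge p (\<lambda>n. Z (x2 n)) 1"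
    unfolding pge_eventually by (rule eventually_cong) (rule vge_cong)
  have "pnull p (\<lambda>n. u^3 * (y1 n - y2 n) + s * u^2 * (x1 n - x2 n))"
    by (intro pnull_add pnull_mult pcauchy_const y) (use x in \<open>simp add: peq_def\<close>)
  then have "pnull p (\<lambda>n. Y (x1 n) (y1 n) - Y (x2 n) (y2 n))" by (simp add: algebra_simps)
  from pnullD[OF this, of k] have "pge p (\<lambda>n. Y (x1 n) (y1 n)) k \<longleftrightarrow> pge p (\<lambda>n. Y (x2 n) (y2 n)) k"
    unfolding pge_eventually by (rule eventually_cong) (rule vge_cong)
  with z show ?thesis by (simp add: component_def)
qed

text \<open>The residual order 8 is larger than every valuation occurring in the reduction types below.\<close>

theorem E0_index_component:
  assumes H: "\<And>z1 y1 z2 y2 l. V 1 z1 \<Longrightarrow> V 1 z2 \<Longrightarrow> V 8 (weq T z1 y1) \<Longrightarrow> V 8 (weq T z2 y2) \<Longrightarrow>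
     V 8 (y1 - y2 - l * (z1 - z2)) \<Longrightarrow>
     V 8 (l * (y1 + y2 + A3) - (z1^2 + z1 * z2 + z2^2 + A2 * (z1 + z2) + A4)) \<Longrightarrow>
     V 1 (l^2 - A2 - z1 - z2) \<longleftrightarrow> component_at k z1 y1 \<noteq> component_at k z2 (- y2 - A3)"
  shows "E0_index p B = card (component k ` Epts p B)"
proof (rule E0_index_eq_card_image)
  fix P Q assume P: "P \<in> Epts p B" and Q: "Q \<in> Epts p B"
  have E0: "R \<in> E0pts p B \<longleftrightarrow> component k R = 0" if "R \<in> Epts p B" for R
    using that E0pts_Some by (cases R) (auto simp: component_def split: if_splits)
  consider "P = None" | "Q = None" | x1 y1 x2 y2 where "P = Some (x1, y1)" "Q = Some (x2, y2)"
    by (metis option.exhaust prod.collapse)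
  then show "wadd p B P (wneg B Q) \<in> E0pts p B \<longleftrightarrow> component k P = component k Q"
  proof cases
    case 1
    have "component k (wneg B Q) = 0 \<longleftrightarrow> component k Q = 0"
      by (cases Q) (auto simp: component_def wneg_def B_eq split: if_splits)
    then show ?thesis
      using 1 E0[OF wneg_Epts[OF Q]] by (auto simp: wadd_def B_eq component_def)
  next
    case 2
    then show ?thesis
      using E0[OF P] by (cases P) (auto simp: wadd_def B_eq component_def wneg_def)
  next
    case 3
    define y where "y n = - y2 n - b1 * x2 n - b3" for n
    have neg: "wneg B Q = Some (x2, y)" using 3 by (simp add: wneg_def B_eq y_def fun_eq_iff)
    have R: "Some (x2, y) \<in> Epts p B" using wneg_Epts[OF Q] neg by simp
    have c: "pcauchy p x1" "pcauchy p y1" "pcauchy p x2" "pcauchy p y2" "pcauchy p y"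
      and F: "pnull p (\<lambda>n. weq B (x1 n) (y1 n))" "pnull p (\<lambda>n. weq B (x2 n) (y n))"
      using P Q R 3 by (auto simp: Epts_Some)
    show ?thesis
    proof (cases "peq p x1 x2 \<and> pnull p (\<lambda>n. y1 n + y n + b1 * x2 n + b3)")
      case True
      then have "pnull p (\<lambda>n. y1 n - y2 n)" by (simp add: y_def)
      then have "component k P = component k Q" using component_cong[of x1 y1 x2 y2 k] P Q 3 True by simp
      moreover have "wadd p B P (wneg B Q) = None"
        unfolding neg using 3 True by (simp add: wadd_def B_eq)
      ultimately show ?thesis by simp
    next
      case False
      obtain l x3 y3 y3' where add: "wadd p B (Some (x1, y1)) (Some (x2, y)) = Some (x3, y3')"
        and ev: "\<And>k. \<forall>\<^sub>F n in sequentially. Z (x3 n) = l n ^ 2 - A2 - Z (x1 n) - Z (x2 n)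
       \<and> V k (Y (x1 n) (y1 n) - Y (x2 n) (y n) - l n * (Z (x1 n) - Z (x2 n)))
       \<and> V k (Y (x1 n) (y1 n) - y3 n - l n * (Z (x1 n) - Z (x3 n)))
       \<and> V k (Y (x2 n) (y n) - y3 n - l n * (Z (x2 n) - Z (x3 n)))
       \<and> V k (weq T (Z (x3 n)) (y3 n))
       \<and> V k (l n * (Y (x1 n) (y1 n) + Y (x2 n) (y n) + A3)
          - (Z (x1 n) ^ 2 + Z (x1 n) * Z (x2 n) + Z (x2 n) ^ 2 + A2 * (Z (x1 n) + Z (x2 n)) + A4))"
        by (rule third_point_eventually[OF P[unfolded 3] R False]) (rule that)
      have S: "Some (x3, y3') \<in> Epts p B" using wadd_Epts[OF P[unfolded 3] R] add by simp
      then have c3: "pcauchy p x3" "pcauchy p y3'" by (auto simp: Epts_Some)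
      have "\<forall>\<^sub>F n in sequentially. component k (Some (x3, y3')) = 0 \<longleftrightarrow> component k P = component k Q"
        using ev[of 8] pnullD[OF F(1), of 8] pnullD[OF F(2), of 8]
          eventually_component_at[OF c(1,2), of k] eventually_component_at[OF c(3,4), of k]
          eventually_component_at[OF c3, of k]
      proof eventually_elim
        case (elim n)
        let ?z1 = "Z (x1 n)" and ?z2 = "Z (x2 n)" and ?z3 = "Z (x3 n)"
        let ?y1 = "Y (x1 n) (y1 n)" and ?y2 = "Y (x2 n) (y n)"
        have F8: "V 8 (weq T ?z1 ?y1)" "V 8 (weq T ?z2 ?y2)" "V 8 (weq T ?z3 (y3 n))"
          using elim by (simp_all add: weq_T)
        then have F1: "V 1 (weq T ?z1 ?y1)" "V 1 (weq T ?z2 ?y2)" "V 1 (weq T ?z3 (y3 n))"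
          by (auto elim: vge_mono)
        have sing: "V 1 ?z1 \<Longrightarrow> V 1 ?y1" "V 1 ?z2 \<Longrightarrow> V 1 ?y2" "V 1 ?z3 \<Longrightarrow> V 1 (y3 n)"
          using vge_Y_if_vge_Z F1 by blast+
        have z3: "?z3 = l n ^ 2 - A2 - ?z1 - ?z2" "?z2 = l n ^ 2 - A2 - ?z1 - ?z3"
          "?z1 = l n ^ 2 - A2 - ?z2 - ?z3" "?z3 = l n ^ 2 - A2 - ?z2 - ?z1"
          using elim by simp_all
        have line: "V 1 (?y1 - ?y2 - l n * (?z1 - ?z2))" "V 1 (?y1 - y3 n - l n * (?z1 - ?z3))"
          "V 1 (?y2 - y3 n - l n * (?z2 - ?z3))"
          using elim by (auto elim: vge_mono)
        have line': "V 1 (?y2 - ?y1 - l n * (?z2 - ?z1))"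
          using line(1) vge_minus[of 1 "?y2 - ?y1 - l n * (?z2 - ?z1)"] by (simp add: algebra_simps)
        \<comment> \<open>The chord passes through P and -Q, whereas the component of Q is read at
          the reflected ordinate.\<close>
        have y2: "- ?y2 - A3 = Y (x2 n) (y2 n)" unfolding y_def Y_neg by simp
        have 0: "component k (Some (x3, y3')) = 0 \<longleftrightarrow> \<not> V 1 ?z3" "component k P = 0 \<longleftrightarrow> \<not> V 1 ?z1"
          "component k Q = 0 \<longleftrightarrow> \<not> V 1 ?z2"
          using elim(4-6) 3 by (auto simp: component_at_def split: if_splits)
        consider "V 1 ?z1" "V 1 ?z2" | "\<not> V 1 ?z1" "V 1 ?z2" | "V 1 ?z1" "\<not> V 1 ?z2" | "\<not> V 1 ?z1" "\<not> V 1 ?z2"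
          by blast
        then show ?case
        proof cases
          case 1
          have "V 1 ?z3 \<longleftrightarrow> component_at k ?z1 ?y1 \<noteq> component_at k ?z2 (- ?y2 - A3)"
            unfolding z3(1) using elim by (intro H 1 F8) simp_all
          then show ?thesis using elim(4-6) 3 0 unfolding y2 by auto
        next
          case 2
          have "V 1 ?z3" unfolding z3(1)
            by (rule mixed_third[OF 2(1) F1(1) 2(2) sing(2)[OF 2(2)] line(1)])
          then show ?thesis using 0 2 by auto
        next
          case 3
          have "V 1 ?z3" unfolding z3(4)
            by (rule mixed_third[OF 3(2) F1(2) 3(1) sing(1)[OF 3(1)] line'])
          then show ?thesis using 0 3 by auto
        next
          case 4
          \<comment> \<open>Collinearity is symmetric: a singular third point together with the
            nonsingular first one would make the second one singular.\<close>
          have "\<not> V 1 ?z3"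
          proof
            assume s: "V 1 ?z3"
            have "V 1 (l n ^ 2 - A2 - ?z1 - ?z3)"
              by (rule mixed_third[OF 4(1) F1(1) s sing(3)[OF s] line(2)])
            then show False using 4 z3(2) by simp
          qed
          then show ?thesis using 0 4 by auto
        qed
      qed
      then have "component k (Some (x3, y3')) = 0 \<longleftrightarrow> component k P = component k Q" by simp
      moreover have "wadd p B P (wneg B Q) = Some (x3, y3')" unfolding neg 3(1) by (rule add)
      ultimately show ?thesis using E0[OF S] by simp
    qed
  qed
qed

end

section \<open>Kodaira types III, III*, IV and IV*\<close>

lemma image_eqI_ball: "\<forall>x\<in>S. f x \<in> C \<Longrightarrow> \<forall>c\<in>C. \<exists>x\<in>S. f x = c \<Longrightarrow> f ` S = C"
  by (auto simp: image_iff)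

context tate_form
begin

text \<open>If nothing reduces to the cusp, all points lie in component 0 and the hypothesis of
  \<open>E0_index_component\<close> is vacuous. This covers types II and II* and the nonsplit forms
  of IV and IV*.\<close>

lemma E0_index_no_singular_points:
  assumes "\<And>z y. V 1 z \<Longrightarrow> V 1 y \<Longrightarrow> \<not> V 8 (weq T z y)"
  shows "E0_index p B = 1"
proof -
  have no: "\<not> V 8 (weq T z y)" if "V 1 z" for z y
    using assms[OF that] vge_Y_if_vge_Z[OF that, of y] vge_mono[of 8 "weq T z y" 1] by auto
  have "component 0 P = 0" if P: "P \<in> Epts p B" for P
  proof (cases P)
    case (Some xy)
    obtain x y where xy: "xy = (x, y)" by force
    have F: "\<forall>\<^sub>F n in sequentially. V 8 (weq B (x n) (y n))"
      using P Some xy by (intro pnullD) (simp add: Epts_Some)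
    have "\<not> pge p (\<lambda>n. Z (x n)) 1"
    proof
      assume "pge p (\<lambda>n. Z (x n)) 1"
      then have "\<forall>\<^sub>F n in sequentially. V 1 (Z (x n))" by (simp add: pge_eventually)
      with F have "\<forall>\<^sub>F n in sequentially. False"
      proof eventually_elim
        case (elim n)
        then show ?case using no[of "Z (x n)" "Y (x n) (y n)"] by (simp add: weq_T)
      qed
      then show False by simp
    qed
    then show ?thesis by (simp add: Some xy component_def)
  qed (simp add: component_def)
  moreover have "\<exists>P \<in> Epts p B. component 0 P = 0" by (rule bexI[of _ None]) (simp_all add: component_def)
  ultimately have "component 0 ` Epts p B = {0}" by (intro image_eqI_ball) simp_all
  moreover have "E0_index p B = card (component 0 ` Epts p B)"
    by (rule E0_index_component) (use no in blast)
  ultimately show ?thesis by simp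
qed

lemma point_on_B:
  assumes "pcauchy p z" "pcauchy p y" "pnull p (\<lambda>n. weq T (z n) (y n))" "pge p z 1"
  shows "\<exists>P \<in> Epts p B. component k P = (if pge p y k then 1 else 2)"
proof -
  define x where "x n = (z n - r) / u^2" for n
  define w where "w n = (y n - s * u^2 * x n - t) / u^3" for n
  have Z: "Z (x n) = z n" and Y: "Y (x n) (w n) = y n" for n
    using u0 by (simp_all add: x_def w_def)
  have x: "pcauchy p x" unfolding x_def divide_inverse by (intro pcauchy_intros assms)
  have w: "pcauchy p w" unfolding w_def divide_inverse by (intro pcauchy_intros assms x)
  have "pnull p (\<lambda>n. inverse (u^6) * weq T (z n) (y n))"
    by (intro pnull_mult assms pcauchy_const)
  moreover have "inverse (u^6) * weq T (z n) (y n) = weq B (x n) (w n)" for n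
    using weq_T[of "x n" "w n"] u0 unfolding Z Y by simp
  ultimately have "Some (x, w) \<in> Epts p B" using x w by (simp add: Epts_Some)
  moreover have "component k (Some (x, w)) = (if pge p y k then 1 else 2)"
    using assms(4) unfolding component_def by (simp add: Z Y)
  ultimately show ?thesis by blast
qed

lemma not_vge_third:
  assumes "V 1 z1" "V 1 z2" "\<not> V 1 l"
  shows "\<not> V 1 (l^2 - A2 - z1 - z2)"
proof
  assume "V 1 (l^2 - A2 - z1 - z2)"
  then have "V 1 (l * l)"
    using vge_diff_iff'[OF A(1), of "l * l"] vge_diff_iff'[OF assms(1), of "l * l - A2"]
      vge_diff_iff'[OF assms(2), of "l * l - A2 - z1"] by (simp add: power2_eq_square)
  then show False using not_vge_mult[of 0 l 0 l] assms(3) by simp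
qed

text \<open>\<open>K\<close> is 1 for type III and 3 for type III*. If \<open>l\<close> were
  divisible by p, the left side of the slope relation and all terms on its right except
  \<open>A4\<close> would have valuation above \<open>K\<close>, against the bound on
  \<open>A4\<close>. So the difference of two singular points is always nonsingular.\<close>

lemma E0_index_2:
  assumes A3: "A3 = 0" and K: "K \<le> 7"
    and y: "\<And>z y. V 1 z \<Longrightarrow> V 8 (weq T z y) \<Longrightarrow> V K y"
    and z: "\<And>z y. V 1 z \<Longrightarrow> V 8 (weq T z y) \<Longrightarrow> V k z"
    and k: "1 \<le> k" "K + 1 \<le> 2 * k" "V k A2" "\<not> V (K + 1) A4"
    and point: "pcauchy p z0" "pcauchy p y0" "pnull p (\<lambda>n. weq T (z0 n) (y0 n))" "pge p z0 1"
  shows "E0_index p B = 2"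
proof -
  have E: "E0_index p B = card (component 0 ` Epts p B)"
  proof (rule E0_index_component)
    fix z1 y1 z2 y2 l
    assume z12: "V 1 z1" "V 1 z2" and F: "V 8 (weq T z1 y1)" "V 8 (weq T z2 y2)"
      and sl: "V 8 (l * (y1 + y2 + A3) - (z1^2 + z1 * z2 + z2^2 + A2 * (z1 + z2) + A4))"
    note zk = z[OF z12(1) F(1)] z[OF z12(2) F(2)]
    have yK: "V K (y1 + y2)" by (rule vge_add[OF y[OF z12(1) F(1)] y[OF z12(2) F(2)]])
    have "\<not> V 1 l"
    proof
      assume l: "V 1 l"
      have "V (K + 1) (l * (y1 + y2))" by (rule vge_mult_le[OF l yK]) simp
      moreover have "V (K + 1) (l * (y1 + y2) - (z1 * z1 + z1 * z2 + z2 * z2 + A2 * (z1 + z2) + A4))"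
        using vge_mono[OF sl, of "K + 1"] A3 K by (simp add: power2_eq_square)
      ultimately have "V (K + 1) (l * (y1 + y2) - (l * (y1 + y2)
          - (z1 * z1 + z1 * z2 + z2 * z2 + A2 * (z1 + z2) + A4)))"
        by (rule vge_diff)
      then have "V (K + 1) (z1 * z1 + z1 * z2 + z2 * z2 + A2 * (z1 + z2) + A4)"
        by (simp only: diff_diff_eq2 add_diff_cancel_left')
      moreover have "V (K + 1) (z1 * z1 + z1 * z2 + z2 * z2 + A2 * (z1 + z2))"
        by (intro vge_add vge_mult_le[OF zk(1) zk(1)] vge_mult_le[OF zk(1) zk(2)]
            vge_mult_le[OF zk(2) zk(2)] vge_mult_le[OF k(3) vge_add[OF zk]]) (use k in auto)
      ultimately show False using vge_add_iff k(4) by blast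
    qed
    moreover have "V 0 y1" "V 0 y2"
      using vge_mono[OF vge_Y_if_vge_Z[OF z12(1) vge_mono[OF F(1)]], of 0]
        vge_mono[OF vge_Y_if_vge_Z[OF z12(2) vge_mono[OF F(2)]], of 0] by simp_all
    ultimately show "V 1 (l^2 - A2 - z1 - z2) \<longleftrightarrow> component_at 0 z1 y1 \<noteq> component_at 0 z2 (- y2 - A3)"
      using not_vge_third[OF z12] A3 z12 by (simp add: component_at_def)
  qed
  have "component 0 P \<in> {0, 1}" if P: "P \<in> Epts p B" for P
  proof (cases P)
    case (Some xy)
    obtain x w where xy: "xy = (x, w)" by force
    have F: "\<forall>\<^sub>F n in sequentially. V 1 (weq B (x n) (w n))"
      using P Some xy by (intro pnullD) (simp add: Epts_Some)
    have "pge p (\<lambda>n. Y (x n) (w n)) 0" if "pge p (\<lambda>n. Z (x n)) 1"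
      using F that unfolding pge_eventually
    proof eventually_elim
      case (elim n)
      then have "V 1 (weq T (Z (x n)) (Y (x n) (w n)))" by (simp add: weq_T)
      from vge_Y_if_vge_Z[OF elim(2) this] show ?case by (rule vge_mono) simp
    qed
    then show ?thesis by (simp add: component_def Some xy)
  qed (simp add: component_def)
  moreover have "\<exists>P \<in> Epts p B. component 0 P = 0" by (rule bexI[of _ None]) (simp_all add: component_def)
  moreover have "pge p y0 0"
  proof -
    have "\<forall>\<^sub>F n in sequentially. V 1 (z0 n)" using point(4) by (simp add: pge_eventually)
    then show ?thesis
      unfolding pge_eventually using pnullD[OF point(3), of 1]
    proof eventually_elim
      case (elim n)
      show ?case by (rule vge_mono[OF vge_Y_if_vge_Z[OF elim]]) simp
    qed
  qed
  ultimately have "component 0 ` Epts p B = {0, 1}"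
    using point_on_B[OF point, of 0] by (intro image_eqI_ball ballI) (blast, force)
  then show ?thesis using E by simp
qed

lemma E0_index_type_III:
  assumes "A3 = 0" "\<not> V 2 A4" "pcauchy p z0" "pcauchy p y0" "pnull p (\<lambda>n. weq T (z0 n) (y0 n))" "pge p z0 1"
  shows "E0_index p B = 2"
proof (rule E0_index_2[of 1 1 z0 y0])
  show "V 1 y" if "V 1 z" "V 8 (weq T z y)" for z y
    using vge_Y_if_vge_Z[OF that(1) vge_mono[OF that(2)]] by simp
qed (use assms A in auto)

text \<open>The two sides of y (y + A3) = z^3 + A2 z^2 + A4 z + A6 improve each other: valuation 3
  on the left gives v(y) >= 2, hence 4 on the right, hence v(z) >= 2, hence 5 on the left.\<close>

lemma star_estimates:
  assumes z: "V 1 z" and F: "V 8 (weq T z y)"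
    and a: "V 2 A2" "V 2 A3" "V 3 A4" "V 5 A6"
  shows "V 2 z" "V 5 (y * (y + A3))"
proof -
  have eq: "y * (y + A3) = weq T z y + (z * (z * z) + (A2 * (z * z) + A4 * z + A6))"
    unfolding weq_tuple by Groebner_Basis.algebra
  have zz: "V 2 (z * z)" using vge_mult[OF z z] by simp
  have w: "V 4 (A2 * (z * z) + A4 * z + A6)"
    by (intro vge_add vge_mult_le[OF a(1) zz] vge_mult_le[OF a(3) z] vge_mono[OF a(4)]) auto
  have "V 3 (y * (y + A3))"
    unfolding eq by (intro vge_add vge_mono[OF F] vge_mono[OF w] vge_mult_le[OF z zz]) auto
  have y1: "V 1 y" using vge_Y_if_vge_Z[OF z] vge_mono[OF F] by simp
  have y: "V 2 y"
  proof (rule ccontr)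
    assume n: "\<not> V 2 y"
    then have "\<not> V 2 (y + A3)" using vge_add_iff'[OF a(2)] by simp
    then have "\<not> V 3 (y * (y + A3))" using not_vge_mult[of 1 y 1 "y + A3"] n by simp
    then show False using \<open>V 3 (y * (y + A3))\<close> by simp
  qed
  have "V 4 (y * (y + A3))" by (rule vge_mult_le[OF y vge_add[OF y a(2)]]) simp
  then have "V 4 (z * (z * z) + (A2 * (z * z) + A4 * z + A6))"
    unfolding eq using vge_add_iff[OF vge_mono[OF F], of 4] by simp
  then show z2: "V 2 z" using vge_2_if_cube[OF z] w by blast
  have zz: "V 4 (z * z)" using vge_mult[OF z2 z2] by simp
  show "V 5 (y * (y + A3))"
    unfolding eq by (intro vge_add vge_mono[OF F] vge_mult_le[OF z2 zz] vge_mult_le[OF a(1) zz]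
        vge_mult_le[OF a(3) z2] a) auto
qed

lemma E0_index_type_III_star:
  assumes "A3 = 0" "V 2 A2" "V 3 A4" "\<not> V 4 A4" "V 5 A6"
    "pcauchy p z0" "pcauchy p y0" "pnull p (\<lambda>n. weq T (z0 n) (y0 n))" "pge p z0 1"
  shows "E0_index p B = 2"
proof (rule E0_index_2[of 3 2 z0 y0])
  show "V 3 y" if "V 1 z" "V 8 (weq T z y)" for z y
    using star_estimates(2)[OF that] vge_square_cancel[of 3 y] assms by simp
  show "V 2 z" if "V 1 z" "V 8 (weq T z y)" for z y
    using star_estimates(1)[OF that] assms by simp
qed (use assms A in auto)

text \<open>Here \<open>K\<close> = v(A3), which is 1 for IV and 2 for IV*, so exactly one of y and
  y + A3 is small at a singular point. If P and -Q are on the same side, y1 + y2 + A3 has valuation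
  \<open>K\<close> and the slope relation makes \<open>l\<close> divisible by p; on opposite sides
  y1 - y2 has valuation \<open>K\<close>, and the chord equation prevents that.\<close>

lemma E0_index_3:
  assumes K: "1 \<le> K" "K \<le> 7" and A3: "V K A3" "\<not> V (K + 1) A3" and A24: "V K A2" "V (K + 1) A4"
    and z: "\<And>z y. V 1 z \<Longrightarrow> V 8 (weq T z y) \<Longrightarrow> V K z"
    and y: "\<And>z y. V 1 z \<Longrightarrow> V 8 (weq T z y) \<Longrightarrow> V (K + 1) y \<or> V (K + 1) (y + A3)"
    and point: "pcauchy p z0" "pcauchy p y0" "pnull p (\<lambda>n. weq T (z0 n) (y0 n))" "pge p z0 1"
  shows "E0_index p B = 3"
proof -
  have E: "E0_index p B = card (component (K + 1) ` Epts p B)"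
  proof (rule E0_index_component)
    fix z1 y1 z2 y2 l
    assume z12: "V 1 z1" "V 1 z2" and F: "V 8 (weq T z1 y1)" "V 8 (weq T z2 y2)"
      and line: "V 8 (y1 - y2 - l * (z1 - z2))"
      and sl: "V 8 (l * (y1 + y2 + A3) - (z1^2 + z1 * z2 + z2^2 + A2 * (z1 + z2) + A4))"
    have zk: "V K z1" "V K z2" using z[OF z12(1) F(1)] z[OF z12(2) F(2)] by auto
    note y12 = y[OF z12(1) F(1)] y[OF z12(2) F(2)]
    have neg: "V (K + 1) (- y - A3) \<longleftrightarrow> V (K + 1) (y + A3)" for y
      using vge_minus[of "K + 1" "y + A3"] by (simp del: vge_minus)
    have xor: "\<not> (V (K + 1) y \<and> V (K + 1) (y + A3))" for y
      using vge_add_iff[of "K + 1" y A3] A3(2) by auto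
    have eq: "component_at (K + 1) z1 y1 \<noteq> component_at (K + 1) z2 (- y2 - A3) \<longleftrightarrow>
        (V (K + 1) y1 \<longleftrightarrow> V (K + 1) y2)"
      unfolding component_at_def neg using z12 y12 xor[of y2] by simp blast
    show "V 1 (l^2 - A2 - z1 - z2) \<longleftrightarrow> component_at (K + 1) z1 y1 \<noteq> component_at (K + 1) z2 (- y2 - A3)"
    proof (cases "V (K + 1) y1 \<longleftrightarrow> V (K + 1) y2")
      case True
      have "\<not> V (K + 1) (y1 + y2 + A3)"
      proof (cases "V (K + 1) y1")
        case y1: True
        then show ?thesis using True vge_add_iff[OF vge_add[of "K + 1" y1 y2], of A3] A3 by simp
      next
        case False
        then have "V (K + 1) (y1 + A3)" "V (K + 1) (y2 + A3)" using True y12 by auto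
        then have "V (K + 1) ((y1 + A3) + (y2 + A3))" by (rule vge_add)
        then have "V (K + 1) (y1 + y2 + A3 + A3)" by (simp add: algebra_simps)
        then show ?thesis using vge_add_iff[of "K + 1" "y1 + y2 + A3" A3] A3(2) by blast
      qed
      moreover have "V (K + 1) (l * (y1 + y2 + A3))"
      proof -
        have "V (K + 1) (z1 * z1 + z1 * z2 + z2 * z2 + A2 * (z1 + z2) + A4)"
          by (intro vge_add vge_mult_le[OF zk(1) zk(1)] vge_mult_le[OF zk(1) zk(2)]
              vge_mult_le[OF zk(2) zk(2)] vge_mult_le[OF A24(1) vge_add[OF zk]] A24) (use K in auto)
        moreover have "V (K + 1) (l * (y1 + y2 + A3) - (z1 * z1 + z1 * z2 + z2 * z2 + A2 * (z1 + z2) + A4))"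
          using vge_mono[OF sl, of "K + 1"] K by (simp add: power2_eq_square)
        ultimately show ?thesis using vge_diff_iff' by blast
      qed
      ultimately have l: "V 1 l" using vge_cancel[of K 1 "y1 + y2 + A3" l] by (simp add: mult.commute)
      have "V 1 (l * l - A2 - z1 - z2)"
        by (intro vge_diff A z12 vge_mult_le[OF l l]) auto
      then show ?thesis using eq True by (simp add: power2_eq_square)
    next
      case False
      have n: "\<not> V (K + 1) (y1 - y2)"
      proof (cases "V (K + 1) y1")
        case y1: True
        then have "V (K + 1) (y1 - (y2 + A3))" using False y12 by (intro vge_diff) auto
        then have "V (K + 1) (y1 - (y2 + A3) + A3) \<longleftrightarrow> V (K + 1) A3" by (rule vge_add_iff)
        then show ?thesis using A3 by simp
      next
        case y1: False
        then have "V (K + 1) (y2 - (y1 + A3))" using False y12 by (intro vge_diff) auto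
        then have "V (K + 1) (y2 - (y1 + A3) + A3) \<longleftrightarrow> V (K + 1) A3" by (rule vge_add_iff)
        then show ?thesis using A3 vge_diff_commute[of "K + 1" y1 y2] by simp
      qed
      have "\<not> V 1 l"
      proof
        assume l: "V 1 l"
        have "V (K + 1) (l * (z1 - z2))" by (rule vge_mult_le[OF l vge_diff[OF zk]]) simp
        moreover have "V (K + 1) (y1 - y2 - l * (z1 - z2))" using vge_mono[OF line] K by simp
        ultimately show False using vge_diff_iff' n by blast
      qed
      then show ?thesis using eq False not_vge_third[OF z12] by simp
    qed
  qed
  have "component (K + 1) P \<in> {0, 1, 2}" for P by (auto simp: component_def split: option.splits)
  moreover have "\<exists>P \<in> Epts p B. component (K + 1) P = 0" by (rule bexI[of _ None]) (simp_all add: component_def)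
  moreover have "\<exists>P \<in> Epts p B. component (K + 1) P = 1" "\<exists>P \<in> Epts p B. component (K + 1) P = 2"
  proof -
    \<comment> \<open>The negative of the given singular point supplies the other nontrivial
      component.\<close>
    define y1 where "y1 n = - y0 n - A3" for n
    have y1: "pcauchy p y1" unfolding y1_def by (intro pcauchy_intros point)
    have "weq T (z0 n) (y1 n) = weq T (z0 n) (y0 n)" for n unfolding y1_def weq_tuple by Groebner_Basis.algebra
    then have F1: "pnull p (\<lambda>n. weq T (z0 n) (y1 n))" using point(3) by simp
    have "\<forall>\<^sub>F n in sequentially. V 1 (z0 n)" using point(4) by (simp add: pge_eventually)
    with pnullD[OF point(3), of 8] have ev: "\<forall>\<^sub>F n in sequentially. V (K + 1) (y0 n) \<longleftrightarrow> \<not> V (K + 1) (y1 n)"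
    proof eventually_elim
      case (elim n)
      have "V (K + 1) (y1 n) \<longleftrightarrow> V (K + 1) (y0 n + A3)"
        using vge_minus[of "K + 1" "y0 n + A3"] by (simp add: y1_def del: vge_minus)
      then show ?case
        using y[OF elim(2,1)] vge_add_iff[of "K + 1" "y0 n" A3] A3(2) by auto
    qed
    have "pge p y0 (K + 1) \<longleftrightarrow> \<not> pge p y1 (K + 1)"
    proof
      assume "pge p y0 (K + 1)"
      then have "\<forall>\<^sub>F n in sequentially. V (K + 1) (y0 n)" by (simp add: pge_eventually)
      with ev have "\<forall>\<^sub>F n in sequentially. \<not> V (K + 1) (y1 n)" by eventually_elim simp
      moreover have False if "\<forall>\<^sub>F n in sequentially. V (K + 1) (y1 n)" "\<forall>\<^sub>F n in sequentially. \<not> V (K + 1) (y1 n)"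
      proof -
        from that have "\<forall>\<^sub>F n in sequentially. False" by eventually_elim simp
        then show False by simp
      qed
      ultimately show "\<not> pge p y1 (K + 1)" unfolding pge_eventually by blast
    next
      assume "\<not> pge p y1 (K + 1)"
      from not_pge_eventually[OF y1 this] ev show "pge p y0 (K + 1)"
        unfolding pge_eventually by eventually_elim simp
    qed
    then show "\<exists>P \<in> Epts p B. component (K + 1) P = 1" "\<exists>P \<in> Epts p B. component (K + 1) P = 2"
      using point_on_B[OF point, of "K + 1"] point_on_B[OF point(1) y1 F1 point(4), of "K + 1"]
      by (auto split: if_splits)
  qed
  ultimately have "component (K + 1) ` Epts p B = {0, 1, 2}"
    by (intro image_eqI_ball) simp_all
  then show ?thesis using E by simp
qed

text \<open>In Tate's algorithm the quadratic Y^2 + (A3/p) Y - A6/p^2 over F_p must split: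
  \<open>V 3 A6\<close> places one root at 0 and \<open>\<not> V 2 A3\<close> keeps the other one
  away from it.\<close>

lemma E0_index_type_IV:
  assumes "\<not> V 2 A3" "V 2 A4" "V 3 A6"
    "pcauchy p z0" "pcauchy p y0" "pnull p (\<lambda>n. weq T (z0 n) (y0 n))" "pge p z0 1"
  shows "E0_index p B = 3"
proof (rule E0_index_3[of 1 z0 y0])
  show "V (1 + 1) y \<or> V (1 + 1) (y + A3)" if z: "V 1 z" and F: "V 8 (weq T z y)" for z y
  proof -
    have zz: "V 2 (z * z)" using vge_mult[OF z z] by simp
    have "y * (y + A3) = weq T z y + (z * (z * z) + (A2 * (z * z) + A4 * z + A6))"
      unfolding weq_tuple by Groebner_Basis.algebra
    moreover have "V 3 (weq T z y + (z * (z * z) + (A2 * (z * z) + A4 * z + A6)))"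
      by (intro vge_add vge_mono[OF F] vge_mult_le[OF z zz] vge_mult_le[OF A(1) zz]
          vge_mult_le[OF assms(2) z] assms) auto
    ultimately show ?thesis using not_vge_mult[of 1 y 1 "y + A3"] by auto
  qed
qed (simp_all add: assms A)

text \<open>The corresponding quadratic is Y^2 + (A3/p^2) Y - A6/p^4, again with one root at 0 and
  one away from it.\<close>

lemma E0_index_type_IV_star:
  assumes "V 2 A2" "V 2 A3" "\<not> V 3 A3" "V 3 A4" "V 5 A6"
    "pcauchy p z0" "pcauchy p y0" "pnull p (\<lambda>n. weq T (z0 n) (y0 n))" "pge p z0 1"
  shows "E0_index p B = 3"
proof (rule E0_index_3[of 2 z0 y0])
  fix z y assume h: "V 1 z" "V 8 (weq T z y)"
  show "V 2 z" using star_estimates(1)[OF h] assms by simp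
  show "V (2 + 1) y \<or> V (2 + 1) (y + A3)"
    using star_estimates(2)[OF h] assms not_vge_mult[of 2 y 2 "y + A3"] by auto
qed (simp_all add: assms A)

end

section \<open>Minimal models\<close>

lemma chg_chg:
  assumes "u \<noteq> 0" "v \<noteq> 0"
  shows "chg (chg A u r s t) v r' s' t' =
    chg A (u * v) (u^2 * r' + r) (u * s' + s) (u^3 * t' + s * u^2 * r' + t)"
proof -
  obtain a1 a2 a3 a4 a6 where A: "A = (a1, a2, a3, a4, a6)" by (metis prod.collapse)
  obtain b1 b2 b3 b4 b6 where B: "(b1, b2, b3, b4, b6) = chg A u r s t" by (metis prod.collapse)
  obtain c1 c2 c3 c4 c6 where C: "(c1, c2, c3, c4, c6) = chg (b1, b2, b3, b4, b6) v r' s' t'"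
    by (metis prod.collapse)
  note b = B[unfolded A, unfolded chg_iff[OF assms(1)]]
  note c = C[unfolded chg_iff[OF assms(2)]]
  have 1: "(u * v) * c1 = a1 + 2 * (u * s' + s)"
    using b c by Groebner_Basis.algebra
  have "(u * v)^2 * c2 = u^2 * b2 - (u * s') * (u * b1) + 3 * (u^2 * r') - (u * s')^2"
    using c by Groebner_Basis.algebra
  then have 2: "(u * v)^2 * c2 = a2 - (u * s' + s) * a1 + 3 * (u^2 * r' + r) - (u * s' + s)^2"
    using b by Groebner_Basis.algebra
  have "(u * v)^3 * c3 = u^3 * b3 + (u^2 * r') * (u * b1) + 2 * (u^3 * t')"
    using c by Groebner_Basis.algebra
  then have 3: "(u * v)^3 * c3 = a3 + (u^2 * r' + r) * a1 + 2 * (u^3 * t' + s * u^2 * r' + t)"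
    using b by Groebner_Basis.algebra
  have "(u * v)^4 * c4 = u^4 * b4 - (u * s') * (u^3 * b3) + 2 * (u^2 * r') * (u^2 * b2)
      - (u^3 * t' + (u^2 * r') * (u * s')) * (u * b1) + 3 * (u^2 * r')^2 - 2 * (u * s') * (u^3 * t')"
    using c by Groebner_Basis.algebra
  then have 4: "(u * v)^4 * c4 = a4 - (u * s' + s) * a3 + 2 * (u^2 * r' + r) * a2
      - ((u^3 * t' + s * u^2 * r' + t) + (u^2 * r' + r) * (u * s' + s)) * a1
      + 3 * (u^2 * r' + r)^2 - 2 * (u * s' + s) * (u^3 * t' + s * u^2 * r' + t)"
    using b by Groebner_Basis.algebra
  have "(u * v)^6 * c6 = u^6 * b6 + (u^2 * r') * (u^4 * b4) + (u^2 * r')^2 * (u^2 * b2) + (u^2 * r')^3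
      - (u^3 * t') * (u^3 * b3) - (u^3 * t')^2 - (u^2 * r') * (u^3 * t') * (u * b1)"
    using c by Groebner_Basis.algebra
  then have 6: "(u * v)^6 * c6 = a6 + (u^2 * r' + r) * a4 + (u^2 * r' + r)^2 * a2 + (u^2 * r' + r)^3
      - (u^3 * t' + s * u^2 * r' + t) * a3 - (u^3 * t' + s * u^2 * r' + t)^2
      - (u^2 * r' + r) * (u^3 * t' + s * u^2 * r' + t) * a1"
    using b by Groebner_Basis.algebra
  have "u * v \<noteq> 0" using assms by simp
  then have "(c1, c2, c3, c4, c6) = chg A (u * v) (u^2 * r' + r) (u * s' + s) (u^3 * t' + s * u^2 * r' + t)"
    unfolding A using 1 2 3 4 6 by (subst chg_iff) (assumption, intro conjI)
  then show ?thesis using B C by simp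
qed

lemma chg_1_0 [simp]: "chg A 1 0 0 0 = A"
  by (cases A) (simp add: chg_def)

lemma is_model_chg:
  assumes "u \<noteq> 0"
  shows "is_model (chg A u r s t) C \<longleftrightarrow> is_model A C"
proof
  assume "is_model (chg A u r s t) C"
  then obtain v r' s' t' where v: "v \<noteq> 0" "C = chg (chg A u r s t) v r' s' t'" by (auto simp: is_model_def)
  moreover have "u * v \<noteq> 0" using assms v by simp
  ultimately show "is_model A C" unfolding is_model_def using chg_chg[OF assms v(1)] by metis
next
  assume "is_model A C"
  then obtain v r' s' t' where v: "v \<noteq> 0" "C = chg A v r' s' t'" by (auto simp: is_model_def)
  have "u^3 * ((t' - t - s * (r' - r)) / u^3) + s * u^2 * ((r' - r) / u^2) + t = t'"
    "u^2 * ((r' - r) / u^2) + r = r'" "u * ((s' - s) / u) + s = s'" "u * (v / u) = v" "v / u \<noteq> 0"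
    using assms v(1) by simp_all
  then have "C = chg (chg A u r s t) (v / u) ((r' - r) / u^2) ((s' - s) / u) ((t' - t - s * (r' - r)) / u^3)"
    using chg_chg[OF assms, of "v / u" A r s t] v(2) by simp
  then show "is_model (chg A u r s t) C" unfolding is_model_def using \<open>v / u \<noteq> 0\<close> by blast
qed

lemma disc_tuple:
  "disc (a1, a2, a3, a4, a6) =
    -((a1^2 + 4 * a2)^2 * (a1^2 * a6 + 4 * a2 * a6 - a1 * a3 * a4 + a2 * a3^2 - a4^2))
    - 8 * (2 * a4 + a1 * a3)^3 - 27 * (a3^2 + 4 * a6)^2
    + 9 * (a1^2 + 4 * a2) * (2 * a4 + a1 * a3) * (a3^2 + 4 * a6)"
  by (simp add: disc_def Let_def)

text \<open>The invariants \<open>b\<^sub>2, b\<^sub>4, b\<^sub>6, b\<^sub>8\<close> of Silverman, III.1.\<close>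

lemma chg_b_invariants:
  assumes "u \<noteq> 0" "(b1, b2, b3, b4, b6) = chg (a1, a2, a3, a4, a6) u r s t"
  shows "u^2 * (b1^2 + 4 * b2) = (a1^2 + 4 * a2) + 12 * r"
    "u^4 * (2 * b4 + b1 * b3) = (2 * a4 + a1 * a3) + r * (a1^2 + 4 * a2) + 6 * r^2"
    "u^6 * (b3^2 + 4 * b6) = (a3^2 + 4 * a6) + 2 * r * (2 * a4 + a1 * a3) + r^2 * (a1^2 + 4 * a2) + 4 * r^3"
    "u^8 * (b1^2 * b6 + 4 * b2 * b6 - b1 * b3 * b4 + b2 * b3^2 - b4^2) =
      (a1^2 * a6 + 4 * a2 * a6 - a1 * a3 * a4 + a2 * a3^2 - a4^2) + 3 * r * (a3^2 + 4 * a6)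
      + 3 * r^2 * (2 * a4 + a1 * a3) + r^3 * (a1^2 + 4 * a2) + 3 * r^4"
proof -
  note b = assms(2)[unfolded chg_iff[OF assms(1)]]
  have "u^2 * (b1^2 + 4 * b2) = (u * b1)^2 + 4 * (u^2 * b2)" by Groebner_Basis.algebra
  then show "u^2 * (b1^2 + 4 * b2) = (a1^2 + 4 * a2) + 12 * r" using b by Groebner_Basis.algebra
  have "u^4 * (2 * b4 + b1 * b3) = 2 * (u^4 * b4) + (u * b1) * (u^3 * b3)" by Groebner_Basis.algebra
  then show "u^4 * (2 * b4 + b1 * b3) = (2 * a4 + a1 * a3) + r * (a1^2 + 4 * a2) + 6 * r^2" using b by Groebner_Basis.algebra
  have "u^6 * (b3^2 + 4 * b6) = (u^3 * b3)^2 + 4 * (u^6 * b6)" by Groebner_Basis.algebra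
  then show "u^6 * (b3^2 + 4 * b6) = (a3^2 + 4 * a6) + 2 * r * (2 * a4 + a1 * a3)
      + r^2 * (a1^2 + 4 * a2) + 4 * r^3" using b by Groebner_Basis.algebra
  have "u^8 * (b1^2 * b6 + 4 * b2 * b6 - b1 * b3 * b4 + b2 * b3^2 - b4^2) =
    (u * b1)^2 * (u^6 * b6) + 4 * (u^2 * b2) * (u^6 * b6) - (u * b1) * (u^3 * b3) * (u^4 * b4)
    + (u^2 * b2) * (u^3 * b3)^2 - (u^4 * b4)^2" by Groebner_Basis.algebra
  then show "u^8 * (b1^2 * b6 + 4 * b2 * b6 - b1 * b3 * b4 + b2 * b3^2 - b4^2) =
      (a1^2 * a6 + 4 * a2 * a6 - a1 * a3 * a4 + a2 * a3^2 - a4^2) + 3 * r * (a3^2 + 4 * a6)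
      + 3 * r^2 * (2 * a4 + a1 * a3) + r^3 * (a1^2 + 4 * a2) + 3 * r^4"
    using b by Groebner_Basis.algebra
qed

lemma disc_chg:
  assumes "u \<noteq> 0"
  shows "u^12 * disc (chg A u r s t) = disc A"
proof -
  obtain a1 a2 a3 a4 a6 where A: "A = (a1, a2, a3, a4, a6)" by (metis prod.collapse)
  obtain b1 b2 b3 b4 b6 where B: "(b1, b2, b3, b4, b6) = chg A u r s t" by (metis prod.collapse)
  note inv = chg_b_invariants[OF assms B[unfolded A]]
  define B2 B4 B6 B8 where "B2 = a1^2 + 4 * a2" and "B4 = 2 * a4 + a1 * a3" and "B6 = a3^2 + 4 * a6"
    and "B8 = a1^2 * a6 + 4 * a2 * a6 - a1 * a3 * a4 + a2 * a3^2 - a4^2"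
  \<comment> \<open>The discriminant is translation invariant only modulo this relation between the
    b-invariants.\<close>
  have rel: "4 * B8 = B2 * B6 - B4^2"
    unfolding B2_def B4_def B6_def B8_def by Groebner_Basis.algebra
  have "u^12 * disc (b1, b2, b3, b4, b6) =
     -((u^2 * (b1^2 + 4 * b2))^2 * (u^8 * (b1^2 * b6 + 4 * b2 * b6 - b1 * b3 * b4 + b2 * b3^2 - b4^2)))
    - 8 * (u^4 * (2 * b4 + b1 * b3))^3 - 27 * (u^6 * (b3^2 + 4 * b6))^2
    + 9 * (u^2 * (b1^2 + 4 * b2)) * (u^4 * (2 * b4 + b1 * b3)) * (u^6 * (b3^2 + 4 * b6))"
    unfolding disc_tuple by Groebner_Basis.algebra
  also have "\<dots> = - ((B2 + 12 * r)^2 * (B8 + 3 * r * B6 + 3 * r^2 * B4 + r^3 * B2 + 3 * r^4))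
    - 8 * (B4 + r * B2 + 6 * r^2)^3 - 27 * (B6 + 2 * r * B4 + r^2 * B2 + 4 * r^3)^2
    + 9 * (B2 + 12 * r) * (B4 + r * B2 + 6 * r^2) * (B6 + 2 * r * B4 + r^2 * B2 + 4 * r^3)"
    unfolding inv B2_def B4_def B6_def B8_def ..
  also have "\<dots> = - (B2^2 * B8) - 8 * B4^3 - 27 * B6^2 + 9 * B2 * B4 * B6"
    using rel by Groebner_Basis.algebra
  also have "\<dots> = disc A" unfolding A disc_tuple B2_def B4_def B6_def B8_def ..
  finally show ?thesis unfolding B .
qed

context padic
begin

lemma p_integral_iff: "p_integral p q \<longleftrightarrow> V 0 q"
  by (simp add: p_integral_def vge_def)

lemma integral_model_tuple: "integral_model p (a1, a2, a3, a4, a6) \<longleftrightarrow> V 0 a1 \<and> V 0 a2 \<and> V 0 a3 \<and> V 0 a4 \<and> V 0 a6"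
  by (simp add: integral_model_def p_integral_iff)

lemma integral_disc:
  assumes "integral_model p C"
  shows "V 0 (disc C)"
proof -
  obtain a1 a2 a3 a4 a6 where C: "C = (a1, a2, a3, a4, a6)" by (metis prod.collapse)
  then show ?thesis
    using assms unfolding C integral_model_tuple disc_tuple
    by (intro vge_add vge_diff vge_minus[THEN iffD2] vge_mult_0 vge_power_0) auto
qed

lemma rat_val_disc_chg:
  assumes "u \<noteq> 0" "disc A \<noteq> 0"
  shows "rat_val p (disc (chg A u r s t)) = rat_val p (disc A) - 12 * rat_val p u"
proof -
  have d: "u^12 * disc (chg A u r s t) = disc A" by (rule disc_chg[OF assms(1)])
  then have "disc (chg A u r s t) \<noteq> 0" using assms by auto
  then show ?thesis using rat_val_mult[of "u^12" "disc (chg A u r s t)"] rat_val_power[of u 12] assms d by simp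
qed

text \<open>The discriminant is divided by u^12, so only a change with v(u) > 0 could improve the
  model.\<close>

lemma p_minimalI:
  assumes T: "T = chg A u0 r0 s0 t0" "u0 \<noteq> 0" "integral_model p T" and d: "disc A \<noteq> 0"
    and H: "\<And>u r s t. u \<noteq> 0 \<Longrightarrow> integral_model p (chg T u r s t) \<Longrightarrow> \<not> V 1 u"
  shows "p_minimal p A T"
  unfolding p_minimal_def
proof (intro conjI allI impI)
  show "is_model A T" using T is_model_def by blast
  fix C assume C: "is_model A C \<and> integral_model p C"
  then have "is_model T C" using is_model_chg[OF T(2)] T(1) by simp
  then obtain u r s t where u: "u \<noteq> 0" "C = chg T u r s t" by (auto simp: is_model_def)
  have "disc T \<noteq> 0" using disc_chg[OF T(2), of A r0 s0 t0] d T by auto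
  moreover have "rat_val p u \<le> 0" using H[OF u(1), of r s t] C u by (auto simp: vge_def)
  ultimately show "rat_val p (disc T) \<le> rat_val p (disc C)"
    using rat_val_disc_chg[OF u(1), of T r s t] u(2) by simp
qed (use T in simp)

lemma p_minimal_if_disc_lt_12:
  assumes T: "T = chg A u0 r0 s0 t0" "u0 \<noteq> 0" "integral_model p T" and d: "disc A \<noteq> 0"
    and "\<not> V 12 (disc T)"
  shows "p_minimal p A T"
proof (rule p_minimalI[OF T d])
  fix u r s t :: rat assume u: "u \<noteq> 0" "integral_model p (chg T u r s t)"
  show "\<not> V 1 u"
  proof
    assume "V 1 u"
    then have "V 12 (u^12)" using vge_power[of 1 u 12] by simp
    then have "V 12 (u^12 * disc (chg T u r s t))" using vge_mult_0'[OF integral_disc[OF u(2)]] by simp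
    then show False using assms(5) disc_chg[OF u(1), of T] by simp
  qed
qed

lemma p_minimal_disc_eq: "p_minimal p A B \<Longrightarrow> p_minimal p A C \<Longrightarrow> rat_val p (disc B) = rat_val p (disc C)"
  unfolding p_minimal_def by (meson antisym)

lemma min_model_minimal: "p_minimal p A T \<Longrightarrow> p_minimal p A (min_model p A)"
  unfolding min_model_def by (rule someI)

lemma bad_reduction_iff:
  assumes "p_minimal p A T"
  shows "bad_reduction p A \<longleftrightarrow> rat_val p (disc T) > 0"
  unfolding bad_reduction_def using p_minimal_disc_eq[OF min_model_minimal[OF assms] assms] by simp

text \<open>Each parameter is a root of a polynomial with integral coefficients. For
  \<open>r\<close> this is the transformation of b6, with leading term 4 r^3, or for p = 2 that of
  b8, with leading term 3 r^4; \<open>s\<close> and \<open>t\<close> satisfy monic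
  quadratics.\<close>

lemma integral_change:
  assumes A: "V 0 A2" "V 0 A3" "V 0 A4" "V 0 A6"
    and u: "V 0 u" "u \<noteq> 0" and int: "integral_model p (chg (0, A2, A3, A4, A6) u r s t)"
  shows "V 0 r" "V 0 s" "V 0 t"
proof -
  obtain b1 b2 b3 b4 b6 where B: "(b1, b2, b3, b4, b6) = chg (0, A2, A3, A4, A6) u r s t" by (metis prod.collapse)
  have b: "V 0 b1" "V 0 b2" "V 0 b3" "V 0 b4" "V 0 b6"
    using int[unfolded B[symmetric] integral_model_tuple] by auto
  note inv = chg_b_invariants[OF u(2) B] and c = B[unfolded chg_iff[OF u(2)]]
  show r: "V 0 r"
  proof (rule ccontr)
    assume r: "\<not> V 0 r"
    define e where "e = rat_val p r"
    have e: "e < 0" "V e r" "\<not> V (e + 1) r" using r by (auto simp: e_def vge_def)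
    have r2: "V (2 * e) (r^2)" "V (3 * e) (r^3)" using vge_power[OF e(2), of 2] vge_power[OF e(2), of 3] by simp_all
    have n2: "\<not> V (2 * e + 1) (r^2)" using not_vge_mult[OF e(3) e(3)] by (simp add: power2_eq_square)
    have n3: "\<not> V (3 * e + 1) (r^3)" using not_vge_mult[OF e(3) n2] by (simp add: power3_eq_cube power2_eq_square mult.assoc)
    have n4: "\<not> V (4 * e + 1) (r^4)" using not_vge_mult[OF n2 n2] by (simp add: power2_eq_square power4_eq_xxxx mult.assoc)
    show False
    proof (cases "p = 2")
      case False
      have eq: "4 * r^3 = (u^6 * (b3^2 + 4 * b6) - (A3^2 + 4 * A6)) - 2 * (2 * A4) * r - 4 * A2 * r^2"
        using inv(3) unfolding mult_zero_left mult_zero_right power_zero_numeral add_0_left add_0_right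
        by Groebner_Basis.algebra
      have h: "V 0 (u^6 * (b3^2 + 4 * b6) - (A3^2 + 4 * A6))"
        by (intro vge_diff vge_add vge_mult_0 vge_power_0 u b A vge_numeral)
      have h': "V e (2 * (2 * A4) * r)" "V (2 * e) (4 * A2 * r^2)"
        by (intro vge_mult_0 vge_numeral A e r2)+
      have "V (0 + (2 * e)) (4 * r^3)" unfolding eq
        by (rule vge_diff[OF vge_diff[OF vge_mono[OF h] vge_mono[OF h'(1)]]]) (use e(1) h'(2) in simp_all)
      moreover have "\<not> V 1 4" using not_vge_mult[of 0 2 0 2] not_vge_2[OF False] by simp
      ultimately have "V (2 * e) (r^3)" using vge_cancel[of 0 "2 * e" 4 "r^3"] by simp
      then show False using vge_mono[of "2 * e" "r^3" "3 * e + 1"] n3 e by simp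
    next
      case True
      have eq: "3 * r^4 = (u^8 * (b1^2 * b6 + 4 * b2 * b6 - b1 * b3 * b4 + b2 * b3^2 - b4^2)
          - (4 * A2 * A6 + A2 * A3^2 - A4^2)) - 3 * (A3^2 + 4 * A6) * r - 3 * (2 * A4) * r^2 - 4 * A2 * r^3"
        using inv(4) unfolding mult_zero_left mult_zero_right power_zero_numeral add_0_left add_0_right
        by Groebner_Basis.algebra
      have h: "V 0 (u^8 * (b1^2 * b6 + 4 * b2 * b6 - b1 * b3 * b4 + b2 * b3^2 - b4^2)
          - (4 * A2 * A6 + A2 * A3^2 - A4^2))"
        by (intro vge_diff vge_add vge_mult_0 vge_power_0 u b A vge_numeral)
      have h': "V e (3 * (A3^2 + 4 * A6) * r)" "V (2 * e) (3 * (2 * A4) * r^2)" "V (3 * e) (4 * A2 * r^3)"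
        by (intro vge_mult_0 vge_add vge_power_0 vge_numeral A e r2)+
      have "V (0 + (3 * e)) (3 * r^4)" unfolding eq
        by (rule vge_diff[OF vge_diff[OF vge_diff[OF vge_mono[OF h] vge_mono[OF h'(1)]] vge_mono[OF h'(2)]]])
          (use e(1) h'(3) in simp_all)
      moreover have "\<not> V 1 3" by (rule not_vge_3[OF True])
      ultimately have "V (3 * e) (r^4)" using vge_cancel[of 0 "3 * e" 3 "r^4"] by simp
      then show False using vge_mono[of "3 * e" "r^4" "4 * e + 1"] n4 e by simp
    qed
  qed
  have "s^2 = A2 + 3 * r - u^2 * b2" using c by Groebner_Basis.algebra
  moreover have "V 0 \<dots>" by (intro vge_diff vge_add vge_mult_0 vge_power_0 A r b u vge_numeral)
  ultimately show "V 0 s" using vge_power_cancel[of 2 0 s] by simp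
  have t: "t * (t + A3) = A6 + r * A4 + r^2 * A2 + r^3 - u^6 * b6" using c by Groebner_Basis.algebra
  have "V 0 (t * (t + A3))" unfolding t by (intro vge_diff vge_add vge_mult_0 vge_power_0 A r b u)
  then show "V 0 t"
    using not_vge_mult[of "-1" t "-1" "t + A3"] vge_add_iff'[OF A(2), of t] vge_mono[of 0 "t * (t + A3)" "-1"]
    by auto
qed

text \<open>Two minimal models have discriminants of equal valuation, so \<open>u\<close> is a unit,
  and integrality of both models makes the other parameters integral. This controls the unspecified
  \<open>min_model\<close>.\<close>

lemma minimal_model_tate_form:
  assumes T: "p_minimal p A (0, A2, A3, A4, A6)" and d: "disc A \<noteq> 0"
    and A: "V 1 A2" "V 1 A3" "V 1 A4" "V 1 A6"
  obtains u r s t where "tate_form p A2 A3 A4 A6 u r s t" "min_model p A = chg (0, A2, A3, A4, A6) u r s t"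
proof -
  let ?T = "(0, A2, A3, A4, A6)"
  note M = min_model_minimal[OF T]
  obtain u0 r0 s0 t0 where T0: "u0 \<noteq> 0" "?T = chg A u0 r0 s0 t0"
    using T by (auto simp: p_minimal_def is_model_def)
  have "is_model ?T (min_model p A)"
    unfolding T0(2) is_model_chg[OF T0(1)] using M by (simp add: p_minimal_def)
  then obtain u r s t where u: "u \<noteq> 0" "min_model p A = chg ?T u r s t" by (auto simp: is_model_def)
  have "disc ?T \<noteq> 0" using disc_chg[OF T0(1), of A r0 s0 t0] d T0 by auto
  then have "rat_val p u = 0"
    using rat_val_disc_chg[OF u(1), of ?T r s t] p_minimal_disc_eq[OF M T] u(2) by simp
  then have v: "V 0 u" "\<not> V 1 u" using u(1) by (auto simp: vge_def)
  have "integral_model p (chg ?T u r s t)" using M u(2) by (simp add: p_minimal_def)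
  then have "V 0 r" "V 0 s" "V 0 t"
    using integral_change[OF A[THEN vge_mono] v(1) u(1)] by simp_all
  then have "tate_form p A2 A3 A4 A6 u r s t"
    using A v by unfold_locales simp_all
  then show ?thesis using that u(2) by blast
qed

end

section \<open>Cube roots and cube roots of unity\<close>

lemma prime_dvd_3_int:
  assumes "prime p" "int p dvd 3"
  shows "p = 3"
proof -
  have "p dvd 3" using assms(2) by (metis int_dvd_int_iff of_nat_numeral)
  then have "p \<le> 3" by (rule dvd_imp_le) simp
  moreover have "p \<ge> 2" using prime_ge_2_nat[OF assms(1)] .
  moreover have "p \<noteq> 2" using \<open>p dvd 3\<close> by auto
  ultimately show ?thesis by simp
qed

text \<open>For a primitive root g, the power g^((p - 1)/3) has order 3, so it is a root of x^3 - 1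
  but not of x - 1.\<close>

lemma root_of_unity_order_3:
  fixes p :: nat
  assumes "prime p" "p mod 3 = 1"
  obtains w :: int where "int p dvd w^2 + w + 1"
proof -
  have p1: "p > 1" using prime_gt_1_nat[OF assms(1)] .
  obtain g where g: "residue_primroot p g" using prime_primitive_root_exists[OF p1 assms(1)] by blast
  then have co: "coprime p g" and o: "ord p g = p - 1"
    using assms(1) by (auto simp: residue_primroot_def totient_prime)
  define k where "k = (p - 1) div 3"
  have k: "p - 1 = 3 * k" using assms(2) p1 by (simp add: k_def) presburger
  define x where "x = int (g ^ k)"
  have "[g ^ (3 * k) = 1] (mod p)" using ord_divides[of g "3 * k" p] o k by simp
  then have "[int (g ^ (3 * k)) = int 1] (mod int p)" by (simp only: cong_int_iff)
  moreover have "int (g ^ (3 * k)) = x ^ 3" by (simp add: x_def power_mult mult.commute flip: power_mult)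
  ultimately have "int p dvd x ^ 3 - 1" by (simp add: cong_iff_dvd_diff)
  moreover have "x ^ 3 - 1 = (x - 1) * (x^2 + x + 1)" by (simp add: power2_eq_square power3_eq_cube algebra_simps)
  moreover have "\<not> int p dvd x - 1"
  proof
    assume "int p dvd x - 1"
    then have "[int (g ^ k) = int 1] (mod int p)" by (simp add: cong_iff_dvd_diff x_def)
    then have "[g ^ k = 1] (mod p)" by (simp only: cong_int_iff)
    then have "p - 1 dvd k" using ord_divides[of g k p] o by simp
    then show False using k p1 by (auto dest!: dvd_imp_le)
  qed
  ultimately show ?thesis using that[of x] assms(1) by (simp add: prime_dvd_mult_iff)
qed

text \<open>With p - 1 = 3 k + 1, Fermat gives w^(3k) w = 1 = c^(3k) c, and the factors w^(3k) and
  c^(3k) agree when the cubes do.\<close>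

lemma cong_if_cubes_cong:
  fixes p :: nat and w c :: int
  assumes "prime p" "p mod 3 = 2" and cube: "int p dvd w^3 - c^3"
  shows "int p dvd w - c"
proof -
  have pp: "prime (int p)" using assms by simp
  show ?thesis
  proof (cases "int p dvd c")
    case True
    then have "int p dvd c^3" by (simp add: power3_eq_cube)
    then have "int p dvd w^3" using cube by (metis dvd_diff_commute dvd_diff_left_iff)
    then have "int p dvd w" using pp prime_dvd_power by blast
    then show ?thesis using True by (rule dvd_diff)
  next
    case False
    have "\<not> int p dvd w"
    proof
      assume "int p dvd w"
      then have "int p dvd w^3" by (simp add: power3_eq_cube)
      then have "int p dvd c^3" using cube by (metis dvd_diff_right_iff)
      then show False using False pp prime_dvd_power by blast
    qed
    have p2: "p \<ge> 2" using prime_ge_2_nat[OF assms(1)] .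
    define k where "k = (p - 2) div 3"
    have k: "p - 1 = 3 * k + 1" using assms(2) p2 by (simp add: k_def) presburger
    have f: "[x ^ (p - 1) = 1] (mod int p)" if "\<not> int p dvd x" for x :: int
    proof -
      define b where "b = nat (x mod int p)"
      have b: "[x = int b] (mod int p)"
        using p2 by (simp add: b_def cong_def)
      have "\<not> p dvd b" using that cong_dvd_iff[OF b] int_dvd_int_iff[of p b] by simp
      then have "[b ^ (p - 1) = 1] (mod p)" by (rule fermat_theorem[OF assms(1)])
      then have "[int (b ^ (p - 1)) = int 1] (mod int p)" by (simp only: cong_int_iff)
      then show ?thesis using cong_pow[OF b, of "p - 1"] by (simp add: cong_def)
    qed
    have "[(w^3)^k = (c^3)^k] (mod int p)" using cube by (intro cong_pow[of "w^3"]) (simp add: cong_iff_dvd_diff)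
    then have e: "[w ^ (3 * k) = c ^ (3 * k)] (mod int p)" by (simp add: power_mult)
    have "[w ^ (3 * k) * w = c ^ (3 * k) * c] (mod int p)"
      using cong_trans[OF f[OF \<open>\<not> int p dvd w\<close>] cong_sym[OF f[OF False]]] unfolding k by (simp add: mult.commute)
    moreover have "[w ^ (3 * k) * w = c ^ (3 * k) * w] (mod int p)" by (rule cong_scalar_right[OF e])
    ultimately have "[c ^ (3 * k) * w = c ^ (3 * k) * c] (mod int p)" using cong_sym cong_trans by blast
    moreover have "coprime (c ^ (3 * k)) (int p)"
      using False pp prime_imp_coprime coprime_commute coprime_power_left_iff by blast
    ultimately have "[w = c] (mod int p)" using cong_mult_lcancel by blast
    then show ?thesis by (simp add: cong_iff_dvd_diff)
  qed
qed

text \<open>The form has discriminant -27 and is the cofactor of m - 4 n in (m - n)^3 - (3 n)^3.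
  Injectivity of cubing gives m = 4 n, and then 27 n^2 = 0 mod p. The prime 2 is included.\<close>

lemma quadratic_form_nonsplit:
  fixes p :: nat and m n :: int
  assumes p: "prime p" "p mod 3 = 2" and d: "int p dvd m^2 + m * n + 7 * n^2"
  shows "int p dvd n" "int p dvd m"
proof -
  have pp: "prime (int p)" using p by simp
  have "(m - n)^3 - (3 * n)^3 = (m - n - 3 * n) * (m^2 + m * n + 7 * n^2)"
    by (simp add: power2_eq_square power3_eq_cube algebra_simps)
  then have "int p dvd (m - n)^3 - (3 * n)^3" using d by simp
  then have "int p dvd (m - n) - 3 * n" using cong_if_cubes_cong[OF p] by blast
  then have 4: "int p dvd m - 4 * n" by (simp add: algebra_simps)
  have "m^2 + m * n + 7 * n^2 = (m - 4 * n) * (m + 5 * n) + 27 * n^2"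
    by (simp add: power2_eq_square algebra_simps)
  then have "int p dvd 27 * n^2" using d 4 by (metis dvd_add_right_iff dvd_mult2)
  moreover have "\<not> int p dvd 3" using prime_dvd_3_int[OF p(1)] p(2) by auto
  moreover have "(27::int) = 3 * (3 * 3)" by simp
  ultimately show n: "int p dvd n" using pp by (metis prime_dvd_mult_iff prime_dvd_power)
  then show "int p dvd m" using 4 by (metis dvd_add_right_iff dvd_mult diff_add_cancel dvd_diff_commute add.commute)
qed

text \<open>The derivative 3 x^2 is not a unit, so lifting starts modulo 9 at 1 or -1. If x^3 - c =
  9 q k, replacing x by x - 3 q k leaves 9 q k (1 - x^2) plus terms divisible by 27 q, and 3 divides
  1 - x^2.\<close>

lemma cube_root_3_adic:
  fixes c :: int
  assumes "c mod 9 = 1 \<or> c mod 9 = 8"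
  shows "\<exists>x. 3 dvd x - c \<and> 3 ^ n dvd x^3 - c"
proof -
  have start: "\<exists>x. 3 dvd x - c \<and> 3 ^ (m + 2) dvd x^3 - c" for m
  proof (induction m)
    case 0
    have "9 dvd 1 - c \<or> 9 dvd (-1) - c" using assms by presburger
    then show ?case
    proof
      assume "9 dvd 1 - c"
      then show ?thesis by (intro exI[of _ 1]) (auto elim: dvd_trans[rotated])
    next
      assume "9 dvd (-1) - c"
      then show ?thesis by (intro exI[of _ "-1"]) (auto elim: dvd_trans[rotated])
    qed
  next
    case (Suc m)
    then obtain x where x1: "3 dvd x - c" and "3 ^ (m + 2) dvd x^3 - c" by blast
    then obtain k where "x^3 - c = 3 ^ (m + 2) * k" by (elim dvdE)
    note x = x1 this
    define q :: int where "q = 3 ^ m"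
    have "\<not> 3 dvd x" using x(1) assms by presburger
    then have "3 dvd 1 - x^2"
    proof -
      have "3 dvd x - 1 \<or> 3 dvd x + 1" using \<open>\<not> 3 dvd x\<close> by presburger
      then have "3 dvd - ((x - 1) * (x + 1))" by auto
      then show ?thesis by (simp add: power2_eq_square algebra_simps)
    qed
    then obtain j where j: "1 - x^2 = 3 * j" by (auto elim: dvdE)
    have xk: "x^3 - c = 9 * q * k" using x(2) by (simp add: q_def power_add)
    have "(x - 3 * q * k)^3 - c = (x^3 - c) - 9 * q * k * x^2 + 27 * q * (q * k^2 * x - q^2 * k^3)"
      by (simp add: power2_eq_square power3_eq_cube algebra_simps)
    also have "\<dots> = 9 * q * k * (1 - x^2) + 27 * q * (q * k^2 * x - q^2 * k^3)"
      unfolding xk by (simp add: algebra_simps)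
    also have "\<dots> = 27 * q * (k * j + q * k^2 * x - q^2 * k^3)"
      unfolding j by (simp add: algebra_simps)
    also have "27 * q = 3 ^ (Suc m + 2)" by (simp add: q_def power_add)
    finally have "3 ^ (Suc m + 2) dvd (x - 3 * q * k)^3 - c" by (metis dvd_triv_left)
    moreover have "3 dvd (x - 3 * q * k) - c"
    proof -
      have "(x - 3 * q * k) - c = (x - c) - 3 * (q * k)" by simp
      then show ?thesis using x(1) by (metis dvd_diff dvd_triv_left)
    qed
    ultimately show ?case by blast
  qed
  then obtain x where "3 dvd x - c" "3 ^ (n + 2) dvd x^3 - c" by blast
  moreover have "(3::int) ^ n dvd 3 ^ (n + 2)" by (simp add: power_add)
  ultimately show ?thesis using dvd_trans by blast
qed

text \<open>Newton lifting at a simple root: (2 x + 1)^2 = 4 (x^2 + x + 1) - 3, so the derivative 2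
  x + 1 is a unit for p different from 3.\<close>

lemma omega_p_adic:
  fixes p :: nat and w :: int
  assumes p: "prime p" "p \<noteq> 3" and w: "int p dvd w^2 + w + 1"
  shows "\<exists>x. int p dvd x - w \<and> int p ^ n dvd x^2 + x + 1"
proof -
  have pp: "prime (int p)" using p by simp
  have "\<exists>x. int p dvd x - w \<and> int p ^ Suc m dvd x^2 + x + 1" for m
  proof (induction m)
    case 0
    show ?case using w by (intro exI[of _ w]) simp
  next
    case (Suc m)
    then obtain x where x1: "int p dvd x - w" and "int p ^ Suc m dvd x^2 + x + 1" by blast
    then obtain k where "x^2 + x + 1 = int p ^ Suc m * k" by (elim dvdE)
    note x = x1 this
    have "\<not> int p dvd 2 * x + 1"
    proof
      assume "int p dvd 2 * x + 1"
      moreover have "int p dvd x^2 + x + 1" using x(2) by simp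
      moreover have "3 = 4 * (x^2 + x + 1) - (2 * x + 1) * (2 * x + 1)"
        by (simp add: power2_eq_square algebra_simps)
      ultimately have "int p dvd 3" by (metis dvd_diff dvd_mult)
      then show False using p prime_dvd_3_int by blast
    qed
    then have "coprime (2 * x + 1) (int p)" using pp prime_imp_coprime coprime_commute by blast
    then obtain e f where ef: "e * (2 * x + 1) + f * int p = 1"
      using bezout_int[of "2 * x + 1" "int p"] by (auto simp: coprime_iff_gcd_eq_1)
    define q :: int where "q = int p ^ m"
    have xk: "x^2 + x + 1 = int p * q * k" using x(2) by (simp add: q_def)
    define y where "y = x - int p * q * (k * e)"
    have "y^2 + y + 1 = (x^2 + x + 1) - int p * q * k * (e * (2 * x + 1)) + int p * q * (int p * q) * (k * e)^2"
      unfolding y_def by (simp add: power2_eq_square algebra_simps)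
    also have "\<dots> = int p * q * k * (1 - e * (2 * x + 1)) + int p * q * (int p * q) * (k * e)^2"
      unfolding xk by (simp add: algebra_simps)
    also have "1 - e * (2 * x + 1) = f * int p" using ef by simp
    also have "int p * q * k * (f * int p) + int p * q * (int p * q) * (k * e)^2
        = (int p * (int p * q)) * (k * f + q * (k * e)^2)" by (simp add: algebra_simps)
    also have "int p * (int p * q) = int p ^ Suc (Suc m)" by (simp add: q_def)
    finally have "int p ^ Suc (Suc m) dvd y^2 + y + 1" by (metis dvd_triv_left)
    moreover have "int p dvd y - w"
    proof -
      have "y - w = (x - w) - int p * (q * (k * e))" by (simp add: y_def)
      then show ?thesis using x(1) by (metis dvd_diff dvd_triv_left)
    qed
    ultimately show ?case by blast
  qed
  then obtain x where "int p dvd x - w" "int p ^ Suc n dvd x^2 + x + 1" by blast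
  moreover have "int p ^ n dvd int p ^ Suc n" by simp
  ultimately show ?thesis using dvd_trans by blast
qed

context padic
begin

lemma pnull_of_int:
  assumes "\<And>n. int p ^ n dvd f n"
  shows "pnull p (\<lambda>n. of_int (f n))"
proof (rule pnullI)
  fix k
  have "V k (of_int (f n))" if "n \<ge> nat k" for n
    using vge_of_int_iff[of n "f n"] assms[of n] vge_mono[of "int n" _ k] that by simp
  then show "\<forall>\<^sub>F n in sequentially. V k (of_int (f n))" by (auto simp: eventually_sequentially)
qed

text \<open>The approximate roots are chosen independently for each precision. \<open>R\<close>
  singles out one residue class, and \<open>lift\<close> makes the choices Cauchy, with
  \<open>d\<close> the number of powers of p lost between values and arguments.\<close>

lemma pcauchy_root:
  fixes f :: "int \<Rightarrow> int"
  assumes ex: "\<And>n. \<exists>x. R x \<and> int p ^ n dvd f x"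
    and lift: "\<And>x y n. R x \<Longrightarrow> R y \<Longrightarrow> int p ^ (n + d) dvd f x - f y \<Longrightarrow> int p ^ n dvd x - y"
  obtains w where "\<And>n. R (w n)" "pcauchy p (\<lambda>n. of_int (w n))" "pnull p (\<lambda>n. of_int (f (w n)))"
proof -
  obtain w where w: "\<And>n. R (w n)" "\<And>n. int p ^ n dvd f (w n)" using ex by metis
  have "pcauchy p (\<lambda>n. of_int (w n))"
    unfolding pcauchy_vge
  proof
    fix k
    have "V k (of_int (w m) - of_int (w n))" if "m \<ge> nat k + d" "n \<ge> nat k + d" for m n
    proof -
      have "int p ^ (nat k + d) dvd f (w m)" "int p ^ (nat k + d) dvd f (w n)"
        using w(2) that by (meson dvd_trans le_imp_power_dvd)+
      then have "int p ^ (nat k + d) dvd f (w m) - f (w n)" by (rule dvd_diff)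
      then have "int p ^ nat k dvd w m - w n" by (rule lift[OF w(1) w(1)])
      then have "V (int (nat k)) (of_int (w m - w n))" by (simp only: vge_of_int_iff)
      then have "V k (of_int (w m - w n))" by (rule vge_mono) simp
      then show ?thesis by simp
    qed
    then show "\<exists>N. \<forall>m\<ge>N. \<forall>n\<ge>N. V k (of_int (w m) - of_int (w n))" by blast
  qed
  moreover have "pnull p (\<lambda>n. of_int (f (w n)))" by (rule pnull_of_int) (rule w)
  ultimately show ?thesis using that w(1) by blast
qed

lemma pcauchy_cube_root:
  assumes p3: "p = 3" and c: "c mod 9 = 1 \<or> c mod 9 = 8"
  obtains w where "\<And>n. 3 dvd w n - c" "pcauchy p (\<lambda>n. of_int (w n))"
    "pnull p (\<lambda>n. of_int (w n)^3 - of_int c)"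
proof -
  have "int p ^ n dvd x - y"
    if x: "3 dvd x - c" and y: "3 dvd y - c" and d: "int p ^ (n + 1) dvd (x^3 - c) - (y^3 - c)" for x y n
  proof -
    have "3 dvd x - y" using x y by presburger
    then obtain h where h: "x = y + 3 * h" by (auto elim!: dvdE simp: algebra_simps)
    \<comment> \<open>With x = y + 3 h, x^2 + x y + y^2 is 3 times \<open>?m\<close>, a unit at 3;
      the factor 3 is the one power lost.\<close>
    let ?m = "y * y + 3 * (h * y + h^2)"
    have "(x^3 - c) - (y^3 - c) = 3 * ((x - y) * ?m)"
      unfolding h by (simp add: power2_eq_square power3_eq_cube algebra_simps)
    then have "3 * 3 ^ n dvd 3 * ((x - y) * ?m)" using d p3 by simp
    then have "3 ^ n dvd (x - y) * ?m" by simp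
    moreover have "coprime (3 ^ n) ?m"
    proof -
      have "\<not> 3 dvd y" using y c by presburger
      then have "\<not> 3 dvd y * y" by (simp add: prime_dvd_mult_iff)
      then have "\<not> 3 dvd ?m" by (metis dvd_add_left_iff dvd_triv_left)
      then show ?thesis using prime_imp_coprime[of "3::int" ?m] by simp
    qed
    ultimately show ?thesis using p3 by (simp add: coprime_dvd_mult_left_iff)
  qed
  note lift = this
  show ?thesis
  proof (rule pcauchy_root[of "\<lambda>x. 3 dvd x - c" "\<lambda>x. x^3 - c" 1])
    show "\<exists>x. 3 dvd x - c \<and> int p ^ n dvd x^3 - c" for n
      using cube_root_3_adic[OF c, of n] p3 by simp
    fix w assume "\<And>n. 3 dvd w n - c" "pcauchy p (\<lambda>n. of_int (w n))"
      "pnull p (\<lambda>n. of_int ((w n)^3 - c))"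
    then show thesis by (intro that[of w]) simp_all
  qed (use lift in simp_all)
qed

lemma pcauchy_omega:
  assumes p3: "p \<noteq> 3" and w0: "int p dvd w0^2 + w0 + 1"
  obtains w where "\<And>n. int p dvd w n - w0" "pcauchy p (\<lambda>n. of_int (w n))"
    "pnull p (\<lambda>n. of_int (w n)^2 + of_int (w n) + 1)"
proof -
  have "int p ^ n dvd x - y"
    if x: "int p dvd x - w0" and y: "int p dvd y - w0"
      and d: "int p ^ (n + 0) dvd (x^2 + x + 1) - (y^2 + y + 1)" for x y n
  proof -
    have "(x^2 + x + 1) - (y^2 + y + 1) = (x - y) * (x + y + 1)" by (simp add: power2_eq_square algebra_simps)
    then have "int p ^ n dvd (x - y) * (x + y + 1)" using d by simp
    moreover have "\<not> int p dvd x + y + 1"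
    proof
      assume a: "int p dvd x + y + 1"
      have "2 * w0 + 1 = (x + y + 1) - (x - w0) - (y - w0)" by simp
      then have "int p dvd 2 * w0 + 1" using a x y by (metis dvd_diff)
      moreover have "3 = 4 * (w0^2 + w0 + 1) - (2 * w0 + 1) * (2 * w0 + 1)"
        by (simp add: power2_eq_square algebra_simps)
      ultimately have "int p dvd 3" using w0 by (metis dvd_diff dvd_mult)
      then show False using p p3 prime_dvd_3_int by blast
    qed
    ultimately show ?thesis
      using prime_imp_coprime[OF prime_int, of "x + y + 1"] by (simp add: coprime_dvd_mult_left_iff)
  qed
  note lift = this
  show ?thesis
  proof (rule pcauchy_root[of "\<lambda>x. int p dvd x - w0" "\<lambda>x. x^2 + x + 1" 0])
    show "\<exists>x. int p dvd x - w0 \<and> int p ^ n dvd x^2 + x + 1" for n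
      by (rule omega_p_adic[OF p p3 w0])
    fix w assume "\<And>n. int p dvd w n - w0" "pcauchy p (\<lambda>n. of_int (w n))"
      "pnull p (\<lambda>n. of_int ((w n)^2 + w n + 1))"
    then show thesis by (intro that[of w]) simp_all
  qed (use lift in simp_all)
qed

end

section \<open>The two curves\<close>

context padic
begin

lemma rat_val_pos_iff: "q \<noteq> 0 \<Longrightarrow> 0 < rat_val p q \<longleftrightarrow> V 1 q"
  by (auto simp: vge_def)

lemma not_vge_1_1: "\<not> V 1 1"
  by (simp add: vge_def)

lemma vge_divide_unit: "\<not> V 1 y \<Longrightarrow> V k x \<Longrightarrow> V k (x / y)"
  using vge_divide[of k x 0 y] by simp

lemma tamagawa_eq:
  assumes T: "p_minimal p A (0, A2, A3, A4, A6)" and d: "disc A \<noteq> 0"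
    and A: "V 1 A2" "V 1 A3" "V 1 A4" "V 1 A6"
    and H: "\<And>u r s t. tate_form p A2 A3 A4 A6 u r s t \<Longrightarrow> E0_index p (chg (0, A2, A3, A4, A6) u r s t) = c"
  shows "tamagawa p A = c"
proof -
  obtain u r s t where "tate_form p A2 A3 A4 A6 u r s t" "min_model p A = chg (0, A2, A3, A4, A6) u r s t"
    by (rule minimal_model_tate_form[OF T d A])
  then show ?thesis using H by (simp add: tamagawa_def)
qed

lemma vge_9_iff: "p = 3 \<Longrightarrow> V 2 (of_int n) \<longleftrightarrow> 9 dvd n"
  using vge_of_int_iff[of 2 n] by simp

lemma vge_3_numerals:
  assumes "p = 3"
  shows "V 1 3" "\<not> V 2 3" "V 2 9" "\<not> V 3 9" "V 3 27" "\<not> V 4 27" "\<not> V 1 2" "\<not> V 1 4" "\<not> V 1 8"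
    "V 9 19683" "\<not> V 10 19683"
  using vge_of_int_iff[of 1 3] vge_of_int_iff[of 2 3] vge_of_int_iff[of 2 9] vge_of_int_iff[of 3 9]
    vge_of_int_iff[of 3 27] vge_of_int_iff[of 4 27] vge_of_int_iff[of 1 2] vge_of_int_iff[of 1 4]
    vge_of_int_iff[of 1 8] vge_of_int_iff[of 9 19683] vge_of_int_iff[of 10 19683] assms
  by simp_all

lemma not_vge_3_other:
  assumes "p \<noteq> 3"
  shows "\<not> V 1 3"
  using vge_of_int_1[of 3] prime_dvd_3_int[OF p] assms by auto

lemma not_vge_power_unit: "\<not> V 1 x \<Longrightarrow> \<not> V 1 (x ^ n)"
proof (induction n)
  case (Suc n)
  then show ?case using not_vge_mult[of 0 x 0 "x ^ n"] by simp
qed (simp add: not_vge_1_1)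

text \<open>After division by the coordinate of smaller valuation, one coordinate is 1 and the form
  takes a unit value. So its valuation is twice the smaller one, and an odd bound improves by
  one.\<close>

lemma nonsplit_form_vge:
  assumes p3: "p mod 3 = 2" and F: "V (2 * k - 1) (x^2 + x * b + 7 * b^2)"
  shows "V k x \<and> V k b"
proof -
  have no: "\<not> V 1 (m^2 + m * n + 7 * n^2)" if q0: "V 0 q" and mn: "m = 1 \<and> n = q \<or> m = q \<and> n = 1" for m n q
  proof
    assume V1: "V 1 (m^2 + m * n + 7 * n^2)"
    obtain i where i: "V (int 1) (q - of_int i)" using vge_approx_int[OF q0] by blast
    have iq: "V 1 (q - of_int i)" using i by simp
    have q: "V 1 ((q - of_int i) * (q + of_int i + 1))" "V 1 ((q - of_int i) * (7 * (q + of_int i) + 1))"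
      by (intro vge_mult_0'[OF _ iq] vge_add vge_mult_0 q0 vge_of_int vge_1 vge_numeral)+
    have one: "\<not> int p dvd 1" using prime_int not_prime_unit by blast
    from mn show False
    proof
      assume "m = 1 \<and> n = q"
      then have "V 1 (1^2 + 1 * q + 7 * q^2)" using V1 by simp
      moreover have "1^2 + 1 * q + 7 * q^2 - (q - of_int i) * (7 * (q + of_int i) + 1)
          = of_int (1^2 + 1 * i + 7 * i^2)" by (simp add: power2_eq_square algebra_simps)
      ultimately have "V 1 (of_int (1^2 + 1 * i + 7 * i^2))" using vge_diff q(2) by metis
      then have "int p dvd 1^2 + 1 * i + 7 * i^2" by (simp only: vge_of_int_1)
      then show False using quadratic_form_nonsplit(2)[OF p p3, of 1 i] one by blast
    next
      assume "m = q \<and> n = 1"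
      then have "V 1 (q^2 + q * 1 + 7 * 1^2)" using V1 by simp
      moreover have "q^2 + q * 1 + 7 * 1^2 - (q - of_int i) * (q + of_int i + 1)
          = of_int (i^2 + i * 1 + 7 * 1^2)" by (simp add: power2_eq_square algebra_simps)
      ultimately have "V 1 (of_int (i^2 + i * 1 + 7 * 1^2))" using vge_diff q(1) by metis
      then have "int p dvd i^2 + i * 1 + 7 * 1^2" by (simp only: vge_of_int_1)
      then show False using quadratic_form_nonsplit(1)[OF p p3, of i 1] one by blast
    qed
  qed
  have main: "V k w" if w: "V (2 * k - 1) (w * w * f)" and f: "\<not> V 1 f" for w f
  proof (rule ccontr)
    assume "\<not> V k w"
    then have "\<not> V (2 * k - 2 + 1) (w * w)" using not_vge_mult[of "k - 1" w "k - 1" w] by (simp add: algebra_simps)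
    then show False using vge_cancel[of "2 * k - 2" 1 "w * w" f] w f by (simp add: algebra_simps)
  qed
  consider "x = 0" "b = 0" | "x \<noteq> 0" "V (rat_val p x) b" | "b \<noteq> 0" "V (rat_val p b) x"
    by (metis linear vge_def)
  then show ?thesis
  proof cases
    case 2
    have "V 0 (b / x)" using vge_divide[OF 2(2), of "rat_val p x" x] 2(1) by (simp add: vge_def)
    then have "\<not> V 1 (1^2 + 1 * (b / x) + 7 * (b / x)^2)" by (intro no[of "b / x"]) auto
    moreover have "x * x * (1^2 + 1 * (b / x) + 7 * (b / x)^2) = x^2 + x * b + 7 * b^2"
      using 2(1) by (simp add: field_simps power2_eq_square)
    ultimately have "V k x" using main F by metis
    then show ?thesis using 2 by (auto simp: vge_def)
  next
    case 3
    have "V 0 (x / b)" using vge_divide[OF 3(2), of "rat_val p b" b] 3(1) by (simp add: vge_def)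
    then have "\<not> V 1 ((x / b)^2 + (x / b) * 1 + 7 * 1^2)" by (intro no[of "x / b"]) auto
    moreover have "b * b * ((x / b)^2 + (x / b) * 1 + 7 * 1^2) = x^2 + x * b + 7 * b^2"
      using 3(1) by (simp add: field_simps power2_eq_square)
    ultimately have "V k b" using main F by metis
    then show ?thesis using 3 by (auto simp: vge_def)
  qed simp
qed

end

section \<open>Minimality for cubefree \<open>a\<close>, and Tamagawa numbers at primes dividing
  \<open>a\<close>\<close>

locale cubefree_padic = padic +
  fixes a :: int
  assumes a: "a \<noteq> 0" "cubefree a"
begin

abbreviation \<alpha> :: rat where "\<alpha> \<equiv> of_int a"

lemma not_vge_3_a: "\<not> V 3 \<alpha>"
  using a(2) p vge_of_int_iff[of 3 a] by (auto simp: cubefree_def)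

lemma not_vge_9_a4: "\<not> V 9 (\<alpha>^4)"
proof -
  have "\<not> V 5 (\<alpha> * \<alpha>)" using not_vge_mult[of 2 \<alpha> 2 \<alpha>] not_vge_3_a by simp
  then show ?thesis
    using not_vge_mult[of 4 "\<alpha> * \<alpha>" 4 "\<alpha> * \<alpha>"] by (simp add: power4_eq_xxxx mult.assoc)
qed

lemma disc_E: "disc (E_C3 a) = - (3^3 * \<alpha>^4)"
  by (simp add: E_C3_def disc_def Let_def)

lemma disc_Et: "disc (Et_C3 a) = - (3^9 * \<alpha>^4)"
  by (simp add: Et_C3_def disc_def Let_def power2_eq_square power4_eq_xxxx)

lemma disc_nonzero: "disc (E_C3 a) \<noteq> 0" "disc (Et_C3 a) \<noteq> 0"
  using a by (simp_all add: disc_E disc_Et)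

lemma V_a: "V 0 \<alpha>"
  by simp

lemma disc_unit_change: "disc (chg A 1 r s t) = disc A"
  using disc_chg[of 1 A] by simp

text \<open>The valuation of 27 a^4 is at most 3 + 8 = 11, at 3 as well as elsewhere.\<close>

lemma E_minimal:
  assumes T: "chg (E_C3 a) 1 r s t = T" and i: "integral_model p T"
  shows "p_minimal p (E_C3 a) T"
proof (rule p_minimal_if_disc_lt_12[OF T[symmetric] _ i disc_nonzero(1)])
  have "\<not> V 4 27"
  proof (cases "p = 3")
    case True
    then show ?thesis by (rule vge_3_numerals)
  next
    case False
    then have "\<not> V 1 (3^3)" by (intro not_vge_power_unit not_vge_3_other)
    then show ?thesis using vge_mono[of 4 27 1] by auto
  qed
  then show "\<not> V 12 (disc T)"
    using not_vge_mult[of 3 27 8 "\<alpha>^4"] not_vge_9_a4 unfolding T[symmetric] disc_unit_change disc_E by simp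
qed simp

text \<open>The valuation of 3^9 a^4 is at most 8 away from 3, and 9 at 3 if \<open>a\<close> is a
  unit there. The excluded case has 13 or 17.\<close>

lemma Et_minimal:
  assumes T: "chg (Et_C3 a) 1 r s t = T" and i: "integral_model p T" and pa: "p \<noteq> 3 \<or> \<not> V 1 \<alpha>"
  shows "p_minimal p (Et_C3 a) T"
proof (rule p_minimal_if_disc_lt_12[OF T[symmetric] _ i disc_nonzero(2)])
  have "\<not> V 12 (3^9 * \<alpha>^4)"
  proof (cases "p = 3")
    case True
    then have "\<not> V 1 (\<alpha>^4)" using pa not_vge_power_unit by blast
    then have "\<not> V 10 (19683 * \<alpha>^4)"
      using not_vge_mult[of 9 19683 0 "\<alpha>^4"] vge_3_numerals(11)[OF True] by simp
    then show ?thesis using vge_mono[of 12 "19683 * \<alpha>^4" 10] by auto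
  next
    case False
    then have "\<not> V 1 (3^9)" by (intro not_vge_power_unit not_vge_3_other)
    then have "\<not> V 9 (3^9 * \<alpha>^4)" using not_vge_mult[of 0 "3^9" 8 "\<alpha>^4"] not_vge_9_a4 by simp
    then show ?thesis using vge_mono[of 12 "3^9 * \<alpha>^4" 9] by auto
  qed
  then show "\<not> V 12 (disc T)"
    unfolding T[symmetric] disc_unit_change disc_Et by simp
qed simp

lemma E_tuple: "chg (E_C3 a) 1 0 0 0 = (0, 0, \<alpha>, 0, 0)"
  by (simp add: E_C3_def)

lemma Et_tuple: "chg (Et_C3 a) 1 0 0 0 = (0, 0, \<alpha>, 0, - (7 * \<alpha>^2))"
  by (simp add: Et_C3_def)

lemma vge_a: "V 1 \<alpha> \<longleftrightarrow> int p dvd a"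
  by (rule vge_of_int_1)

lemma vge_a4: "V 1 (\<alpha>^4) \<longleftrightarrow> V 1 \<alpha>"
  using not_vge_power_unit[of \<alpha> 4] vge_power[of 1 \<alpha> 4] vge_mono[of 4 "\<alpha>^4" 1] by auto

lemma vge_disc: "0 < n \<Longrightarrow> V 1 (- (3^n * \<alpha>^4)) \<longleftrightarrow> int p dvd 3 * a"
proof -
  assume n: "0 < n"
  have "V 1 (3^n * \<alpha>^4) \<longleftrightarrow> V 1 3 \<or> V 1 \<alpha>"
  proof
    assume "V 1 (3^n * \<alpha>^4)"
    then show "V 1 3 \<or> V 1 \<alpha>"
      using not_vge_mult[of 0 "3^n" 0 "\<alpha>^4"] not_vge_power_unit[of 3 n] vge_a4 by auto
  next
    have 3: "V 0 (3^n)" by (intro vge_power_0 vge_numeral)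
    have "V 1 (3^n)" if "V 1 3"
      using vge_power[OF that, of n] vge_mono[of "int n" "3^n" 1] n by simp
    then show "V 1 (3^n * \<alpha>^4)" if "V 1 3 \<or> V 1 \<alpha>"
      using that vge_mult_0[OF 3, of 1 "\<alpha>^4"] vge_mult_0'[of "\<alpha>^4" 1 "3^n"] vge_power_0[OF V_a, of 4] vge_a4
      by blast
  qed
  also have "\<dots> \<longleftrightarrow> int p dvd 3 * a"
    using vge_of_int_1[of 3] vge_a prime_int by (simp add: prime_dvd_mult_iff)
  finally show ?thesis by simp
qed

lemma E_bad_reduction: "bad_reduction p (E_C3 a) \<longleftrightarrow> int p dvd 3 * a"
proof -
  have "p_minimal p (E_C3 a) (0, 0, \<alpha>, 0, 0)"
    by (rule E_minimal[OF E_tuple]) (simp add: integral_model_tuple)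
  from bad_reduction_iff[OF this] show ?thesis
    using disc_E disc_nonzero(1) rat_val_pos_iff[OF disc_nonzero(1)] vge_disc[of 3]
    by (simp add: E_C3_def)
qed

text \<open>Type IV if v(a) = 1 and IV* if v(a) = 2. The singular point has abscissa 0 and as
  ordinate a p-adic root of the quadratic on the line z = 0.\<close>

lemma tamagawa_split_IV:
  assumes "p_minimal p A (0, 0, c * \<alpha>, 0, g * \<alpha>^2)" "disc A \<noteq> 0" and pa: "V 1 \<alpha>"
    and c: "V 0 c" "\<not> V 1 c" and g: "V 1 g"
    and y: "pcauchy p y" "pnull p (\<lambda>n. y n ^ 2 + c * \<alpha> * y n - g * \<alpha>^2)"
  shows "tamagawa p A = 3"
proof (rule tamagawa_eq[OF assms(1,2)])
  have aa: "V 2 (\<alpha>^2)" using vge_power[OF pa, of 2] by simp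
  show A3: "V 1 (c * \<alpha>)" by (rule vge_mult_0[OF c(1) pa])
  have A6: "V 3 (g * \<alpha>^2)" using vge_mult[OF g aa] by simp
  then show "V 1 (g * \<alpha>^2)" by (rule vge_mono) simp
  fix u r s t assume tf: "tate_form p 0 (c * \<alpha>) 0 (g * \<alpha>^2) u r s t"
  have pt: "pcauchy p (\<lambda>_. 0)" "pge p (\<lambda>_. 0) 1" by (simp_all add: pge_def)
  have eq: "pnull p (\<lambda>n. weq (0, 0, c * \<alpha>, 0, g * \<alpha>^2) 0 (y n))"
    using y(2) by (simp add: weq_tuple)
  show "E0_index p (chg (0, 0, c * \<alpha>, 0, g * \<alpha>^2) u r s t) = 3"
  proof (cases "V 2 \<alpha>")
    case False
    have "\<not> V 2 (c * \<alpha>)" using not_vge_mult[of 0 c 1 \<alpha>] c False by simp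
    then show ?thesis
      using tate_form.E0_index_type_IV[OF tf _ _ A6 pt(1) y(1) eq pt(2)] by simp
  next
    case True
    have "\<not> V 3 (c * \<alpha>)" using not_vge_mult[of 0 c 2 \<alpha>] c not_vge_3_a by simp
    moreover have "V 2 (c * \<alpha>)" by (rule vge_mult_0[OF c(1) True])
    moreover have "V 5 (g * \<alpha>^2)"
      using vge_mult[OF g vge_power[OF True, of 2]] by simp
    ultimately show ?thesis
      using tate_form.E0_index_type_IV_star[OF tf _ _ _ _ _ pt(1) y(1) eq pt(2)] by simp
  qed
qed simp_all

text \<open>The 3-torsion point (0, 0) itself reduces to the cusp and gives the nontrivial
  components; p = 3 is included.\<close>

lemma E_tamagawa_dvd:
  assumes "int p dvd a"
  shows "tamagawa p (E_C3 a) = 3"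
proof (rule tamagawa_split_IV[of _ 1 0 "\<lambda>_. 0"])
  show "p_minimal p (E_C3 a) (0, 0, 1 * \<alpha>, 0, 0 * \<alpha>^2)"
    using E_minimal[OF E_tuple] by (simp add: integral_model_tuple)
qed (use assms vge_a disc_nonzero not_vge_1_1 in simp_all)

text \<open>The roots of y^2 + a y + 7 a^2 are (3 w + 1) a with w a primitive cube root of unity.
  The change of variables must be rational, so the translation uses an integer \<open>v\<close> that
  is a root modulo p only; relative to it the exact root is 3 a (w - v).\<close>

lemma Et_tamagawa_split:
  assumes "int p dvd a" and p1: "p mod 6 = 1"
  shows "tamagawa p (Et_C3 a) = 3"
proof -
  have p3: "p \<noteq> 3" "p mod 3 = 1" using p1 by (auto, presburger)
  obtain w0 where w0: "int p dvd w0^2 + w0 + 1" by (rule root_of_unity_order_3[OF p p3(2)])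
  obtain w where w: "\<And>n. int p dvd w n - w0" "pcauchy p (\<lambda>n. of_int (w n))"
    "pnull p (\<lambda>n. of_int (w n)^2 + of_int (w n) + 1)"
    using pcauchy_omega[OF p3(1) w0] by blast
  define v :: rat where "v = of_int w0"
  have v: "V 0 v" "V 1 (v^2 + v + 1)" using w0 vge_of_int_1[of "w0^2 + w0 + 1"] by (simp_all add: v_def)
  show ?thesis
  proof (rule tamagawa_split_IV[of _ "3 * (2 * v + 1)" "- (9 * (v^2 + v + 1))" "\<lambda>n. 3 * \<alpha> * (of_int (w n) - v)"])
    have "chg (Et_C3 a) 1 0 0 ((3 * v + 1) * \<alpha>) = (0, 0, 3 * (2 * v + 1) * \<alpha>, 0, - (9 * (v^2 + v + 1)) * \<alpha>^2)"
      by (simp add: Et_C3_def chg_def algebra_simps power2_eq_square)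
    then show "p_minimal p (Et_C3 a) (0, 0, 3 * (2 * v + 1) * \<alpha>, 0, - (9 * (v^2 + v + 1)) * \<alpha>^2)"
    proof (rule Et_minimal)
      show "integral_model p (0, 0, 3 * (2 * v + 1) * \<alpha>, 0, - (9 * (v^2 + v + 1)) * \<alpha>^2)"
        unfolding integral_model_tuple
        by (intro conjI vge_mult_0 vge_minus[THEN iffD2] vge_add vge_power_0 vge_0 vge_1 vge_numeral v V_a)
    qed (use p3 in simp)
    show "V 0 (3 * (2 * v + 1))" by (intro vge_mult_0 vge_add vge_numeral v vge_1)
    show "\<not> V 1 (3 * (2 * v + 1))"
    proof
      assume "V 1 (3 * (2 * v + 1))"
      then have "V 1 (2 * v + 1)" using vge_cancel[of 0 1 3 "2 * v + 1"] not_vge_3_other[OF p3(1)] by simp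
      moreover have "V 0 (2 * v + 1)" by (intro vge_mult_0 vge_add vge_numeral v vge_1)
      ultimately have "V 1 ((2 * v + 1) * (2 * v + 1))" by (rule vge_mult_0'[rotated])
      then have "V 1 (4 * (v^2 + v + 1) - (2 * v + 1) * (2 * v + 1))"
        by (rule vge_diff[OF vge_mult_0[OF vge_numeral v(2)]])
      moreover have "4 * (v^2 + v + 1) - (2 * v + 1) * (2 * v + 1) = 3"
        by (simp add: power2_eq_square algebra_simps)
      ultimately show False using not_vge_3_other[OF p3(1)] by metis
    qed
    show "V 1 (- (9 * (v^2 + v + 1)))" by (rule vge_minus[THEN iffD2, OF vge_mult_0[OF vge_numeral v(2)]])
    show "pcauchy p (\<lambda>n. 3 * \<alpha> * (of_int (w n) - v))" by (intro pcauchy_intros w)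
    have "pnull p (\<lambda>n. 9 * \<alpha>^2 * (of_int (w n)^2 + of_int (w n) + 1))"
      by (intro pnull_mult pcauchy_const w)
    moreover have "(3 * \<alpha> * (x - v))^2 + 3 * (2 * v + 1) * \<alpha> * (3 * \<alpha> * (x - v)) - - (9 * (v^2 + v + 1)) * \<alpha>^2
      = 9 * \<alpha>^2 * (x^2 + x + 1)" for x by Groebner_Basis.algebra
    ultimately show "pnull p (\<lambda>n. (3 * \<alpha> * (of_int (w n) - v))^2 + 3 * (2 * v + 1) * \<alpha> * (3 * \<alpha> * (of_int (w n) - v))
      - - (9 * (v^2 + v + 1)) * \<alpha>^2)" by (simp only:)
  qed (use assms vge_a disc_nonzero in simp_all)
qed

text \<open>A singular point would make the anisotropic form y^2 + y a + 7 a^2 equal to z^3 up to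
  the residual. One side has even valuation and the other a multiple of 3, so the bounds rise from 3
  to 5 and force v(a) >= 3, which cubefreeness excludes.\<close>

lemma Et_tamagawa_nonsplit:
  assumes pa: "int p dvd a" and p2: "p mod 6 = 2 \<or> p mod 6 = 5"
  shows "tamagawa p (Et_C3 a) = 1"
proof -
  have p3: "p \<noteq> 3" "p mod 3 = 2" using p2 by (auto, presburger+)
  have va: "V 1 \<alpha>" using pa vge_a by simp
  show ?thesis
  proof (rule tamagawa_eq)
    show "p_minimal p (Et_C3 a) (0, 0, \<alpha>, 0, - (7 * \<alpha>^2))"
      by (rule Et_minimal[OF Et_tuple]) (use p3 in \<open>auto simp: integral_model_tuple intro!: vge_mult_0 vge_power_0\<close>)
    have "V 1 (\<alpha>^2)" using vge_mult_0[OF V_a va] by (simp add: power2_eq_square)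
    then show A6: "V 1 (- (7 * \<alpha>^2))" using vge_mult_0[OF vge_numeral] by simp
    fix u r s t assume tf: "tate_form p 0 \<alpha> 0 (- (7 * \<alpha>^2)) u r s t"
    interpret tate_form p 0 \<alpha> 0 "- (7 * \<alpha>^2)" u r s t by (rule tf)
    show "E0_index p (chg (0, 0, \<alpha>, 0, - (7 * \<alpha>^2)) u r s t) = 1"
    proof (rule E0_index_no_singular_points)
      fix z y assume z: "V 1 z" and y: "V 1 y"
      show "\<not> V 8 (weq (0, 0, \<alpha>, 0, - (7 * \<alpha>^2)) z y)"
      proof
        assume F: "V 8 (weq (0, 0, \<alpha>, 0, - (7 * \<alpha>^2)) z y)"
        have eq: "y^2 + y * \<alpha> + 7 * \<alpha>^2 = weq (0, 0, \<alpha>, 0, - (7 * \<alpha>^2)) z y + z * (z * z)"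
          unfolding weq_tuple by (simp add: power2_eq_square power3_eq_cube algebra_simps)
        have zz: "V 2 (z * z)" using vge_mult[OF z z] by simp
        have "V 3 (y^2 + y * \<alpha> + 7 * \<alpha>^2)"
          unfolding eq by (intro vge_add vge_mono[OF F] vge_mult_le[OF z zz]) auto
        then have 2: "V 2 y" "V 2 \<alpha>" using nonsplit_form_vge[OF p3(2), of 2] by simp_all
        have "V 4 (y * y)" "V 4 (y * \<alpha>)" "V 4 (\<alpha> * \<alpha>)"
          using vge_mult[OF 2(1) 2(1)] vge_mult[OF 2(1) 2(2)] vge_mult[OF 2(2) 2(2)] by simp_all
        then have "V 4 (y^2 + y * \<alpha> + 7 * \<alpha>^2)"
          unfolding power2_eq_square by (intro vge_add vge_mult_0[OF vge_numeral])
        then have "V 4 (z * (z * z))"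
          unfolding eq using vge_add_iff[OF vge_mono[OF F], of 4] by simp
        then have z2: "V 2 z" using vge_2_if_cube[OF z, of 0] by simp
        have zz: "V 4 (z * z)" using vge_mult[OF z2 z2] by simp
        have "V 5 (y^2 + y * \<alpha> + 7 * \<alpha>^2)"
          unfolding eq by (intro vge_add vge_mono[OF F] vge_mult_le[OF z2 zz]) auto
        then have "V 3 \<alpha>" using nonsplit_form_vge[OF p3(2), of 3] by simp
        then show False using not_vge_3_a by simp
      qed
    qed
  qed (use va disc_nonzero in simp_all)
qed

end

section \<open>The prime 3 when \<open>a\<close> is prime to 3\<close>

lemma square_mod_9: "(a::int) mod 9 = r \<Longrightarrow> a^2 mod 9 = r^2 mod 9"
  by (metis power_mod)

lemma not_minus_one_square_mod_3: "\<not> (3::int) dvd 4 * m^2 + 1"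
proof -
  have "m mod 3 = 0 \<or> m mod 3 = 1 \<or> m mod 3 = 2" by presburger
  moreover have "m^2 mod 3 = (m mod 3)^2 mod 3" by (simp add: power_mod)
  ultimately have "m^2 mod 3 = 0 \<or> m^2 mod 3 = 1" by auto
  then show ?thesis by presburger
qed

context cubefree_padic
begin

lemma pge_of_int_divide_2:
  assumes "p = 3" "\<And>n. 3 dvd f n"
  shows "pge p (\<lambda>n. of_int (f n) / 2) 1"
proof -
  have "V 1 (of_int (f n) / 2)" for n
    using assms(2)[of n] vge_of_int_1[of "f n"] vge_3_numerals(7)[OF assms(1)] assms(1)
    by (intro vge_divide_unit) simp_all
  then show ?thesis by (simp add: pge_eventually)
qed

lemma vge_divide_4: "p = 3 \<Longrightarrow> V k (x / 4) \<longleftrightarrow> V k x"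
  using vge_divide_unit[of 4 k x] vge_3_numerals(8) vge_mult_0[OF vge_numeral, of k "x / 4" "num.Bit0 (num.Bit0 num.One)"]
  by auto

text \<open>Completing the square gives y^2 = x^3 + a^2/4. For \<open>a\<close> prime to 3 the
  constant is 1 mod 3, so the cusp is at x = -1.\<close>

lemma E_unit_model: "chg (E_C3 a) 1 (-1) 0 (- (\<alpha> / 2)) = (0, -3, 0, 3, (\<alpha>^2 - 4) / 4)"
  by (simp add: E_C3_def chg_def power2_eq_square field_simps)

lemma E_unit_conditions:
  assumes p3: "p = 3" and a: "3 dvd a^2 - 4"
  shows "p_minimal p (E_C3 a) (0, -3, 0, 3, (\<alpha>^2 - 4) / 4)" "V 1 (-3)" "V 1 3" "V 1 ((\<alpha>^2 - 4) / 4)"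
proof -
  show n: "V 1 (-3)" "V 1 3" using vge_3_numerals(1)[OF p3] by simp_all
  show 6: "V 1 ((\<alpha>^2 - 4) / 4)"
    using vge_divide_4[OF p3] vge_of_int_1[of "a^2 - 4"] a p3 by simp
  show "p_minimal p (E_C3 a) (0, -3, 0, 3, (\<alpha>^2 - 4) / 4)"
    by (rule E_minimal[OF E_unit_model])
      (use vge_mono[OF 6, of 0] in \<open>simp add: integral_model_tuple\<close>)
qed

text \<open>Type III. The singular point is 2-torsion: x^3 = -a^2/4 = -(2 a^2)/8, and 2 a^2 = 8 mod
  9 is a 3-adic cube w^3; thus x = -w/2 and z = x + 1.\<close>

lemma E_tamagawa_2:
  assumes p3: "p = 3" and a9: "a mod 9 = 2 \<or> a mod 9 = 7"
  shows "tamagawa p (E_C3 a) = 2"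
proof -
  have sq: "a^2 mod 9 = 4" using a9 square_mod_9[of a 2] square_mod_9[of a 7] by auto
  define c where "c = 2 * a^2"
  have c: "c mod 9 = 8" using sq unfolding c_def by presburger
  obtain w where w: "\<And>n. 3 dvd w n - c" "pcauchy p (\<lambda>n. of_int (w n))" "pnull p (\<lambda>n. of_int (w n)^3 - of_int c)"
    using pcauchy_cube_root[OF p3] c by blast
  have a3: "3 dvd a^2 - 4" using sq by presburger
  note cond = E_unit_conditions[OF p3 a3]
  show ?thesis
  proof (rule tamagawa_eq[OF cond(1) disc_nonzero(1) cond(2) _ cond(3,4)])
    fix u r s t assume tf: "tate_form p (-3) 0 3 ((\<alpha>^2 - 4) / 4) u r s t"
    show "E0_index p (chg (0, -3, 0, 3, (\<alpha>^2 - 4) / 4) u r s t) = 2"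
    proof (rule tate_form.E0_index_type_III[OF tf])
      have "3 dvd 2 - w n" for n using w(1)[of n] c by presburger
      then have "pge p (\<lambda>n. of_int (2 - w n) / 2) 1" by (rule pge_of_int_divide_2[OF p3])
      then show "pge p (\<lambda>n. 1 - of_int (w n) / 2) 1" by (simp add: diff_divide_distrib)
      show "pcauchy p (\<lambda>n. 1 - of_int (w n) / 2)"
        unfolding divide_inverse by (intro pcauchy_intros w)
      have "pnull p (\<lambda>n. 1 / 8 * (of_int (w n)^3 - of_int c))" by (intro pnull_mult pcauchy_const w)
      moreover have "weq (0, -3, 0, 3, (\<alpha>^2 - 4) / 4) (1 - x / 2) 0 = 1 / 8 * (x^3 - of_int c)" for x
        by (simp add: weq_tuple c_def power2_eq_square power3_eq_cube field_simps)
      ultimately show "pnull p (\<lambda>n. weq (0, -3, 0, 3, (\<alpha>^2 - 4) / 4) (1 - of_int (w n) / 2) 0)" by (simp only:)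
    qed (use vge_3_numerals(2)[OF p3] in simp_all)
  qed simp
qed

text \<open>Type II: the constant term has valuation exactly 1, all other terms at a singular point
  at least 2.\<close>

lemma E_tamagawa_1:
  assumes p3: "p = 3" and a9: "a mod 9 = 1 \<or> a mod 9 = 8 \<or> a mod 9 = 4 \<or> a mod 9 = 5"
  shows "tamagawa p (E_C3 a) = 1"
proof -
  have sq: "a^2 mod 9 = 1 \<or> a^2 mod 9 = 7"
    using a9 square_mod_9[of a 1] square_mod_9[of a 8] square_mod_9[of a 4] square_mod_9[of a 5] by auto
  have a3: "3 dvd a^2 - 4" using sq by presburger
  note cond = E_unit_conditions[OF p3 a3]
  show ?thesis
  proof (rule tamagawa_eq[OF cond(1) disc_nonzero(1) cond(2) _ cond(3,4)])
    fix u r s t assume tf: "tate_form p (-3) 0 3 ((\<alpha>^2 - 4) / 4) u r s t"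
    show "E0_index p (chg (0, -3, 0, 3, (\<alpha>^2 - 4) / 4) u r s t) = 1"
    proof (rule tate_form.E0_index_no_singular_points[OF tf])
      fix z y assume z: "V 1 z" and y: "V 1 y"
      show "\<not> V 8 (weq (0, -3, 0, 3, (\<alpha>^2 - 4) / 4) z y)"
      proof
        assume F: "V 8 (weq (0, -3, 0, 3, (\<alpha>^2 - 4) / 4) z y)"
        have zz: "V 1 (z * z)" by (rule vge_mult_le[OF z z]) simp
        have "(\<alpha>^2 - 4) / 4 = y * y - weq (0, -3, 0, 3, (\<alpha>^2 - 4) / 4) z y - z * (z * z) + 3 * (z * z) - 3 * z"
          by (simp add: weq_tuple power2_eq_square power3_eq_cube)
        moreover have "V 2 \<dots>"
          by (intro vge_add vge_diff vge_mono[OF F] vge_mult_le[OF y y] vge_mult_le[OF z zz]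
            vge_mult_le[OF cond(3) z] vge_mult_le[OF cond(3) zz]) auto
        ultimately have "V 2 ((\<alpha>^2 - 4) / 4)" by (simp only:)
        then have "V 2 (of_int (a^2 - 4))" using vge_divide_4[OF p3] by simp
        then have "9 dvd a^2 - 4" using vge_9_iff[OF p3] by blast
        then show False using sq by presburger
      qed
    qed
  qed simp
qed

text \<open>From y^2 = x^3 - 27 a^2/4, the translation x = z + 3 makes the constant 27 (1 - a^2/4),
  which is divisible by 81 for \<open>a\<close> prime to 3.\<close>

lemma Et_unit_model: "chg (Et_C3 a) 1 3 0 (- (\<alpha> / 2)) = (0, 9, 0, 27, 27 * ((4 - \<alpha>^2) / 4))"
  by (simp add: Et_C3_def chg_def power2_eq_square field_simps)

text \<open>The translation 4 a differs from -a/2 by 9 a/2. For a^2 = 1 mod 9 this moves a root of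
  the IV* quadratic to 0: \<open>A3\<close> keeps valuation 2 and the constant is divisible by
  3^5.\<close>

lemma Et_unit_model': "chg (Et_C3 a) 1 3 0 (4 * \<alpha>) = (0, 9, 9 * \<alpha>, 27, 27 * (1 - \<alpha>^2))"
  by (simp add: Et_C3_def chg_def power2_eq_square field_simps)

lemma Et_unit_conditions:
  assumes p3: "p = 3" and a: "3 dvd a^2 - 4"
  shows "p_minimal p (Et_C3 a) (0, 9, 0, 27, 27 * ((4 - \<alpha>^2) / 4))"
    "V 1 9" "V 1 27" "V 1 (27 * ((4 - \<alpha>^2) / 4))" "\<not> V 1 \<alpha>"
proof -
  show n: "V 1 9" "V 1 27"
    using vge_mono[OF vge_3_numerals(3)[OF p3], of 1] vge_mono[OF vge_3_numerals(5)[OF p3], of 1] by simp_all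
  have 0: "V 0 ((4 - \<alpha>^2) / 4)"
    unfolding vge_divide_4[OF p3] by (intro vge_diff vge_numeral vge_power_0 V_a)
  then show 6: "V 1 (27 * ((4 - \<alpha>^2) / 4))" using n by (intro vge_mult_0') auto
  show na: "\<not> V 1 \<alpha>"
  proof
    assume "V 1 \<alpha>"
    then have "3 dvd a" using vge_a p3 by simp
    then have "3 dvd a^2" by (simp add: power2_eq_square)
    then show False using a by presburger
  qed
  show "p_minimal p (Et_C3 a) (0, 9, 0, 27, 27 * ((4 - \<alpha>^2) / 4))"
    by (rule Et_minimal[OF Et_unit_model])
      (use vge_mono[OF 6, of 0] na in \<open>simp_all add: integral_model_tuple\<close>)
qed

text \<open>Type III*. The 2-torsion point has x^3 = 27 (2 a^2)/8, hence x = 3 w/2 with w^3 = 2 a^2,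
  and z = x - 3.\<close>

lemma Et_tamagawa_2:
  assumes p3: "p = 3" and a9: "a mod 9 = 2 \<or> a mod 9 = 7"
  shows "tamagawa p (Et_C3 a) = 2"
proof -
  have sq: "a^2 mod 9 = 4" using a9 square_mod_9[of a 2] square_mod_9[of a 7] by auto
  define c where "c = 2 * a^2"
  have c: "c mod 9 = 8" using sq unfolding c_def by presburger
  obtain w where w: "\<And>n. 3 dvd w n - c" "pcauchy p (\<lambda>n. of_int (w n))" "pnull p (\<lambda>n. of_int (w n)^3 - of_int c)"
    using pcauchy_cube_root[OF p3] c by blast
  have a3: "3 dvd a^2 - 4" using sq by presburger
  note cond = Et_unit_conditions[OF p3 a3]
  have "9 dvd 4 - a^2" using sq by presburger
  then have "V 2 (of_int (4 - a^2))" using vge_9_iff[OF p3] by blast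
  then have "V 2 ((4 - \<alpha>^2) / 4)" using vge_divide_4[OF p3] by simp
  then have A6: "V 5 (27 * ((4 - \<alpha>^2) / 4))" by (rule vge_mult_le[OF vge_3_numerals(5)[OF p3]]) simp
  show ?thesis
  proof (rule tamagawa_eq[OF cond(1) disc_nonzero(2) cond(2) _ cond(3,4)])
    fix u r s t assume tf: "tate_form p 9 0 27 (27 * ((4 - \<alpha>^2) / 4)) u r s t"
    show "E0_index p (chg (0, 9, 0, 27, 27 * ((4 - \<alpha>^2) / 4)) u r s t) = 2"
    proof (rule tate_form.E0_index_type_III_star[OF tf _ _ _ _ A6])
      have "3 dvd 3 * (w n - 2)" for n by simp
      then have "pge p (\<lambda>n. of_int (3 * (w n - 2)) / 2) 1" by (rule pge_of_int_divide_2[OF p3])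
      then show "pge p (\<lambda>n. 3 / 2 * (of_int (w n) - 2)) 1" by simp
      show "pcauchy p (\<lambda>n. 3 / 2 * (of_int (w n) - 2))" by (intro pcauchy_intros w)
      have "pnull p (\<lambda>n. - (27 / 8) * (of_int (w n)^3 - of_int c))" by (intro pnull_mult pcauchy_const w)
      moreover have "weq (0, 9, 0, 27, 27 * ((4 - \<alpha>^2) / 4)) (3 / 2 * (x - 2)) 0 = - (27 / 8) * (x^3 - of_int c)" for x
        by (simp add: weq_tuple c_def power2_eq_square power3_eq_cube field_simps)
      ultimately show "pnull p (\<lambda>n. weq (0, 9, 0, 27, 27 * ((4 - \<alpha>^2) / 4)) (3 / 2 * (of_int (w n) - 2)) 0)" by simp
    qed (use vge_3_numerals[OF p3] in simp_all)
  qed simp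
qed

text \<open>Ordinate 0 on the translated model is y = 4 a on the original one, where x^3 = (16 + 4 +
  7) a^2 = 27 a^2. Since a^2 = 1 mod 9 is a 3-adic cube w^3, this gives x = 3 w and z = x -
  3.\<close>

lemma Et_tamagawa_3:
  assumes p3: "p = 3" and a9: "a mod 9 = 1 \<or> a mod 9 = 8"
  shows "tamagawa p (Et_C3 a) = 3"
proof -
  have sq: "a^2 mod 9 = 1" using a9 square_mod_9[of a 1] square_mod_9[of a 8] by auto
  obtain w where w: "\<And>n. 3 dvd w n - a^2" "pcauchy p (\<lambda>n. of_int (w n))" "pnull p (\<lambda>n. of_int (w n)^3 - of_int (a^2))"
    using pcauchy_cube_root[OF p3] sq by blast
  have a3: "3 dvd a^2 - 4" using sq by presburger
  note cond = Et_unit_conditions[OF p3 a3]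
  have "9 dvd 1 - a^2" using sq by presburger
  then have "V 2 (of_int (1 - a^2))" using vge_9_iff[OF p3] by blast
  then have "V 2 (1 - \<alpha>^2)" by simp
  then have A6: "V 5 (27 * (1 - \<alpha>^2))" by (rule vge_mult_le[OF vge_3_numerals(5)[OF p3]]) simp
  have A3: "V 2 (9 * \<alpha>)" by (rule vge_mult_0'[OF V_a vge_3_numerals(3)[OF p3]])
  have nA3: "\<not> V 3 (9 * \<alpha>)" using not_vge_mult[of 2 9 0 \<alpha>] vge_3_numerals(4)[OF p3] cond(5) by simp
  have m: "p_minimal p (Et_C3 a) (0, 9, 9 * \<alpha>, 27, 27 * (1 - \<alpha>^2))"
    by (rule Et_minimal[OF Et_unit_model'])
      (use vge_mono[OF A6, of 0] vge_mono[OF A3, of 0] cond(5) in \<open>simp_all add: integral_model_tuple\<close>)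
  show ?thesis
  proof (rule tamagawa_eq[OF m disc_nonzero(2) cond(2) vge_mono[OF A3] cond(3) vge_mono[OF A6]])
    fix u r s t assume tf: "tate_form p 9 (9 * \<alpha>) 27 (27 * (1 - \<alpha>^2)) u r s t"
    show "E0_index p (chg (0, 9, 9 * \<alpha>, 27, 27 * (1 - \<alpha>^2)) u r s t) = 3"
    proof (rule tate_form.E0_index_type_IV_star[OF tf _ A3 nA3 _ A6])
      have "V 1 (3 * (of_int (w n) - 1))" for n
        using vge_mult_0'[OF vge_of_int vge_3_numerals(1)[OF p3], of "w n - 1"] by simp
      then show "pge p (\<lambda>n. 3 * (of_int (w n) - 1)) 1" by (simp add: pge_eventually)
      show "pcauchy p (\<lambda>n. 3 * (of_int (w n) - 1))" by (intro pcauchy_intros w)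
      have "pnull p (\<lambda>n. - 27 * (of_int (w n)^3 - of_int (a^2)))" by (intro pnull_mult pcauchy_const w)
      moreover have "weq (0, 9, 9 * \<alpha>, 27, 27 * (1 - \<alpha>^2)) (3 * (x - 1)) 0 = - 27 * (x^3 - of_int (a^2))" for x
        by (simp add: weq_tuple power2_eq_square power3_eq_cube field_simps)
      ultimately show "pnull p (\<lambda>n. weq (0, 9, 9 * \<alpha>, 27, 27 * (1 - \<alpha>^2)) (3 * (of_int (w n) - 1)) 0)" by simp
    qed (use vge_3_numerals[OF p3] in simp_all)
  qed simp_all
qed

text \<open>Nonsplit IV*: a singular point would have v(y) >= 2 and y^2 equal to the constant term
  modulo 3^5. The constant divided by 81 is -1 mod 3, not a square.\<close>

lemma Et_tamagawa_1_unit: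
  assumes p3: "p = 3" and a9: "a mod 9 = 4 \<or> a mod 9 = 5"
  shows "tamagawa p (Et_C3 a) = 1"
proof -
  have sq: "a^2 mod 9 = 7" using a9 square_mod_9[of a 4] square_mod_9[of a 5] by auto
  have a3: "3 dvd a^2 - 4" using sq by presburger
  note cond = Et_unit_conditions[OF p3 a3]
  have "V 1 (of_int (4 - a^2))" using vge_of_int_1[of "4 - a^2"] sq p3 by simp presburger
  then have "V 1 ((4 - \<alpha>^2) / 4)" using vge_divide_4[OF p3] by simp
  then have A6: "V 4 (27 * ((4 - \<alpha>^2) / 4))" by (rule vge_mult_le[OF vge_3_numerals(5)[OF p3]]) simp
  show ?thesis
  proof (rule tamagawa_eq[OF cond(1) disc_nonzero(2) cond(2) _ cond(3,4)])
    fix u r s t assume tf: "tate_form p 9 0 27 (27 * ((4 - \<alpha>^2) / 4)) u r s t"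
    interpret tate_form p 9 0 27 "27 * ((4 - \<alpha>^2) / 4)" u r s t by (rule tf)
    show "E0_index p (chg (0, 9, 0, 27, 27 * ((4 - \<alpha>^2) / 4)) u r s t) = 1"
    proof (rule E0_index_no_singular_points)
      fix z y assume z: "V 1 z" and y: "V 1 y"
      show "\<not> V 8 (weq T z y)"
      proof
        assume F: "V 8 (weq T z y)"
        have eq: "y * y = weq T z y + (z * (z * z) + (9 * (z * z) + 27 * z + 27 * ((4 - \<alpha>^2) / 4)))"
          by (simp add: weq_tuple power2_eq_square power3_eq_cube)
        have zz: "V 2 (z * z)" by (rule vge_mult_le[OF z z]) simp
        have w: "V 4 (9 * (z * z) + 27 * z + 27 * ((4 - \<alpha>^2) / 4))"
          by (intro vge_add A6 vge_mult_le[OF vge_3_numerals(3)[OF p3] zz]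
              vge_mult_le[OF vge_3_numerals(5)[OF p3] z]) auto
        have "V 3 (y * y)"
          unfolding eq by (intro vge_add[OF vge_mono[OF F] vge_add[OF vge_mult_le[OF z zz] vge_mono[OF w]]]) auto
        then have y2: "V 2 y" using vge_square_cancel[of 2 y] by simp
        have "V 4 (y * y)" by (rule vge_mult_le[OF y2 y2]) simp
        then have "V 4 (z * (z * z) + (9 * (z * z) + 27 * z + 27 * ((4 - \<alpha>^2) / 4)))"
          unfolding eq using vge_add_iff[OF vge_mono[OF F], of 4] by simp
        then have z2: "V 2 z" using vge_2_if_cube[OF z] w by blast
        have zz2: "V 4 (z * z)" by (rule vge_mult_le[OF z2 z2]) simp
        have y0: "V 0 y" by (rule vge_mono[OF y2]) simp
        \<comment> \<open>Approximation modulo 27 is needed: y - n contributes 3 and y + n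
          contributes 2, which gives y^2 modulo 3^5.\<close>
        obtain n where n: "V (int 3) (y - of_int n)" using vge_approx_int[OF y0] by blast
        then have "V 2 (y - of_int n)" by (rule vge_mono) simp
        then have n2: "V 2 (of_int n)" using vge_cong y2 by blast
        then obtain m where m: "n = 9 * m" using vge_9_iff[OF p3] by (auto elim: dvdE)
        have d: "27 * ((4 - \<alpha>^2) / 4) - of_int n * of_int n
            = (y - of_int n) * (y + of_int n) - weq T z y - z * (z * z) - 9 * (z * z) - 27 * z"
          by (simp add: weq_tuple power2_eq_square power3_eq_cube algebra_simps)
        have "V 5 (27 * ((4 - \<alpha>^2) / 4) - of_int n * of_int n)"
          unfolding d using n
          by (intro vge_diff vge_mono[OF F] vge_mult_le[OF n vge_add[OF y2 n2]] vge_mult_le[OF z2 zz2]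
              vge_mult_le[OF vge_3_numerals(3)[OF p3] zz2] vge_mult_le[OF vge_3_numerals(5)[OF p3] z2]) auto
        moreover have "27 * ((4 - \<alpha>^2) / 4) - of_int n * of_int n = 27 * (of_int (4 - a^2 - 12 * m^2) / 4)"
          by (simp add: m power2_eq_square field_simps)
        ultimately have "V 5 (27 * (of_int (4 - a^2 - 12 * m^2) / 4))" by (simp only:)
        then have "V (3 + 2) (27 * (of_int (4 - a^2 - 12 * m^2) / 4))" by (rule vge_mono) simp
        then have "V 2 (of_int (4 - a^2 - 12 * m^2) / 4)"
          by (rule vge_cancel) (use vge_3_numerals(6)[OF p3] in simp)
        then have "9 dvd 4 - a^2 - 12 * m^2" using vge_divide_4[OF p3] vge_9_iff[OF p3] by blast
        then have "3 dvd 4 * m^2 + 1" using sq by presburger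
        then show False using not_minus_one_square_mod_3 by blast
      qed
    qed
  qed simp
qed

end

section \<open>The isogenous curve at 3 when 3 divides \<open>a\<close>\<close>

context cubefree_padic
begin

text \<open>Kraus' condition at 3: an integral model with \<open>c\<^sub>4 = 0\<close> has \<open>c\<^sub>6\<close> divisible by 27,
  which excludes scaling the model by 3 although its discriminant has valuation 13.\<close>

lemma Et_minimal_3_exactly_divides:
  assumes p3: "p = 3" and a3: "V 1 \<alpha>" "\<not> V 2 \<alpha>"
  shows "p_minimal p (Et_C3 a) (0, 0, \<alpha>, 0, - (7 * \<alpha>^2))"
proof (rule p_minimalI[OF Et_tuple[symmetric] _ _ disc_nonzero(2)])
  show "integral_model p (0, 0, \<alpha>, 0, - (7 * \<alpha>^2))"
    unfolding integral_model_tuple by (intro conjI vge_mult_0 vge_minus[THEN iffD2] vge_power_0 vge_0 vge_numeral V_a)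
  fix u r s t :: rat
  assume u: "u \<noteq> 0" and int: "integral_model p (chg (0, 0, \<alpha>, 0, - (7 * \<alpha>^2)) u r s t)"
  obtain b1 b2 b3 b4 b6 where B: "(b1, b2, b3, b4, b6) = chg (0, 0, \<alpha>, 0, - (7 * \<alpha>^2)) u r s t"
    by (metis prod.collapse)
  have b: "V 0 b1" "V 0 b2" "V 0 b3" "V 0 b4" "V 0 b6"
    using int[unfolded B[symmetric] integral_model_tuple] by auto
  define B2 B4 B6 where "B2 = b1^2 + 4 * b2" and "B4 = 2 * b4 + b1 * b3" and "B6 = b3^2 + 4 * b6"
  have inv: "u^2 * B2 = 12 * r" "u^4 * B4 = 6 * r^2" "u^6 * B6 = 4 * r^3 - 27 * \<alpha>^2"
    using chg_b_invariants(1-3)[OF u B] unfolding B2_def B4_def B6_def by simp_all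
  have V: "V 0 B2" "V 0 B4" "V 0 B6"
    unfolding B2_def B4_def B6_def by (intro vge_add vge_mult_0 vge_power_0 b vge_numeral)+
  \<comment> \<open>This is c4, which vanishes because j = 0; it forces 3 to divide
    \<open>B2\<close>.\<close>
  have "u^4 * (B2^2 - 24 * B4) = 0" using inv by Groebner_Basis.algebra
  then have c4: "B2 * B2 = 24 * B4" using u by (simp add: power2_eq_square)
  have num: "V 1 24" "V 2 36" "V 3 216" "\<not> V 7 5832"
    using vge_of_int_iff[of 1 24] vge_of_int_iff[of 2 36] vge_of_int_iff[of 3 216] vge_of_int_iff[of 7 5832] p3
    by simp_all
  have "V 1 (B2 * B2)" unfolding c4 by (rule vge_mult_0'[OF V(2) num(1)])
  then have B2: "V 1 B2" using not_vge_mult[of 0 B2 0 B2] by auto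
  have BB: "V 2 (B2 * B2)" by (rule vge_mult_le[OF B2 B2]) simp
  \<comment> \<open>The transformation of c6. On the right 5832 = 2^3 3^6 gives valuation 6 + 2 = 8,
    while v(u) >= 1 and integrality would give at least 6 + 3 = 9 on the left.\<close>
  have c6: "u^6 * (- (B2 * (B2 * B2)) + 36 * (B2 * B4) - 216 * B6) = 5832 * \<alpha>^2"
    using inv by Groebner_Basis.algebra
  have V3: "V 3 (- (B2 * (B2 * B2)) + 36 * (B2 * B4) - 216 * B6)"
    by (intro vge_add vge_diff vge_minus[THEN iffD2] vge_mult_le[OF B2 BB] vge_mult_0'[OF V(3) num(3)]
        vge_mult_le[OF num(2) vge_mult_0'[OF V(2) B2]]) auto
  show "\<not> V 1 u"
  proof
    assume "V 1 u"
    then have "V 6 (u^6)" using vge_power[of 1 u 6] by simp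
    then have "V 9 (5832 * \<alpha>^2)" unfolding c6[symmetric] using vge_mult[OF _ V3, of 6 "u^6"] by simp
    moreover have "\<not> V 3 (\<alpha>^2)" using not_vge_mult[of 1 \<alpha> 1 \<alpha>] a3 by (simp add: power2_eq_square)
    ultimately show False using not_vge_mult[of 6 5832 2 "\<alpha>^2"] num(4) by simp
  qed
qed simp

text \<open>Type II*. With w = 2 y + a the equation is w^2 = 4 z^3 - 27 a^2, and 27 a^2 has
  valuation exactly 5. At a singular point the bounds rise to v(z) >= 2 and v(w) >= 3, so all other
  terms are divisible by 3^6.\<close>

lemma Et_tamagawa_3_exactly_divides:
  assumes p3: "p = 3" and a3: "V 1 \<alpha>" "\<not> V 2 \<alpha>"
  shows "tamagawa p (Et_C3 a) = 1"
proof (rule tamagawa_eq[OF Et_minimal_3_exactly_divides[OF assms] disc_nonzero(2) _ a3(1)])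
  have aa: "V 2 (\<alpha> * \<alpha>)" using vge_mult[OF a3(1) a3(1)] by simp
  then have "V 1 (\<alpha>^2)" unfolding power2_eq_square by (rule vge_mono) simp
  then show "V 1 (- (7 * \<alpha>^2))" by (rule vge_minus[THEN iffD2, OF vge_mult_0[OF vge_numeral]])
  fix u r s t assume tf: "tate_form p 0 \<alpha> 0 (- (7 * \<alpha>^2)) u r s t"
  interpret tate_form p 0 \<alpha> 0 "- (7 * \<alpha>^2)" u r s t by (rule tf)
  show "E0_index p (chg (0, 0, \<alpha>, 0, - (7 * \<alpha>^2)) u r s t) = 1"
  proof (rule E0_index_no_singular_points)
    fix z y assume z: "V 1 z" and y: "V 1 y"
    show "\<not> V 8 (weq T z y)"
    proof
      assume F: "V 8 (weq T z y)"
      define w where "w = 2 * y + \<alpha>"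
      have eq: "w * w = 4 * weq T z y + (4 * (z * (z * z)) - 27 * (\<alpha> * \<alpha>))"
        by (simp add: weq_tuple w_def power2_eq_square power3_eq_cube algebra_simps)
      have F4: "V 8 (4 * weq T z y)" by (rule vge_mult_0[OF vge_numeral F])
      have a5: "V 5 (27 * (\<alpha> * \<alpha>))" by (rule vge_mult_le[OF vge_3_numerals(5)[OF p3] aa]) simp
      have zz: "V 2 (z * z)" by (rule vge_mult_le[OF z z]) simp
      have "V 3 (w * w)"
        unfolding eq by (intro vge_add[OF vge_mono[OF F4] vge_diff] vge_mult_0[OF vge_numeral]
            vge_mult_le[OF z zz] vge_mono[OF a5]) auto
      then have w2: "V 2 w" using vge_square_cancel[of 2 w] by simp
      have "V 4 (w * w)" by (rule vge_mult_le[OF w2 w2]) simp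
      then have "V 4 (4 * (z * (z * z)))"
        unfolding eq using vge_add_iff[OF vge_mono[OF F4], of 4] vge_diff_iff'[OF vge_mono[OF a5], of 4] by simp
      then have "V 4 (z * (z * z))"
        using vge_cancel[of 0 4 4 "z * (z * z)"] vge_3_numerals(8)[OF p3] by simp
      then have z2: "V 2 z" using vge_2_if_cube[OF z, of 0] by simp
      have zz: "V 4 (z * z)" by (rule vge_mult_le[OF z2 z2]) simp
      have z6: "V 6 (4 * (z * (z * z)))" by (rule vge_mult_0[OF vge_numeral vge_mult_le[OF z2 zz]]) simp
      have "V 5 (w * w)"
        unfolding eq by (intro vge_add[OF vge_mono[OF F4] vge_diff[OF vge_mono[OF z6] a5]]) auto
      then have w3: "V 3 w" using vge_square_cancel[of 3 w] by simp
      have w6: "V 6 (w * w)" by (rule vge_mult_le[OF w3 w3]) simp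
      have "27 * (\<alpha> * \<alpha>) = 4 * weq T z y + 4 * (z * (z * z)) - w * w" unfolding eq by simp
      moreover have "V 6 \<dots>" by (intro vge_diff[OF vge_add[OF vge_mono[OF F4] z6] w6]) auto
      ultimately have "V 6 (27 * (\<alpha> * \<alpha>))" by (simp only:)
      moreover have "\<not> V 3 (\<alpha> * \<alpha>)" using not_vge_mult[of 1 \<alpha> 1 \<alpha>] a3 by simp
      ultimately show False using not_vge_mult[of 3 27 2 "\<alpha> * \<alpha>"] vge_3_numerals(6)[OF p3] by simp
    qed
  qed
qed simp_all

text \<open>Completing the square leaves the constant -27 a^2/4, and scaling by u = 3 divides it by
  3^6. For v(a) = 2 the result has valuation 3 + 4 - 6 = 1.\<close>

lemma Et_9_model: "chg (Et_C3 a) 3 0 0 (- (\<alpha> / 2)) = (0, 0, 0, 0, - (\<alpha>^2 / 108))"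
  by (simp add: Et_C3_def chg_def power2_eq_square field_simps)

lemma Et_9_conditions:
  assumes p3: "p = 3" and a9: "V 2 \<alpha>"
  shows "V 1 (- (\<alpha>^2 / 108))" "\<not> V 2 (- (\<alpha>^2 / 108))"
    "p_minimal p (Et_C3 a) (0, 0, 0, 0, - (\<alpha>^2 / 108))"
proof -
  let ?k = "- (\<alpha>^2 / 108)"
  have num: "\<not> V 4 108" "V 3 108" "\<not> V 4 432" using vge_of_int_iff[of 4 108] vge_of_int_iff[of 3 108] vge_of_int_iff[of 4 432] p3 by simp_all
  have "V 4 (\<alpha>^2)" using vge_power[OF a9, of 2] by simp
  then have "V 1 (\<alpha>^2 / 108)" using vge_divide[of 4 "\<alpha>^2" 3 108] num by simp
  then show k1: "V 1 ?k" by simp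
  show k2: "\<not> V 2 ?k"
  proof
    assume "V 2 ?k"
    then have "V 2 (\<alpha>^2 / 108)" by simp
    then have "V 5 (108 * (\<alpha>^2 / 108))" by (intro vge_mult_le[OF num(2)]) auto
    then have "V 5 (\<alpha> * \<alpha>)" by (simp add: power2_eq_square)
    then show False using not_vge_mult[of 2 \<alpha> 2 \<alpha>] not_vge_3_a by simp
  qed
  show "p_minimal p (Et_C3 a) (0, 0, 0, 0, ?k)"
  proof (rule p_minimal_if_disc_lt_12[OF Et_9_model[symmetric] _ _ disc_nonzero(2)])
    show "integral_model p (0, 0, 0, 0, ?k)"
      unfolding integral_model_tuple by (intro conjI vge_0 vge_mono[OF k1]) simp
    have "\<not> V 3 (?k * ?k)" using not_vge_mult[of 1 ?k 1 ?k] k2 by simp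
    then have "\<not> V 6 (432 * (?k * ?k))" using not_vge_mult[of 3 432 2 "?k * ?k"] num(3) by simp
    then have n: "\<not> V 12 (432 * (?k * ?k))" using vge_mono[of 12 "432 * (?k * ?k)" 6] by linarith
    have d: "disc (0, 0, 0, 0, ?k) = - (432 * (?k * ?k))"
      by (simp add: disc_tuple power2_eq_square)
    show "\<not> V 12 (disc (0, 0, 0, 0, ?k))" unfolding d vge_minus by (rule n)
  qed simp
qed

text \<open>The rescaled model has type II: its constant has valuation exactly 1, against at least 2
  for y^2 and z^3 at a singular point.\<close>

lemma Et_tamagawa_9:
  assumes p3: "p = 3" and a9: "V 2 \<alpha>"
  shows "tamagawa p (Et_C3 a) = 1"
proof -
  note cond = Et_9_conditions[OF assms]
  let ?k = "- (\<alpha>^2 / 108)"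
  show ?thesis
  proof (rule tamagawa_eq[OF cond(3) disc_nonzero(2) _ _ _ cond(1)])
    fix u r s t assume tf: "tate_form p 0 0 0 ?k u r s t"
    show "E0_index p (chg (0, 0, 0, 0, ?k) u r s t) = 1"
    proof (rule tate_form.E0_index_no_singular_points[OF tf])
      fix z y assume z: "V 1 z" and y: "V 1 y"
      show "\<not> V 8 (weq (0, 0, 0, 0, ?k) z y)"
      proof
        assume F: "V 8 (weq (0, 0, 0, 0, ?k) z y)"
        have zz: "V 2 (z * z)" by (rule vge_mult_le[OF z z]) simp
        have "?k = y * y - z * (z * z) - weq (0, 0, 0, 0, ?k) z y"
          by (simp add: weq_tuple power2_eq_square power3_eq_cube)
        moreover have "V 2 \<dots>"
          by (intro vge_diff[OF vge_diff[OF vge_mult_le[OF y y] vge_mult_le[OF z zz]] vge_mono[OF F]]) auto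
        ultimately show False using cond(2) by (simp only:)
      qed
    qed
  qed simp_all
qed

text \<open>The given equation is minimal except at 3 with 9 dividing \<open>a\<close>; there the
  rescaled model still has a discriminant divisible by 3.\<close>

lemma Et_bad_reduction: "bad_reduction p (Et_C3 a) \<longleftrightarrow> int p dvd 3 * a"
proof (cases "p = 3 \<and> V 2 \<alpha>")
  case True
  let ?k = "- (\<alpha>^2 / 108)"
  have cond: "V 1 ?k" "p_minimal p (Et_C3 a) (0, 0, 0, 0, ?k)"
    using Et_9_conditions True by auto
  have d: "disc (0, 0, 0, 0, ?k) = - (432 * (?k * ?k))"
    by (simp add: disc_tuple power2_eq_square)
  have "V 1 (432 * (?k * ?k))" by (intro vge_mult_0[OF vge_numeral] vge_mult_le[OF cond(1) cond(1)]) simp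
  then have "V 1 (disc (0, 0, 0, 0, ?k))" unfolding d by (simp only: vge_minus)
  moreover have "disc (0, 0, 0, 0, ?k) \<noteq> 0" unfolding d using a by simp
  ultimately show ?thesis using bad_reduction_iff[OF cond(2)] rat_val_pos_iff True by simp
next
  case False
  have "p_minimal p (Et_C3 a) (0, 0, \<alpha>, 0, - (7 * \<alpha>^2))"
  proof (cases "p = 3 \<and> V 1 \<alpha>")
    case True
    then show ?thesis using Et_minimal_3_exactly_divides False by blast
  next
    case False
    then show ?thesis
      by (intro Et_minimal[OF Et_tuple])
        (unfold integral_model_tuple, intro conjI vge_mult_0 vge_minus[THEN iffD2] vge_power_0 vge_0 vge_numeral V_a, blast)
  qed
  from bad_reduction_iff[OF this] show ?thesis
    using disc_Et rat_val_pos_iff[OF disc_nonzero(2)] vge_disc[of 9]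
    by (simp add: Et_C3_def)
qed

end

theorem theorem3p1:
  fixes a :: int and p :: nat
  assumes "a > 0" and "cubefree a" and "prime p"
  shows "(bad_reduction p (E_C3 a) \<longleftrightarrow> int p dvd 3 * a)
       \<and> (bad_reduction p (Et_C3 a) \<longleftrightarrow> int p dvd 3 * a)
       \<and> (p \<noteq> 3 \<and> int p dvd a \<longrightarrow>
            tamagawa p (E_C3 a) = 3
          \<and> (p mod 6 = 1 \<longrightarrow> tamagawa p (Et_C3 a) = 3)
          \<and> (p mod 6 = 2 \<or> p mod 6 = 5 \<longrightarrow> tamagawa p (Et_C3 a) = 1))
       \<and> (p = 3 \<longrightarrow>
            (a mod 9 = 1 \<or> a mod 9 = 8 \<longrightarrow> tamagawa 3 (E_C3 a) = 1 \<and> tamagawa 3 (Et_C3 a) = 3)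
          \<and> (a mod 9 = 2 \<or> a mod 9 = 7 \<longrightarrow> tamagawa 3 (E_C3 a) = 2 \<and> tamagawa 3 (Et_C3 a) = 2)
          \<and> (a mod 9 = 4 \<or> a mod 9 = 5 \<longrightarrow> tamagawa 3 (E_C3 a) = 1 \<and> tamagawa 3 (Et_C3 a) = 1)
          \<and> (a mod 3 = 0 \<longrightarrow> tamagawa 3 (E_C3 a) = 3 \<and> tamagawa 3 (Et_C3 a) = 1))"
proof -
  interpret cubefree_padic p a
    using assms by unfold_locales auto
  have "tamagawa p (Et_C3 a) = 1" if "p = 3" "a mod 3 = 0"
  proof (cases "vge p 2 (of_int a)")
    case True
    then show ?thesis using Et_tamagawa_9 that by blast
  next
    case False
    have "vge p 1 (of_int a)" using vge_a that by auto
    then show ?thesis using Et_tamagawa_3_exactly_divides False that by blast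
  qed
  moreover have "tamagawa p (E_C3 a) = 3" if "p = 3" "a mod 3 = 0"
    using E_tamagawa_dvd that by auto
  ultimately have three: "(a mod 9 = 1 \<or> a mod 9 = 8 \<longrightarrow> tamagawa 3 (E_C3 a) = 1 \<and> tamagawa 3 (Et_C3 a) = 3)
          \<and> (a mod 9 = 2 \<or> a mod 9 = 7 \<longrightarrow> tamagawa 3 (E_C3 a) = 2 \<and> tamagawa 3 (Et_C3 a) = 2)
          \<and> (a mod 9 = 4 \<or> a mod 9 = 5 \<longrightarrow> tamagawa 3 (E_C3 a) = 1 \<and> tamagawa 3 (Et_C3 a) = 1)
          \<and> (a mod 3 = 0 \<longrightarrow> tamagawa 3 (E_C3 a) = 3 \<and> tamagawa 3 (Et_C3 a) = 1)" if "p = 3"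
    using E_tamagawa_1 E_tamagawa_2 Et_tamagawa_1_unit Et_tamagawa_2 Et_tamagawa_3 that by simp
  have "p \<noteq> 3 \<and> int p dvd a \<longrightarrow>
            tamagawa p (E_C3 a) = 3
          \<and> (p mod 6 = 1 \<longrightarrow> tamagawa p (Et_C3 a) = 3)
          \<and> (p mod 6 = 2 \<or> p mod 6 = 5 \<longrightarrow> tamagawa p (Et_C3 a) = 1)"
    using E_tamagawa_dvd Et_tamagawa_split Et_tamagawa_nonsplit by blast
  from conjI[OF E_bad_reduction conjI[OF Et_bad_reduction conjI[OF this impI[OF three]]]]
  show ?thesis .
qed

end
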